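(* Let $R$ be a rig in $\mathscr V$. Then the theory of left $R$-modules $\mathrm{Mat}_R$ and the theory of right $R$-modules $\mathrm{Mat}_{R^{\mathrm{op}}}$ are commutants of one another over the full theory $\underline{\mathscr V}_R$ of $R$ in $\underline{\mathscr V}$.
   Context: $\mathscr V$ is a locally small cartesian closed category with equalizers, countable colimits, and intersections of countable families of strong subobjects; $\underline{\mathscr V}$ is $\mathscr V$ as a $\mathscr V$-category, with internal homs $\underline{\mathscr V}(V,W)$. Algebraic formulas below are to be read for generalized elements. \emph{Theories.} A theory (discretely finitary, enriched in $\mathscr V$) is a $\mathscr V$-category $\mathscr T$ whose objects are the natural numbers, equipped for each $n$ with morphisms $\pi_i:n\to1$ ($1\le i\le n$) exhibiting $n$ as a conical ($\mathscr V$-enriched) $n$-th power of $1$, with $\pi_1=\mathrm{id}$ if $n=1$. Morphisms of theories are identity-on-objects $\mathscr V$-functors preserving the designated $\pi_i$; $\mathrm{Th}$ is the resulting category. A $\mathscr T$-algebra is a $\mathscr V$-functor $A:\mathscr T\to\underline{\mathscr V}$ preserving conical finite powers, with carrier $|A|=A(1)$. $\mathscr T\text{-Alg}$ is the $\mathscr V$-category of $\mathscr T$-algebras, with hom-objects the objects of $\mathscr V$-natural transformations; limits in it are pointwise. \emph{Commutants.} For $X\in\mathscr V$, the full theory $\underline{\mathscr V}_X$ has $\underline{\mathscr V}_X(n,m)=\underline{\mathscr V}(X^n,X^m)$, composition as in $\underline{\mathscr V}$, and the product projections as designated $\pi_i$. A theory over $\underline{\mathscr V}_X$ is a theory $\mathscr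 T$ with a morphism $A:\mathscr T\to\underline{\mathscr V}_X$; it amounts to a $\mathscr T$-algebra $n\mapsto X^n$ with carrier $X$, also called $A$. Its commutant $\mathscr T^\perp$ is the theory with $\mathscr T^\perp(n,m)=\mathscr T\text{-Alg}(A^n,A^m)$ (powers of $A$ in $\mathscr T\text{-Alg}$), with composition as in $\mathscr T\text{-Alg}$; the forgetful morphisms $\mathscr T\text{-Alg}(A^n,A^m)\hookrightarrow\underline{\mathscr V}(X^n,X^m)$ make $\mathscr T^\perp$ a theory over $\underline{\mathscr V}_X$. Theories $\mathscr T,\mathscr U$ over $\underline{\mathscr V}_X$ are commutants of one another if $\mathscr T\cong\mathscr U^\perp$ and $\mathscr U\cong\mathscr T^\perp$ in the slice category $\mathrm{Th}/\underline{\mathscr V}_X$. \emph{Rigs.} A rig in $\mathscr V$ is an object $R$ with a commutative monoid structure $(+,0)$ and a monoid structure $(\bullet,1)$ in $\mathscr V$ such that $\bullet$ preserves $+$ and $0$ in each variable separately; $R^{\mathrm{op}}$ is the rig with reversed multiplication; right $R$-modules are left $R^{\mathrm{op}}$-modules. \emph{Matrices.} $\mathrm{Mat}_R$ is the theory with $\mathrm{Mat}_R(n,m)=R^{m\times n}$, composition given by matrix multiplication $(b,a)\mapsto ba$, $(ba)_{ki}=\sum_jb_{kj}a_{ji}$, identities the identity matrices, and designated projections $\pi_i:n\to1$ the standard basis row vectors. Its normal algebras are the left $R$-modules. The left $R$-module $R$ makes $\mathrm{Mat}_R$ a theory over $\underline{\mathscr V}_R$, via $a\in R^{m\times n}\mapsto\big(x\mapsto(\sum_ia_{ji}x_i)_j\big)$;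 similarly $\mathrm{Mat}_{R^{\mathrm{op}}}$ (matrices over the rig $R^{\mathrm{op}}$) is a theory over $\underline{\mathscr V}_R$ via the right $R$-module $R$, i.e. via $a\mapsto\big(x\mapsto(\sum_ix_ia_{ji})_j\big)$, products being taken in $R$. *)

theory Defs
  imports Main
begin

section \<open>Categories\<close>

record ('o, 'm) cat =
  Obj :: "'o set"
  Arr :: "'m set"
  Dom :: "'m \<Rightarrow> 'o"
  Cod :: "'m \<Rightarrow> 'o"
  Cmp :: "'m \<Rightarrow> 'm \<Rightarrow> 'm"  (infixr "\<cdot>\<index>" 70)
  Idt :: "'o \<Rightarrow> 'm"

definition hom :: "('o, 'm, 'x) cat_scheme \<Rightarrow> 'o \<Rightarrow> 'o \<Rightarrow> 'm set" where
  "hom C a b = {f \<in> Arr C. Dom C f = a \<and> Cod C f = b}"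

text \<open>Local smallness is built in: every \<open>hom C a b\<close> is a HOL set.\<close>

locale category =
  fixes C :: "('o, 'm, 'x) cat_scheme" (structure)
  assumes Dom_in: "f \<in> Arr C \<Longrightarrow> Dom C f \<in> Obj C"
    and Cod_in: "f \<in> Arr C \<Longrightarrow> Cod C f \<in> Obj C"
    and Idt_in: "a \<in> Obj C \<Longrightarrow> Idt C a \<in> hom C a a"
    and Cmp_in: "\<lbrakk>f \<in> hom C a b; g \<in> hom C b c\<rbrakk> \<Longrightarrow> g \<cdot> f \<in> hom C a c"
    and Idt_left: "f \<in> hom C a b \<Longrightarrow> Idt C b \<cdot> f = f"
    and Idt_right: "f \<in> hom C a b \<Longrightarrow> f \<cdot> Idt C a = f"
    and Cmp_assoc: "\<lbrakk>f \<in> hom C a b; g \<in> hom C b c; h \<in> hom C c d\<rbrakk>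
      \<Longrightarrow> (h \<cdot> g) \<cdot> f = h \<cdot> (g \<cdot> f)"

definition isomorphic :: "('o, 'm, 'x) cat_scheme \<Rightarrow> 'o \<Rightarrow> 'o \<Rightarrow> bool" where
  "isomorphic C a b \<longleftrightarrow> a \<in> Obj C \<and> b \<in> Obj C \<and>
    (\<exists>f \<in> hom C a b. \<exists>g \<in> hom C b a. g \<cdot>\<^bsub>C\<^esub> f = Idt C a \<and> f \<cdot>\<^bsub>C\<^esub> g = Idt C b)"

definition slice :: "('o, 'm, 'x) cat_scheme \<Rightarrow> 'o \<Rightarrow> ('m, 'm \<times> 'm \<times> 'm) cat" where
  "slice C X =
    \<lparr>Obj = {f \<in> Arr C. Cod C f = X},
     Arr = {(f, h, g). f \<in> Arr C \<and> Cod C f = X \<and> g \<in> Arr C \<and> Cod C g = X \<and>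
                       h \<in> hom C (Dom C f) (Dom C g) \<and> g \<cdot>\<^bsub>C\<^esub> h = f},
     Dom = (\<lambda>(f, h, g). f),
     Cod = (\<lambda>(f, h, g). g),
     Cmp = (\<lambda>(g, k, l) (f, h, g'). (f, k \<cdot>\<^bsub>C\<^esub> h, l)),
     Idt = (\<lambda>f. (f, Idt C (Dom C f), f))\<rparr>"

subsection \<open>Equalizers, countable colimits, countable intersections of strong subobjects\<close>

definition has_equalizers :: "('o, 'm, 'x) cat_scheme \<Rightarrow> bool" where
  "has_equalizers C \<longleftrightarrow> (\<forall>a b. \<forall>f \<in> hom C a b. \<forall>g \<in> hom C a b.
    \<exists>s. \<exists>e \<in> hom C s a. f \<cdot>\<^bsub>C\<^esub> e = g \<cdot>\<^bsub>C\<^esub> e \<and>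
      (\<forall>z. \<forall>h \<in> hom C z a. f \<cdot>\<^bsub>C\<^esub> h = g \<cdot>\<^bsub>C\<^esub> h \<longrightarrow>
        (\<exists>!k. k \<in> hom C z s \<and> e \<cdot>\<^bsub>C\<^esub> k = h)))"

definition is_functor ::
  "('i, 'j, 'x) cat_scheme \<Rightarrow> ('o, 'm, 'y) cat_scheme \<Rightarrow> ('i \<Rightarrow> 'o) \<Rightarrow> ('j \<Rightarrow> 'm) \<Rightarrow> bool" where
  "is_functor J C Fo Fa \<longleftrightarrow>
    (\<forall>i \<in> Obj J. Fo i \<in> Obj C \<and> Fa (Idt J i) = Idt C (Fo i)) \<and>
    (\<forall>i j. \<forall>u \<in> hom J i j. Fa u \<in> hom C (Fo i) (Fo j)) \<and>
    (\<forall>i j k. \<forall>u \<in> hom J i j. \<forall>v \<in> hom J j k. Fa (v \<cdot>\<^bsub>J\<^esub> u) = Fa v \<cdot>\<^bsub>C\<^esub> Fa u)"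

definition is_cocone ::
  "('i, 'j, 'x) cat_scheme \<Rightarrow> ('o, 'm, 'y) cat_scheme \<Rightarrow> ('i \<Rightarrow> 'o) \<Rightarrow> ('j \<Rightarrow> 'm)
    \<Rightarrow> 'o \<Rightarrow> ('i \<Rightarrow> 'm) \<Rightarrow> bool" where
  "is_cocone J C Fo Fa L c \<longleftrightarrow> L \<in> Obj C \<and>
    (\<forall>i \<in> Obj J. c i \<in> hom C (Fo i) L) \<and>
    (\<forall>i j. \<forall>u \<in> hom J i j. c j \<cdot>\<^bsub>C\<^esub> Fa u = c i)"

text \<open>Every category with countably many arrows is isomorphic to one whose objects and
  arrows are natural numbers, so it suffices to consider diagrams of the following shape.\<close>

definition has_countable_colimits :: "('o, 'm, 'x) cat_scheme \<Rightarrow> bool" where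
  "has_countable_colimits C \<longleftrightarrow>
    (\<forall>(J :: (nat, nat) cat) Fo Fa. category J \<and> is_functor J C Fo Fa \<longrightarrow>
      (\<exists>L c. is_cocone J C Fo Fa L c \<and>
        (\<forall>Z d. is_cocone J C Fo Fa Z d \<longrightarrow>
          (\<exists>!h. h \<in> hom C L Z \<and> (\<forall>i \<in> Obj J. h \<cdot>\<^bsub>C\<^esub> c i = d i)))))"

definition is_mono :: "('o, 'm, 'x) cat_scheme \<Rightarrow> 'm \<Rightarrow> bool" where
  "is_mono C m \<longleftrightarrow> m \<in> Arr C \<and>
    (\<forall>z. \<forall>f \<in> hom C z (Dom C m). \<forall>g \<in> hom C z (Dom C m). m \<cdot>\<^bsub>C\<^esub> f = m \<cdot>\<^bsub>C\<^esub> g \<longrightarrow> f = g)"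

definition is_epi :: "('o, 'm, 'x) cat_scheme \<Rightarrow> 'm \<Rightarrow> bool" where
  "is_epi C e \<longleftrightarrow> e \<in> Arr C \<and>
    (\<forall>z. \<forall>f \<in> hom C (Cod C e) z. \<forall>g \<in> hom C (Cod C e) z. f \<cdot>\<^bsub>C\<^esub> e = g \<cdot>\<^bsub>C\<^esub> e \<longrightarrow> f = g)"

definition is_strong_mono :: "('o, 'm, 'x) cat_scheme \<Rightarrow> 'm \<Rightarrow> bool" where
  "is_strong_mono C m \<longleftrightarrow> is_mono C m \<and>
    (\<forall>e. is_epi C e \<longrightarrow>
      (\<forall>u \<in> hom C (Dom C e) (Dom C m). \<forall>v \<in> hom C (Cod C e) (Cod C m).
        m \<cdot>\<^bsub>C\<^esub> u = v \<cdot>\<^bsub>C\<^esub> e \<longrightarrow>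
          (\<exists>d \<in> hom C (Cod C e) (Dom C m). d \<cdot>\<^bsub>C\<^esub> e = u \<and> m \<cdot>\<^bsub>C\<^esub> d = v)))"

text \<open>An intersection of a family of subobjects of \<open>X\<close> is its wide pullback; it is again
  (represented by) a monomorphism into \<open>X\<close>.\<close>

definition is_intersection ::
  "('o, 'm, 'x) cat_scheme \<Rightarrow> 'o \<Rightarrow> 'i set \<Rightarrow> ('i \<Rightarrow> 'm) \<Rightarrow> 'm \<Rightarrow> bool" where
  "is_intersection C X I s m \<longleftrightarrow> m \<in> Arr C \<and> Cod C m = X \<and>
    (\<forall>i \<in> I. \<exists>k \<in> hom C (Dom C m) (Dom C (s i)). s i \<cdot>\<^bsub>C\<^esub> k = m) \<and>
    (\<forall>z. \<forall>f \<in> hom C z X. (\<forall>i \<in> I. \<exists>k \<in> hom C z (Dom C (s i)). s i \<cdot>\<^bsub>C\<^esub> k = f) \<longrightarrow>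
      (\<exists>!h. h \<in> hom C z (Dom C m) \<and> m \<cdot>\<^bsub>C\<^esub> h = f))"

definition has_countable_strong_intersections :: "('o, 'm, 'x) cat_scheme \<Rightarrow> bool" where
  "has_countable_strong_intersections C \<longleftrightarrow>
    (\<forall>X \<in> Obj C. \<forall>(I :: nat set) s. (\<forall>i \<in> I. is_strong_mono C (s i) \<and> Cod C (s i) = X) \<longrightarrow>
      (\<exists>m. is_intersection C X I s m))"

section \<open>Cartesian closed categories\<close>

text \<open>The cartesian closed structure is chosen; \<open>IHom V a b\<close> is the exponential of \<open>b\<close> by
  \<open>a\<close>, with evaluation \<open>Ev V a b\<close> from \<open>IHom V a b \<times> a\<close> to \<open>b\<close>.\<close>

record ('o, 'm) ccc = "('o, 'm) cat" +
  Trm :: "'o"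
  Prd :: "'o \<Rightarrow> 'o \<Rightarrow> 'o"
  Pr1 :: "'o \<Rightarrow> 'o \<Rightarrow> 'm"
  Pr2 :: "'o \<Rightarrow> 'o \<Rightarrow> 'm"
  IHom :: "'o \<Rightarrow> 'o \<Rightarrow> 'o"
  Ev :: "'o \<Rightarrow> 'o \<Rightarrow> 'm"

definition bang :: "('o, 'm) ccc \<Rightarrow> 'o \<Rightarrow> 'm" where
  "bang V z = (THE h. h \<in> hom V z (Trm V))"

definition pair :: "('o, 'm) ccc \<Rightarrow> 'm \<Rightarrow> 'm \<Rightarrow> 'm" where
  "pair V f g = (THE h. h \<in> hom V (Dom V f) (Prd V (Cod V f) (Cod V g)) \<and>
    Pr1 V (Cod V f) (Cod V g) \<cdot>\<^bsub>V\<^esub> h = f \<and> Pr2 V (Cod V f) (Cod V g) \<cdot>\<^bsub>V\<^esub> h = g)"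

definition vcurry :: "('o, 'm) ccc \<Rightarrow> 'o \<Rightarrow> 'o \<Rightarrow> 'o \<Rightarrow> 'm \<Rightarrow> 'm" where
  "vcurry V z a b f = (THE h. h \<in> hom V z (IHom V a b) \<and>
    Ev V a b \<cdot>\<^bsub>V\<^esub> pair V (h \<cdot>\<^bsub>V\<^esub> Pr1 V z a) (Pr2 V z a) = f)"

locale cartesian_closed = category V for V :: "('o, 'm) ccc" (structure) +
  assumes Trm_in: "Trm V \<in> Obj V"
    and Trm_univ: "z \<in> Obj V \<Longrightarrow> \<exists>!h. h \<in> hom V z (Trm V)"
    and Prd_in: "\<lbrakk>a \<in> Obj V; b \<in> Obj V\<rbrakk> \<Longrightarrow> Prd V a b \<in> Obj V"
    and Pr1_in: "\<lbrakk>a \<in> Obj V; b \<in> Obj V\<rbrakk> \<Longrightarrow> Pr1 V a b \<in> hom V (Prd V a b) a"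
    and Pr2_in: "\<lbrakk>a \<in> Obj V; b \<in> Obj V\<rbrakk> \<Longrightarrow> Pr2 V a b \<in> hom V (Prd V a b) b"
    and Prd_univ: "\<lbrakk>f \<in> hom V z a; g \<in> hom V z b\<rbrakk>
      \<Longrightarrow> \<exists>!h. h \<in> hom V z (Prd V a b) \<and> Pr1 V a b \<cdot> h = f \<and> Pr2 V a b \<cdot> h = g"
    and IHom_in: "\<lbrakk>a \<in> Obj V; b \<in> Obj V\<rbrakk> \<Longrightarrow> IHom V a b \<in> Obj V"
    and Ev_in: "\<lbrakk>a \<in> Obj V; b \<in> Obj V\<rbrakk> \<Longrightarrow> Ev V a b \<in> hom V (Prd V (IHom V a b) a) b"
    and IHom_univ: "\<lbrakk>z \<in> Obj V; a \<in> Obj V; b \<in> Obj V; f \<in> hom V (Prd V z a) b\<rbrakk>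
      \<Longrightarrow> \<exists>!h. h \<in> hom V z (IHom V a b) \<and>
            Ev V a b \<cdot> pair V (h \<cdot> Pr1 V z a) (Pr2 V z a) = f"

locale base_category = cartesian_closed +
  assumes equalizers: "has_equalizers V"
    and countable_colimits: "has_countable_colimits V"
    and countable_strong_intersections: "has_countable_strong_intersections V"

subsection \<open>Finite powers\<close>

text \<open>Tuples and matrices are indexed from \<open>0\<close>. The first power of \<open>X\<close> is \<open>X\<close> itself.\<close>

fun pow :: "('o, 'm) ccc \<Rightarrow> 'o \<Rightarrow> nat \<Rightarrow> 'o" where
  "pow V X 0 = Trm V"
| "pow V X (Suc 0) = X"
| "pow V X (Suc (Suc n)) = Prd V (pow V X (Suc n)) X"

fun pproj :: "('o, 'm) ccc \<Rightarrow> 'o \<Rightarrow> nat \<Rightarrow> nat \<Rightarrow> 'm" where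
  "pproj V X 0 i = undefined"
| "pproj V X (Suc 0) i = Idt V X"
| "pproj V X (Suc (Suc n)) i =
    (if i = Suc n then Pr2 V (pow V X (Suc n)) X
     else pproj V X (Suc n) i \<cdot>\<^bsub>V\<^esub> Pr1 V (pow V X (Suc n)) X)"

definition tuple :: "('o, 'm) ccc \<Rightarrow> 'o \<Rightarrow> 'o \<Rightarrow> nat \<Rightarrow> (nat \<Rightarrow> 'm) \<Rightarrow> 'm" where
  "tuple V z X n f =
    (THE h. h \<in> hom V z (pow V X n) \<and> (\<forall>i < n. pproj V X n i \<cdot>\<^bsub>V\<^esub> h = f i))"

definition is_power :: "('o, 'm) ccc \<Rightarrow> nat \<Rightarrow> 'o \<Rightarrow> 'o \<Rightarrow> (nat \<Rightarrow> 'm) \<Rightarrow> bool" where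
  "is_power V n P X p \<longleftrightarrow> P \<in> Obj V \<and> X \<in> Obj V \<and> (\<forall>i < n. p i \<in> hom V P X) \<and>
    (\<forall>z \<in> Obj V. \<forall>f. (\<forall>i < n. f i \<in> hom V z X) \<longrightarrow>
      (\<exists>!h. h \<in> hom V z P \<and> (\<forall>i < n. p i \<cdot>\<^bsub>V\<^esub> h = f i)))"

section \<open>Enriched categories\<close>

text \<open>\<open>VCmp C a b c\<close> goes from \<open>VHom C b c \<times> VHom C a b\<close> to \<open>VHom C a c\<close>.\<close>

record ('c, 'o, 'm) vcat =
  VObj :: "'c set"
  VHom :: "'c \<Rightarrow> 'c \<Rightarrow> 'o"
  VCmp :: "'c \<Rightarrow> 'c \<Rightarrow> 'c \<Rightarrow> 'm"
  VIdt :: "'c \<Rightarrow> 'm"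

text \<open>Composition of generalized elements of hom-objects. The axioms below are equations
  between generalized elements over an arbitrary stage \<open>z\<close>.\<close>

definition vcomp ::
  "('o, 'm) ccc \<Rightarrow> ('c, 'o, 'm, 'x) vcat_scheme \<Rightarrow> 'c \<Rightarrow> 'c \<Rightarrow> 'c \<Rightarrow> 'm \<Rightarrow> 'm \<Rightarrow> 'm" where
  "vcomp V C a b c g f = VCmp C a b c \<cdot>\<^bsub>V\<^esub> pair V g f"

locale vcategory =
  fixes V :: "('o, 'm) ccc" and C :: "('c, 'o, 'm, 'x) vcat_scheme"
  assumes VHom_in: "\<lbrakk>a \<in> VObj C; b \<in> VObj C\<rbrakk> \<Longrightarrow> VHom C a b \<in> Obj V"
    and VCmp_in: "\<lbrakk>a \<in> VObj C; b \<in> VObj C; c \<in> VObj C\<rbrakk>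
      \<Longrightarrow> VCmp C a b c \<in> hom V (Prd V (VHom C b c) (VHom C a b)) (VHom C a c)"
    and VIdt_in: "a \<in> VObj C \<Longrightarrow> VIdt C a \<in> hom V (Trm V) (VHom C a a)"
    and vcomp_assoc: "\<lbrakk>a \<in> VObj C; b \<in> VObj C; c \<in> VObj C; d \<in> VObj C;
        f \<in> hom V z (VHom C a b); g \<in> hom V z (VHom C b c); h \<in> hom V z (VHom C c d)\<rbrakk>
      \<Longrightarrow> vcomp V C a b d (vcomp V C b c d h g) f = vcomp V C a c d h (vcomp V C a b c g f)"
    and VIdt_left: "\<lbrakk>a \<in> VObj C; b \<in> VObj C; f \<in> hom V z (VHom C a b)\<rbrakk>
      \<Longrightarrow> vcomp V C a b b (VIdt C b \<cdot>\<^bsub>V\<^esub> bang V z) f = f"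
    and VIdt_right: "\<lbrakk>a \<in> VObj C; b \<in> VObj C; f \<in> hom V z (VHom C a b)\<rbrakk>
      \<Longrightarrow> vcomp V C a a b f (VIdt C a \<cdot>\<^bsub>V\<^esub> bang V z) = f"

record ('c, 'd, 'm) vfun =
  FObj :: "'c \<Rightarrow> 'd"
  FArr :: "'c \<Rightarrow> 'c \<Rightarrow> 'm"

definition is_vfunctor ::
  "('o, 'm) ccc \<Rightarrow> ('c, 'o, 'm, 'x) vcat_scheme \<Rightarrow> ('d, 'o, 'm, 'y) vcat_scheme
    \<Rightarrow> ('c, 'd, 'm) vfun \<Rightarrow> bool" where
  "is_vfunctor V C D F \<longleftrightarrow>
    (\<forall>a \<in> VObj C. FObj F a \<in> VObj D) \<and>
    (\<forall>a \<in> VObj C. \<forall>b \<in> VObj C.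
      FArr F a b \<in> hom V (VHom C a b) (VHom D (FObj F a) (FObj F b))) \<and>
    (\<forall>a \<in> VObj C. FArr F a a \<cdot>\<^bsub>V\<^esub> VIdt C a = VIdt D (FObj F a)) \<and>
    (\<forall>a \<in> VObj C. \<forall>b \<in> VObj C. \<forall>c \<in> VObj C. \<forall>z.
      \<forall>g \<in> hom V z (VHom C b c). \<forall>f \<in> hom V z (VHom C a b).
        FArr F a c \<cdot>\<^bsub>V\<^esub> vcomp V C a b c g f =
        vcomp V D (FObj F a) (FObj F b) (FObj F c) (FArr F b c \<cdot>\<^bsub>V\<^esub> g) (FArr F a b \<cdot>\<^bsub>V\<^esub> f))"

definition vfun_id :: "('o, 'm) ccc \<Rightarrow> ('c, 'o, 'm, 'x) vcat_scheme \<Rightarrow> ('c, 'c, 'm) vfun" where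
  "vfun_id V C = \<lparr>FObj = id, FArr = (\<lambda>a b. Idt V (VHom C a b))\<rparr>"

definition vfun_comp ::
  "('o, 'm) ccc \<Rightarrow> ('d, 'e, 'm) vfun \<Rightarrow> ('c, 'd, 'm) vfun \<Rightarrow> ('c, 'e, 'm) vfun" where
  "vfun_comp V G F = \<lparr>FObj = FObj G \<circ> FObj F,
    FArr = (\<lambda>a b. FArr G (FObj F a) (FObj F b) \<cdot>\<^bsub>V\<^esub> FArr F a b)\<rparr>"

subsection \<open>The base as an enriched category\<close>

definition self :: "('o, 'm) ccc \<Rightarrow> ('o, 'o, 'm) vcat" where
  "self V =
    \<lparr>VObj = Obj V,
     VHom = IHom V,
     VCmp = (\<lambda>a b c.
       let H = Prd V (IHom V b c) (IHom V a b);
           g = Pr1 V (IHom V b c) (IHom V a b) \<cdot>\<^bsub>V\<^esub> Pr1 V H a;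
           f = Pr2 V (IHom V b c) (IHom V a b) \<cdot>\<^bsub>V\<^esub> Pr1 V H a;
           x = Pr2 V H a
       in vcurry V H a c (Ev V b c \<cdot>\<^bsub>V\<^esub> pair V g (Ev V a b \<cdot>\<^bsub>V\<^esub> pair V f x))),
     VIdt = (\<lambda>a. vcurry V (Trm V) a a (Pr2 V (Trm V) a))\<rparr>"

text \<open>The global element of \<open>IHom V a b\<close> corresponding to a morphism \<open>f\<close> from \<open>a\<close> to \<open>b\<close>.\<close>

definition name_of :: "('o, 'm) ccc \<Rightarrow> 'o \<Rightarrow> 'o \<Rightarrow> 'm \<Rightarrow> 'm" where
  "name_of V a b f = vcurry V (Trm V) a b (f \<cdot>\<^bsub>V\<^esub> Pr2 V (Trm V) a)"

subsection \<open>Conical powers\<close>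

text \<open>For a global element \<open>p\<close> of \<open>VHom C a b\<close>, the induced morphism from \<open>VHom C c a\<close> to
  \<open>VHom C c b\<close>.\<close>

definition vpost ::
  "('o, 'm) ccc \<Rightarrow> ('c, 'o, 'm, 'x) vcat_scheme \<Rightarrow> 'c \<Rightarrow> 'c \<Rightarrow> 'c \<Rightarrow> 'm \<Rightarrow> 'm" where
  "vpost V C c a b p =
    vcomp V C c a b (p \<cdot>\<^bsub>V\<^esub> bang V (VHom C c a)) (Idt V (VHom C c a))"

definition conical_power ::
  "('o, 'm) ccc \<Rightarrow> ('c, 'o, 'm, 'x) vcat_scheme \<Rightarrow> nat \<Rightarrow> 'c \<Rightarrow> 'c \<Rightarrow> (nat \<Rightarrow> 'm) \<Rightarrow> bool" where
  "conical_power V C n P b p \<longleftrightarrow> P \<in> VObj C \<and> b \<in> VObj C \<and>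
    (\<forall>i < n. p i \<in> hom V (Trm V) (VHom C P b)) \<and>
    (\<forall>c \<in> VObj C. is_power V n (VHom C c P) (VHom C c b) (\<lambda>i. vpost V C c P b (p i)))"

definition preserves_finite_powers ::
  "('o, 'm) ccc \<Rightarrow> ('c, 'o, 'm, 'x) vcat_scheme \<Rightarrow> ('d, 'o, 'm, 'y) vcat_scheme
    \<Rightarrow> ('c, 'd, 'm) vfun \<Rightarrow> bool" where
  "preserves_finite_powers V C D F \<longleftrightarrow>
    (\<forall>n P b p. conical_power V C n P b p \<longrightarrow>
      conical_power V D n (FObj F P) (FObj F b) (\<lambda>i. FArr F P b \<cdot>\<^bsub>V\<^esub> p i))"

subsection \<open>Objects of natural transformations\<close>

text \<open>A family of generalized elements \<open>\<phi> k\<close> of \<open>VHom D (F k) (G k)\<close>, all defined over \<open>z\<close>,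
  that is enriched-natural in \<open>k\<close>.\<close>

definition vnatural_family ::
  "('o, 'm) ccc \<Rightarrow> ('c, 'o, 'm, 'x) vcat_scheme \<Rightarrow> ('d, 'o, 'm, 'y) vcat_scheme
    \<Rightarrow> ('c, 'd, 'm) vfun \<Rightarrow> ('c, 'd, 'm) vfun \<Rightarrow> 'o \<Rightarrow> ('c \<Rightarrow> 'm) \<Rightarrow> bool" where
  "vnatural_family V C D F G z \<phi> \<longleftrightarrow> z \<in> Obj V \<and>
    (\<forall>k \<in> VObj C. \<phi> k \<in> hom V z (VHom D (FObj F k) (FObj G k))) \<and>
    (\<forall>k \<in> VObj C. \<forall>l \<in> VObj C.
      vcomp V D (FObj F k) (FObj G k) (FObj G l)
        (FArr G k l \<cdot>\<^bsub>V\<^esub> Pr1 V (VHom C k l) z) (\<phi> k \<cdot>\<^bsub>V\<^esub> Pr2 V (VHom C k l) z) =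
      vcomp V D (FObj F k) (FObj F l) (FObj G l)
        (\<phi> l \<cdot>\<^bsub>V\<^esub> Pr2 V (VHom C k l) z) (FArr F k l \<cdot>\<^bsub>V\<^esub> Pr1 V (VHom C k l) z))"

text \<open>The universal such family, i.e. the end of \<open>VHom D (F k) (G k)\<close>.\<close>

definition is_nat_object ::
  "('o, 'm) ccc \<Rightarrow> ('c, 'o, 'm, 'x) vcat_scheme \<Rightarrow> ('d, 'o, 'm, 'y) vcat_scheme
    \<Rightarrow> ('c, 'd, 'm) vfun \<Rightarrow> ('c, 'd, 'm) vfun \<Rightarrow> 'o \<Rightarrow> ('c \<Rightarrow> 'm) \<Rightarrow> bool" where
  "is_nat_object V C D F G N \<epsilon> \<longleftrightarrow> vnatural_family V C D F G N \<epsilon> \<and>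
    (\<forall>z \<phi>. vnatural_family V C D F G z \<phi> \<longrightarrow>
      (\<exists>!h. h \<in> hom V z N \<and> (\<forall>k \<in> VObj C. \<epsilon> k \<cdot>\<^bsub>V\<^esub> h = \<phi> k)))"

section \<open>Theories and algebras\<close>

text \<open>For \<open>i < n\<close>, \<open>TProj T n i\<close> is the designated morphism from \<open>n\<close> to \<open>1\<close>, as a global
  element of \<open>VHom T n 1\<close>.\<close>

record ('o, 'm) vtheory = "(nat, 'o, 'm) vcat" +
  TProj :: "nat \<Rightarrow> nat \<Rightarrow> 'm"

definition is_theory :: "('o, 'm) ccc \<Rightarrow> ('o, 'm) vtheory \<Rightarrow> bool" where
  "is_theory V T \<longleftrightarrow> vcategory V T \<and> VObj T = UNIV \<and>
    (\<forall>n. conical_power V T n n 1 (TProj T n)) \<and> TProj T 1 0 = VIdt T 1"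

definition is_theory_morphism ::
  "('o, 'm) ccc \<Rightarrow> ('o, 'm) vtheory \<Rightarrow> ('o, 'm) vtheory \<Rightarrow> (nat, nat, 'm) vfun \<Rightarrow> bool" where
  "is_theory_morphism V T U F \<longleftrightarrow> is_vfunctor V T U F \<and> FObj F = id \<and>
    (\<forall>n. \<forall>i < n. FArr F n 1 \<cdot>\<^bsub>V\<^esub> TProj T n i = TProj U n i)"

type_synonym ('o, 'm) th_arrow = "('o, 'm) vtheory \<times> (nat, nat, 'm) vfun \<times> ('o, 'm) vtheory"

definition Th :: "('o, 'm) ccc \<Rightarrow> (('o, 'm) vtheory, ('o, 'm) th_arrow) cat" where
  "Th V =
    \<lparr>Obj = {T. is_theory V T},
     Arr = {(T, F, U). is_theory V T \<and> is_theory V U \<and> is_theory_morphism V T U F},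
     Dom = (\<lambda>(T, F, U). T),
     Cod = (\<lambda>(T, F, U). U),
     Cmp = (\<lambda>(U, G, W) (T, F, U'). (T, vfun_comp V G F, W)),
     Idt = (\<lambda>T. (T, vfun_id V T, T))\<rparr>"

definition is_algebra ::
  "('o, 'm) ccc \<Rightarrow> ('o, 'm) vtheory \<Rightarrow> (nat, 'o, 'm) vfun \<Rightarrow> bool" where
  "is_algebra V T A \<longleftrightarrow> is_vfunctor V T (self V) A \<and> preserves_finite_powers V T (self V) A"

text \<open>A chosen object of natural transformations between algebras, with its universal family
  \<open>alg_ev\<close> and the morphism \<open>alg_lift\<close> into it induced by a natural family over \<open>z\<close>.\<close>

definition alg_hom_data ::
  "('o, 'm) ccc \<Rightarrow> ('o, 'm) vtheory \<Rightarrow> (nat, 'o, 'm) vfun \<Rightarrow> (nat, 'o, 'm) vfun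
    \<Rightarrow> 'o \<times> (nat \<Rightarrow> 'm)" where
  "alg_hom_data V T A B = (SOME p. is_nat_object V T (self V) A B (fst p) (snd p))"

definition alg_hom ::
  "('o, 'm) ccc \<Rightarrow> ('o, 'm) vtheory \<Rightarrow> (nat, 'o, 'm) vfun \<Rightarrow> (nat, 'o, 'm) vfun \<Rightarrow> 'o" where
  "alg_hom V T A B = fst (alg_hom_data V T A B)"

definition alg_ev ::
  "('o, 'm) ccc \<Rightarrow> ('o, 'm) vtheory \<Rightarrow> (nat, 'o, 'm) vfun \<Rightarrow> (nat, 'o, 'm) vfun
    \<Rightarrow> nat \<Rightarrow> 'm" where
  "alg_ev V T A B = snd (alg_hom_data V T A B)"

definition alg_lift ::
  "('o, 'm) ccc \<Rightarrow> ('o, 'm) vtheory \<Rightarrow> (nat, 'o, 'm) vfun \<Rightarrow> (nat, 'o, 'm) vfun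
    \<Rightarrow> 'o \<Rightarrow> (nat \<Rightarrow> 'm) \<Rightarrow> 'm" where
  "alg_lift V T A B z \<phi> =
    (THE h. h \<in> hom V z (alg_hom V T A B) \<and> (\<forall>k. alg_ev V T A B k \<cdot>\<^bsub>V\<^esub> h = \<phi> k))"

definition Alg ::
  "('o, 'm) ccc \<Rightarrow> ('o, 'm) vtheory \<Rightarrow> ((nat, 'o, 'm) vfun, 'o, 'm) vcat" where
  "Alg V T =
    \<lparr>VObj = {A. is_algebra V T A},
     VHom = alg_hom V T,
     VCmp = (\<lambda>A B C.
       let H = alg_hom V T B C; K = alg_hom V T A B
       in alg_lift V T A C (Prd V H K)
            (\<lambda>k. vcomp V (self V) (FObj A k) (FObj B k) (FObj C k)
              (alg_ev V T B C k \<cdot>\<^bsub>V\<^esub> Pr1 V H K) (alg_ev V T A B k \<cdot>\<^bsub>V\<^esub> Pr2 V H K))),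
     VIdt = (\<lambda>A. alg_lift V T A A (Trm V) (\<lambda>k. VIdt (self V) (FObj A k)))\<rparr>"

text \<open>The pointwise \<open>n\<close>-th power of an algebra, and its projections.\<close>

definition alg_pow ::
  "('o, 'm) ccc \<Rightarrow> ('o, 'm) vtheory \<Rightarrow> (nat, 'o, 'm) vfun \<Rightarrow> nat \<Rightarrow> (nat, 'o, 'm) vfun" where
  "alg_pow V T A n =
    \<lparr>FObj = (\<lambda>k. pow V (FObj A k) n),
     FArr = (\<lambda>k l.
       let H = VHom T k l; P = pow V (FObj A k) n
       in vcurry V H P (pow V (FObj A l) n)
            (tuple V (Prd V H P) (FObj A l) n
              (\<lambda>i. Ev V (FObj A k) (FObj A l) \<cdot>\<^bsub>V\<^esub>
                pair V (FArr A k l \<cdot>\<^bsub>V\<^esub> Pr1 V H P) (pproj V (FObj A k) n i \<cdot>\<^bsub>V\<^esub> Pr2 V H P))))\<rparr>"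

definition alg_pproj ::
  "('o, 'm) ccc \<Rightarrow> ('o, 'm) vtheory \<Rightarrow> (nat, 'o, 'm) vfun \<Rightarrow> nat \<Rightarrow> nat \<Rightarrow> 'm" where
  "alg_pproj V T A n i = alg_lift V T (alg_pow V T A n) (alg_pow V T A 1) (Trm V)
    (\<lambda>k. name_of V (pow V (FObj A k) n) (FObj A k) (pproj V (FObj A k) n i))"

section \<open>Commutants\<close>

definition full_theory :: "('o, 'm) ccc \<Rightarrow> 'o \<Rightarrow> ('o, 'm) vtheory" where
  "full_theory V X =
    \<lparr>VObj = UNIV,
     VHom = (\<lambda>n m. VHom (self V) (pow V X n) (pow V X m)),
     VCmp = (\<lambda>n m l. VCmp (self V) (pow V X n) (pow V X m) (pow V X l)),
     VIdt = (\<lambda>n. VIdt (self V) (pow V X n)),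
     TProj = (\<lambda>n i. name_of V (pow V X n) X (pproj V X n i))\<rparr>"

abbreviation Th_over :: "('o, 'm) ccc \<Rightarrow> 'o \<Rightarrow>
    (('o, 'm) th_arrow, ('o, 'm) th_arrow \<times> ('o, 'm) th_arrow \<times> ('o, 'm) th_arrow) cat" where
  "Th_over V X \<equiv> slice (Th V) (full_theory V X)"

text \<open>The algebra with values the powers of \<open>X\<close> to which a morphism \<open>F\<close> into the full theory
  of \<open>X\<close> amounts.\<close>

definition algebra_of :: "('o, 'm) ccc \<Rightarrow> 'o \<Rightarrow> (nat, nat, 'm) vfun \<Rightarrow> (nat, 'o, 'm) vfun" where
  "algebra_of V X F = \<lparr>FObj = pow V X, FArr = FArr F\<rparr>"

definition commutant_theory ::
  "('o, 'm) ccc \<Rightarrow> ('o, 'm) vtheory \<Rightarrow> (nat, 'o, 'm) vfun \<Rightarrow> ('o, 'm) vtheory" where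
  "commutant_theory V T A =
    \<lparr>VObj = UNIV,
     VHom = (\<lambda>n m. VHom (Alg V T) (alg_pow V T A n) (alg_pow V T A m)),
     VCmp = (\<lambda>n m l. VCmp (Alg V T) (alg_pow V T A n) (alg_pow V T A m) (alg_pow V T A l)),
     VIdt = (\<lambda>n. VIdt (Alg V T) (alg_pow V T A n)),
     TProj = alg_pproj V T A\<rparr>"

text \<open>The forgetful morphism takes the component at the object \<open>1\<close>; note that
  \<open>FObj (alg_pow V T A n) 1\<close> is the \<open>n\<close>-th power of \<open>FObj A 1 = X\<close>.\<close>

definition commutant :: "('o, 'm) ccc \<Rightarrow> 'o \<Rightarrow> ('o, 'm) th_arrow \<Rightarrow> ('o, 'm) th_arrow" where
  "commutant V X t = (case t of (T, F, U) \<Rightarrow>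
    let A = algebra_of V X F
    in (commutant_theory V T A,
        \<lparr>FObj = id, FArr = (\<lambda>n m. alg_ev V T (alg_pow V T A n) (alg_pow V T A m) 1)\<rparr>,
        full_theory V X))"

definition mutual_commutants ::
  "('o, 'm) ccc \<Rightarrow> 'o \<Rightarrow> ('o, 'm) th_arrow \<Rightarrow> ('o, 'm) th_arrow \<Rightarrow> bool" where
  "mutual_commutants V X t u \<longleftrightarrow> t \<in> Obj (Th_over V X) \<and> u \<in> Obj (Th_over V X) \<and>
    isomorphic (Th_over V X) t (commutant V X u) \<and>
    isomorphic (Th_over V X) u (commutant V X t)"

section \<open>Rigs\<close>

record ('o, 'm) rig =
  Car :: "'o"
  Add :: "'m"
  Zer :: "'m"
  Mul :: "'m"
  Uni :: "'m"

text \<open>The operations on generalized elements of the carrier.\<close>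

definition radd :: "('o, 'm) ccc \<Rightarrow> ('o, 'm) rig \<Rightarrow> 'm \<Rightarrow> 'm \<Rightarrow> 'm" where
  "radd V R x y = Add R \<cdot>\<^bsub>V\<^esub> pair V x y"

definition rmul :: "('o, 'm) ccc \<Rightarrow> ('o, 'm) rig \<Rightarrow> 'm \<Rightarrow> 'm \<Rightarrow> 'm" where
  "rmul V R x y = Mul R \<cdot>\<^bsub>V\<^esub> pair V x y"

definition rzero :: "('o, 'm) ccc \<Rightarrow> ('o, 'm) rig \<Rightarrow> 'o \<Rightarrow> 'm" where
  "rzero V R z = Zer R \<cdot>\<^bsub>V\<^esub> bang V z"

definition rone :: "('o, 'm) ccc \<Rightarrow> ('o, 'm) rig \<Rightarrow> 'o \<Rightarrow> 'm" where
  "rone V R z = Uni R \<cdot>\<^bsub>V\<^esub> bang V z"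

locale rig_in =
  fixes V :: "('o, 'm) ccc" and R :: "('o, 'm) rig"
  assumes Car_in: "Car R \<in> Obj V"
    and Add_in: "Add R \<in> hom V (Prd V (Car R) (Car R)) (Car R)"
    and Zer_in: "Zer R \<in> hom V (Trm V) (Car R)"
    and Mul_in: "Mul R \<in> hom V (Prd V (Car R) (Car R)) (Car R)"
    and Uni_in: "Uni R \<in> hom V (Trm V) (Car R)"
    and add_assoc: "\<lbrakk>x \<in> hom V z (Car R); y \<in> hom V z (Car R); w \<in> hom V z (Car R)\<rbrakk>
      \<Longrightarrow> radd V R (radd V R x y) w = radd V R x (radd V R y w)"
    and add_comm: "\<lbrakk>x \<in> hom V z (Car R); y \<in> hom V z (Car R)\<rbrakk> \<Longrightarrow> radd V R x y = radd V R y x"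
    and add_zero: "x \<in> hom V z (Car R) \<Longrightarrow> radd V R (rzero V R z) x = x"
    and mul_assoc: "\<lbrakk>x \<in> hom V z (Car R); y \<in> hom V z (Car R); w \<in> hom V z (Car R)\<rbrakk>
      \<Longrightarrow> rmul V R (rmul V R x y) w = rmul V R x (rmul V R y w)"
    and one_mul: "x \<in> hom V z (Car R) \<Longrightarrow> rmul V R (rone V R z) x = x"
    and mul_one: "x \<in> hom V z (Car R) \<Longrightarrow> rmul V R x (rone V R z) = x"
    and mul_add: "\<lbrakk>x \<in> hom V z (Car R); y \<in> hom V z (Car R); w \<in> hom V z (Car R)\<rbrakk>
      \<Longrightarrow> rmul V R x (radd V R y w) = radd V R (rmul V R x y) (rmul V R x w)"
    and add_mul: "\<lbrakk>x \<in> hom V z (Car R); y \<in> hom V z (Car R); w \<in> hom V z (Car R)\<rbrakk>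
      \<Longrightarrow> rmul V R (radd V R x y) w = radd V R (rmul V R x w) (rmul V R y w)"
    and mul_zero: "x \<in> hom V z (Car R) \<Longrightarrow> rmul V R x (rzero V R z) = rzero V R z"
    and zero_mul: "x \<in> hom V z (Car R) \<Longrightarrow> rmul V R (rzero V R z) x = rzero V R z"

definition rig_op :: "('o, 'm) ccc \<Rightarrow> ('o, 'm) rig \<Rightarrow> ('o, 'm) rig" where
  "rig_op V R = R\<lparr>Mul := rmul V R (Pr2 V (Car R) (Car R)) (Pr1 V (Car R) (Car R))\<rparr>"

primrec rsum :: "('o, 'm) ccc \<Rightarrow> ('o, 'm) rig \<Rightarrow> 'o \<Rightarrow> nat \<Rightarrow> (nat \<Rightarrow> 'm) \<Rightarrow> 'm" where
  "rsum V R z 0 f = rzero V R z"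
| "rsum V R z (Suc n) f = radd V R (rsum V R z n f) (f n)"

section \<open>Matrices\<close>

text \<open>\<open>mat_obj V R m n\<close> is the object of matrices with \<open>m\<close> rows and \<open>n\<close> columns, presented as
  \<open>m\<close>-tuples of rows; \<open>entry\<close> takes the row index \<open>j\<close> before the column index \<open>i\<close>.\<close>

definition mat_obj :: "('o, 'm) ccc \<Rightarrow> ('o, 'm) rig \<Rightarrow> nat \<Rightarrow> nat \<Rightarrow> 'o" where
  "mat_obj V R m n = pow V (pow V (Car R) n) m"

definition entry :: "('o, 'm) ccc \<Rightarrow> ('o, 'm) rig \<Rightarrow> nat \<Rightarrow> nat \<Rightarrow> nat \<Rightarrow> nat \<Rightarrow> 'm" where
  "entry V R m n j i = pproj V (Car R) n i \<cdot>\<^bsub>V\<^esub> pproj V (pow V (Car R) n) m j"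

definition mk_mat ::
  "('o, 'm) ccc \<Rightarrow> ('o, 'm) rig \<Rightarrow> 'o \<Rightarrow> nat \<Rightarrow> nat \<Rightarrow> (nat \<Rightarrow> nat \<Rightarrow> 'm) \<Rightarrow> 'm" where
  "mk_mat V R z m n e = tuple V z (pow V (Car R) n) m (\<lambda>j. tuple V z (Car R) n (\<lambda>i. e j i))"

definition Mat :: "('o, 'm) ccc \<Rightarrow> ('o, 'm) rig \<Rightarrow> ('o, 'm) vtheory" where
  "Mat V R =
    \<lparr>VObj = UNIV,
     VHom = (\<lambda>n m. mat_obj V R m n),
     VCmp = (\<lambda>n m l.
       let B = mat_obj V R l m; A = mat_obj V R m n; z = Prd V B A
       in mk_mat V R z l n (\<lambda>k i. rsum V R z m (\<lambda>j.
            rmul V R (entry V R l m k j \<cdot>\<^bsub>V\<^esub> Pr1 V B A) (entry V R m n j i \<cdot>\<^bsub>V\<^esub> Pr2 V B A)))),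
     VIdt = (\<lambda>n. mk_mat V R (Trm V) n n (\<lambda>j i. if j = i then Uni R else Zer R)),
     TProj = (\<lambda>n i. mk_mat V R (Trm V) 1 n (\<lambda>_ i'. if i' = i then Uni R else Zer R))\<rparr>"

text \<open>\<open>Mat V R\<close> over the full theory of \<open>R\<close>, via the left \<open>R\<close>-module \<open>R\<close>.\<close>

definition Mat_left :: "('o, 'm) ccc \<Rightarrow> ('o, 'm) rig \<Rightarrow> ('o, 'm) th_arrow" where
  "Mat_left V R =
    (Mat V R,
     \<lparr>FObj = id,
      FArr = (\<lambda>n m.
        let A = mat_obj V R m n; X = pow V (Car R) n; z = Prd V A X
        in vcurry V A X (pow V (Car R) m) (tuple V z (Car R) m (\<lambda>j. rsum V R z n (\<lambda>i.
             rmul V R (entry V R m n j i \<cdot>\<^bsub>V\<^esub> Pr1 V A X) (pproj V (Car R) n i \<cdot>\<^bsub>V\<^esub> Pr2 V A X)))))\<rparr>,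
     full_theory V (Car R))"

text \<open>Matrices over the opposite rig over the full theory of \<open>R\<close>, via the right \<open>R\<close>-module
  \<open>R\<close>; the products in the action are those of \<open>R\<close>.\<close>

definition Mat_right :: "('o, 'm) ccc \<Rightarrow> ('o, 'm) rig \<Rightarrow> ('o, 'm) th_arrow" where
  "Mat_right V R =
    (Mat V (rig_op V R),
     \<lparr>FObj = id,
      FArr = (\<lambda>n m.
        let A = mat_obj V R m n; X = pow V (Car R) n; z = Prd V A X
        in vcurry V A X (pow V (Car R) m) (tuple V z (Car R) m (\<lambda>j. rsum V R z n (\<lambda>i.
             rmul V R (pproj V (Car R) n i \<cdot>\<^bsub>V\<^esub> Pr2 V A X) (entry V R m n j i \<cdot>\<^bsub>V\<^esub> Pr1 V A X)))))\<rparr>,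
     full_theory V (Car R))"

end

theory Submission
  imports Defs
begin

text \<open>
  Write \<open>X\<close> for the carrier of \<open>R\<close> and \<open>A\<close> for the algebra of \<open>Mat V R\<close> given by the left
  module \<open>R\<close>. A natural transformation from \<open>A\<^sup>n\<close> to \<open>A\<^sup>m\<close> is the same thing as a left-linear map
  from \<open>R\<^sup>n\<close> to \<open>R\<^sup>m\<close>: naturality at the standard basis rows, which are maps from \<open>k\<close> to \<open>1\<close>, says
  that its component at \<open>k\<close> is its component at \<open>1\<close> applied to each of the \<open>k\<close> columns
  (\<open>natural_col\<close>), and naturality at an arbitrary row then says that the component at \<open>1\<close> respects
  linear combinations (\<open>natural_linear\<close>). A left-linear map between finite free modules is right
  multiplication by the matrix of its values on the standard basis, and every matrix occurs,
  because left and right multiplications commute by associativity (\<open>ract_pow_natural\<close>). So the object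
  of \<open>m\<close> by \<open>n\<close> matrices, acting from the right, is an object of natural transformations
  (\<open>is_nat_object_ract_pow\<close>), and composing right multiplications multiplies matrices over the
  opposite rig. This identifies the commutant of \<open>Mat V R\<close> with the matrices over the opposite rig
  (\<open>isomorphic_commutant\<close>). The other half of the theorem is the same statement for the opposite
  rig, whose opposite is \<open>R\<close> again.

  All of this takes place inside \<open>V\<close>, so linear maps and matrices are generalized elements at a
  stage \<open>w\<close>. Two extensionality principles make that harmless: elements of an internal hom agree if
  they agree when applied to generalized elements at every later stage (\<open>ap_ext\<close>), and elements of
  a power agree if their components do (\<open>pow_ext\<close>). With these, each categorical equation becomes an
  identity between finite sums in the rig of elements of \<open>X\<close> at a fixed stage.

  The axioms of an enriched category are checked only for the base itself. Matrices inherit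
  them because their action on powers of \<open>X\<close> is faithful (\<open>vcategory_faithful\<close>, \<open>lact_mono\<close>). The
  commutant is built from arbitrarily chosen objects of natural transformations, which are determined
  up to isomorphism only; it receives its theory structure by transport along the isomorphisms with
  the matrix objects (\<open>theory_transport\<close>).
\<close>

section \<open>Generalized elements in a cartesian closed category\<close>

text \<open>Membership in a hom-set is unfolded into equations for domain and codomain: the
  simplifier can then compute the type of a composite, whereas the intermediate object of a
  composition could not be guessed from a goal \<open>g \<cdot> f \<in> hom C a c\<close>.\<close>

lemma in_hom_iff [simp]: "f \<in> hom C a b \<longleftrightarrow> f \<in> Arr C \<and> Dom C f = a \<and> Cod C f = b"
  by (auto simp: hom_def)

context category
begin

lemma Idt_arr [simp]:
  "a \<in> Obj C \<Longrightarrow> Idt C a \<in> Arr C" "a \<in> Obj C \<Longrightarrow> Dom C (Idt C a) = a" "a \<in> Obj C \<Longrightarrow> Cod C (Idt C a) = a"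
  using Idt_in by auto

lemma Cmp_arr [simp]:
  assumes "f \<in> Arr C" "g \<in> Arr C" "Cod C f = Dom C g"
  shows "g \<cdot> f \<in> Arr C" "Dom C (g \<cdot> f) = Dom C f" "Cod C (g \<cdot> f) = Cod C g"
  using Cmp_in[of f "Dom C f" "Cod C f" g "Cod C g"] assms by auto

lemma Idt_Cmp [simp]:
  "f \<in> Arr C \<Longrightarrow> Cod C f = b \<Longrightarrow> Idt C b \<cdot> f = f"
  "f \<in> Arr C \<Longrightarrow> Dom C f = a \<Longrightarrow> f \<cdot> Idt C a = f"
  using Idt_left[of f "Dom C f"] Idt_right[of f "Dom C f" "Cod C f"] by auto

lemma Cmp_assoc' [simp]:
  assumes "f \<in> Arr C" "g \<in> Arr C" "h \<in> Arr C" "Cod C f = Dom C g" "Cod C g = Dom C h"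
  shows "(h \<cdot> g) \<cdot> f = h \<cdot> (g \<cdot> f)"
  using Cmp_assoc[of f "Dom C f" "Cod C f" g "Cod C g" h "Cod C h"] assms by auto

end

context cartesian_closed
begin

declare Trm_in [simp] Prd_in [simp] IHom_in [simp]

lemma arr_obj [simp]: "f \<in> Arr V \<Longrightarrow> Dom V f \<in> Obj V" "f \<in> Arr V \<Longrightarrow> Cod V f \<in> Obj V"
  by (auto intro: Dom_in Cod_in)

lemma structure_arr [simp]:
  assumes "a \<in> Obj V" "b \<in> Obj V"
  shows "Pr1 V a b \<in> Arr V" "Dom V (Pr1 V a b) = Prd V a b" "Cod V (Pr1 V a b) = a"
    "Pr2 V a b \<in> Arr V" "Dom V (Pr2 V a b) = Prd V a b" "Cod V (Pr2 V a b) = b"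
    "Ev V a b \<in> Arr V" "Dom V (Ev V a b) = Prd V (IHom V a b) a" "Cod V (Ev V a b) = b"
  using Pr1_in Pr2_in Ev_in assms by auto

lemma bang_arr [simp]:
  assumes "z \<in> Obj V"
  shows "bang V z \<in> Arr V" "Dom V (bang V z) = z" "Cod V (bang V z) = Trm V"
proof -
  have "bang V z \<in> hom V z (Trm V)"
    unfolding bang_def by (rule theI'[OF Trm_univ[OF assms]])
  then show "bang V z \<in> Arr V" "Dom V (bang V z) = z" "Cod V (bang V z) = Trm V" by auto
qed

lemma bang_unique: "f \<in> Arr V \<Longrightarrow> Cod V f = Trm V \<Longrightarrow> f = bang V (Dom V f)"
  using Trm_univ[of "Dom V f"] by auto

lemma bang_comp [simp]: "f \<in> Arr V \<Longrightarrow> Cod V f = z \<Longrightarrow> bang V z \<cdot> f = bang V (Dom V f)"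
  using bang_unique[of "bang V z \<cdot> f"] by auto

lemma pair_props:
  assumes "f \<in> Arr V" "g \<in> Arr V" "Dom V f = Dom V g"
  shows "pair V f g \<in> hom V (Dom V f) (Prd V (Cod V f) (Cod V g)) \<and>
    Pr1 V (Cod V f) (Cod V g) \<cdot> pair V f g = f \<and> Pr2 V (Cod V f) (Cod V g) \<cdot> pair V f g = g"
  unfolding pair_def by (rule theI', rule Prd_univ) (use assms in auto)

lemma pair_arr [simp]:
  assumes "f \<in> Arr V" "g \<in> Arr V" "Dom V f = Dom V g"
  shows "pair V f g \<in> Arr V" "Dom V (pair V f g) = Dom V f"
    "Cod V (pair V f g) = Prd V (Cod V f) (Cod V g)"
  using pair_props[OF assms] by auto

lemma proj_pair [simp]:
  assumes "f \<in> Arr V" "g \<in> Arr V" "Dom V f = Dom V g" "Cod V f = a" "Cod V g = b"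
  shows "Pr1 V a b \<cdot> pair V f g = f" "Pr2 V a b \<cdot> pair V f g = g"
  using pair_props assms by auto

lemma pair_unique:
  assumes "h \<in> hom V z (Prd V a b)" "a \<in> Obj V" "b \<in> Obj V"
  shows "pair V (Pr1 V a b \<cdot> h) (Pr2 V a b \<cdot> h) = h"
  using Prd_univ[of "Pr1 V a b \<cdot> h" z a "Pr2 V a b \<cdot> h" b] assms
  by (auto simp del: pair_arr intro!: the1_equality simp: pair_def)

lemma prod_ext:
  assumes "h \<in> hom V z (Prd V a b)" "h' \<in> hom V z (Prd V a b)" "a \<in> Obj V" "b \<in> Obj V"
    and "Pr1 V a b \<cdot> h = Pr1 V a b \<cdot> h'" "Pr2 V a b \<cdot> h = Pr2 V a b \<cdot> h'"
  shows "h = h'"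
  using pair_unique assms by metis

lemma pair_proj [simp]:
  "a \<in> Obj V \<Longrightarrow> b \<in> Obj V \<Longrightarrow> pair V (Pr1 V a b) (Pr2 V a b) = Idt V (Prd V a b)"
  using pair_unique[of "Idt V (Prd V a b)" "Prd V a b" a b] by auto

lemma pair_comp [simp]:
  assumes "f \<in> Arr V" "g \<in> Arr V" "Dom V f = Dom V g" "h \<in> Arr V" "Cod V h = Dom V f"
  shows "pair V f g \<cdot> h = pair V (f \<cdot> h) (g \<cdot> h)"
proof (rule prod_ext[of _ "Dom V h" "Cod V f" "Cod V g"])
  show "Pr1 V (Cod V f) (Cod V g) \<cdot> pair V f g \<cdot> h = Pr1 V (Cod V f) (Cod V g) \<cdot> pair V (f \<cdot> h) (g \<cdot> h)"
    using assms Cmp_assoc'[of h "pair V f g" "Pr1 V (Cod V f) (Cod V g)", symmetric]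
    by (simp del: Cmp_assoc')
  show "Pr2 V (Cod V f) (Cod V g) \<cdot> pair V f g \<cdot> h = Pr2 V (Cod V f) (Cod V g) \<cdot> pair V (f \<cdot> h) (g \<cdot> h)"
    using assms Cmp_assoc'[of h "pair V f g" "Pr2 V (Cod V f) (Cod V g)", symmetric]
    by (simp del: Cmp_assoc')
qed (use assms in auto)

definition ap :: "'o \<Rightarrow> 'o \<Rightarrow> 'm \<Rightarrow> 'm \<Rightarrow> 'm" where
  "ap a b h x = Ev V a b \<cdot> pair V h x"

lemma ap_arr [simp]:
  assumes "a \<in> Obj V" "b \<in> Obj V" "h \<in> Arr V" "x \<in> Arr V" "Cod V h = IHom V a b" "Cod V x = a"
    "Dom V h = Dom V x"
  shows "ap a b h x \<in> Arr V" "Dom V (ap a b h x) = Dom V x" "Cod V (ap a b h x) = b"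
  using assms by (auto simp: ap_def)

lemma ap_comp [simp]:
  assumes "a \<in> Obj V" "b \<in> Obj V" "h \<in> Arr V" "x \<in> Arr V" "Cod V h = IHom V a b" "Cod V x = a"
    "Dom V h = Dom V x" "s \<in> Arr V" "Cod V s = Dom V x"
  shows "ap a b h x \<cdot> s = ap a b (h \<cdot> s) (x \<cdot> s)"
  using assms by (auto simp: ap_def)

lemma vcurry_props:
  assumes "f \<in> hom V (Prd V z a) b" "z \<in> Obj V" "a \<in> Obj V" "b \<in> Obj V"
  shows "vcurry V z a b f \<in> hom V z (IHom V a b) \<and>
    Ev V a b \<cdot> pair V (vcurry V z a b f \<cdot> Pr1 V z a) (Pr2 V z a) = f"
  unfolding vcurry_def by (rule theI', rule IHom_univ) (use assms in auto)

lemma vcurry_arr [simp]: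
  assumes "f \<in> Arr V" "Dom V f = Prd V z a" "Cod V f = b" "z \<in> Obj V" "a \<in> Obj V" "b \<in> Obj V"
  shows "vcurry V z a b f \<in> Arr V" "Dom V (vcurry V z a b f) = z" "Cod V (vcurry V z a b f) = IHom V a b"
  using vcurry_props[of f z a b] assms by auto

lemma ap_vcurry_comp [simp]:
  assumes "f \<in> Arr V" "Dom V f = Prd V z a" "Cod V f = b" "z \<in> Obj V" "a \<in> Obj V" "b \<in> Obj V"
    "s \<in> Arr V" "Cod V s = z" "x \<in> Arr V" "Cod V x = a" "Dom V s = Dom V x"
  shows "ap a b (vcurry V z a b f \<cdot> s) x = f \<cdot> pair V s x"
proof -
  have "f \<cdot> pair V s x = ap a b (vcurry V z a b f \<cdot> Pr1 V z a) (Pr2 V z a) \<cdot> pair V s x"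
    unfolding ap_def using vcurry_props[of f z a b] assms by simp
  also have "\<dots> = ap a b (vcurry V z a b f \<cdot> s) x"
    using assms by simp
  finally show ?thesis by simp
qed

text \<open>It suffices to compare the two sides on the generic pair of projections, at the stage
  \<open>z \<times> a\<close>: applied to it, an element of the internal hom becomes its own uncurrying.\<close>

lemma ap_ext:
  assumes "h \<in> hom V z (IHom V a b)" "h' \<in> hom V z (IHom V a b)" "a \<in> Obj V" "b \<in> Obj V"
    and "\<And>w s x. s \<in> hom V w z \<Longrightarrow> x \<in> hom V w a \<Longrightarrow> ap a b (h \<cdot> s) x = ap a b (h' \<cdot> s) x"
  shows "h = h'"
proof -
  have z: "z \<in> Obj V" using assms(1) by auto
  have "ap a b (h \<cdot> Pr1 V z a) (Pr2 V z a) = ap a b (h' \<cdot> Pr1 V z a) (Pr2 V z a)"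
    by (rule assms(5)[of _ "Prd V z a"]) (use z assms in auto)
  moreover have "ap a b (h' \<cdot> Pr1 V z a) (Pr2 V z a) \<in> hom V (Prd V z a) b"
    using assms z by auto
  ultimately show ?thesis
    using IHom_univ[of z a b "ap a b (h' \<cdot> Pr1 V z a) (Pr2 V z a)"] assms z
    unfolding ap_def by blast
qed

subsection \<open>Powers\<close>

lemma pow_in [simp]: "X \<in> Obj V \<Longrightarrow> pow V X n \<in> Obj V"
  by (induction n; case_tac n) auto

lemma pproj_in:
  "X \<in> Obj V \<Longrightarrow> i < n \<Longrightarrow> pproj V X n i \<in> hom V (pow V X n) X"
proof (induction n)
  case (Suc n)
  then show ?case by (cases n) (auto simp: less_Suc_eq)
qed simp

lemma pproj_arr [simp]:
  assumes "X \<in> Obj V" "i < n"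
  shows "pproj V X n i \<in> Arr V" "Dom V (pproj V X n i) = pow V X n" "Cod V (pproj V X n i) = X"
  using pproj_in[OF assms] by auto

lemma Trm_ext:
  "h \<in> hom V z (Trm V) \<Longrightarrow> h' \<in> hom V z (Trm V) \<Longrightarrow> h = h'"
  using bang_unique[of h] bang_unique[of h'] by auto

lemma pow_ext:
  assumes "h \<in> hom V z (pow V X n)" "h' \<in> hom V z (pow V X n)" "X \<in> Obj V"
    and "\<And>i. i < n \<Longrightarrow> pproj V X n i \<cdot> h = pproj V X n i \<cdot> h'"
  shows "h = h'"
  using assms
proof (induction n arbitrary: h h')
  case 0
  then show ?case by (intro Trm_ext[of h z h']) auto
next
  case (Suc n)
  show ?case
  proof (cases n)
    case 0
    then show ?thesis using Suc.prems(1,2,3) Suc.prems(4)[of 0] by auto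
  next
    case (Suc m)
    note n = this
    let ?P = "pow V X n"
    have "Pr1 V ?P X \<cdot> h = Pr1 V ?P X \<cdot> h'"
    proof (rule Suc.IH)
      show "pproj V X n i \<cdot> Pr1 V ?P X \<cdot> h = pproj V X n i \<cdot> Pr1 V ?P X \<cdot> h'" if "i < n" for i
        using Suc.prems(4)[of i] Suc.prems(1-3) that n by (auto simp: less_Suc_eq)
    qed (use Suc.prems n in auto)
    moreover have "Pr2 V ?P X \<cdot> h = Pr2 V ?P X \<cdot> h'"
      using Suc.prems(4)[of n] n by auto
    ultimately show ?thesis
      by (intro prod_ext[of h z ?P X h']) (use Suc.prems n in auto)
  qed
qed

lemma tuple_ex:
  assumes "z \<in> Obj V" "X \<in> Obj V" "\<And>i. i < n \<Longrightarrow> f i \<in> hom V z X"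
  shows "\<exists>h. h \<in> hom V z (pow V X n) \<and> (\<forall>i < n. pproj V X n i \<cdot> h = f i)"
  using assms
proof (induction n)
  case 0
  then show ?case by (intro exI[of _ "bang V z"]) auto
next
  case (Suc n)
  show ?case
  proof (cases n)
    case 0
    then show ?thesis using Suc.prems by (intro exI[of _ "f 0"]) auto
  next
    case (Suc m)
    obtain h where h: "h \<in> hom V z (pow V X n)" "\<forall>i < n. pproj V X n i \<cdot> h = f i"
      using Suc.IH Suc.prems by auto
    show ?thesis
      by (rule exI[of _ "pair V h (f n)"]) (use h Suc Suc.prems in \<open>auto simp: less_Suc_eq\<close>)
  qed
qed

lemma tuple_props:
  assumes "z \<in> Obj V" "X \<in> Obj V" "\<And>i. i < n \<Longrightarrow> f i \<in> hom V z X"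
  shows "tuple V z X n f \<in> hom V z (pow V X n) \<and> (\<forall>i < n. pproj V X n i \<cdot> tuple V z X n f = f i)"
proof -
  obtain h where "h \<in> hom V z (pow V X n) \<and> (\<forall>i < n. pproj V X n i \<cdot> h = f i)"
    using tuple_ex[of z X n f] assms by blast
  then show ?thesis
    unfolding tuple_def
    by (rule theI) (rule pow_ext[of _ z X n], use \<open>h \<in> _ \<and> _\<close> assms in auto)
qed

lemma tuple_arr [simp]:
  assumes "\<And>i. i < n \<Longrightarrow> f i \<in> Arr V" "\<And>i. i < n \<Longrightarrow> Dom V (f i) = z"
    "\<And>i. i < n \<Longrightarrow> Cod V (f i) = X" "z \<in> Obj V" "X \<in> Obj V"
  shows "tuple V z X n f \<in> Arr V" "Dom V (tuple V z X n f) = z"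
    "Cod V (tuple V z X n f) = pow V X n"
  using tuple_props[of z X n f] assms by auto

lemma pproj_tuple [simp]:
  assumes "i < n" "\<And>i. i < n \<Longrightarrow> f i \<in> Arr V" "\<And>i. i < n \<Longrightarrow> Dom V (f i) = z"
    "\<And>i. i < n \<Longrightarrow> Cod V (f i) = X" "z \<in> Obj V" "X \<in> Obj V"
  shows "pproj V X n i \<cdot> tuple V z X n f = f i"
  using tuple_props[of z X n f] assms by auto

lemma pproj_tuple_comp [simp]:
  assumes "i < n" "\<And>i. i < n \<Longrightarrow> f i \<in> Arr V" "\<And>i. i < n \<Longrightarrow> Dom V (f i) = z"
    "\<And>i. i < n \<Longrightarrow> Cod V (f i) = X" "z \<in> Obj V" "X \<in> Obj V" "s \<in> Arr V" "Cod V s = z"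
  shows "pproj V X n i \<cdot> tuple V z X n f \<cdot> s = f i \<cdot> s"
  using assms Cmp_assoc'[of s "tuple V z X n f" "pproj V X n i", symmetric]
  by (simp del: Cmp_assoc')

lemma tuple_Suc_0 [simp]:
  assumes "f 0 \<in> Arr V" "Dom V (f 0) = z" "Cod V (f 0) = X" "z \<in> Obj V" "X \<in> Obj V"
  shows "tuple V z X (Suc 0) f = f 0"
  using pproj_tuple[of 0 "Suc 0" f z X] tuple_arr[of "Suc 0" f z X] assms by simp

lemma tuple_cong [cong]:
  "z = z' \<Longrightarrow> X = X' \<Longrightarrow> n = n' \<Longrightarrow> (\<And>i. i < n' \<Longrightarrow> f i = f' i) \<Longrightarrow> tuple V z X n f = tuple V z' X' n' f'"
  unfolding tuple_def by (auto intro!: arg_cong[where f = The])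

lemma is_power_pow:
  assumes "X \<in> Obj V"
  shows "is_power V n (pow V X n) X (pproj V X n)"
  unfolding is_power_def
proof (intro conjI allI impI ballI)
  fix z f assume z: "z \<in> Obj V" "\<forall>i<n. f i \<in> hom V z X"
  show "\<exists>!h. h \<in> hom V z (pow V X n) \<and> (\<forall>i<n. pproj V X n i \<cdot> h = f i)"
  proof (rule ex_ex1I)
    show "\<exists>h. h \<in> hom V z (pow V X n) \<and> (\<forall>i<n. pproj V X n i \<cdot> h = f i)"
      by (rule tuple_ex) (use z assms in auto)
  qed (rule pow_ext[of _ z X n], use assms in auto)
qed (use assms in auto)

end

section \<open>The base as an enriched category, and full theories\<close>

context cartesian_closed
begin

lemma self_simps [simp]: "VObj (self V) = Obj V" "VHom (self V) = IHom V"
  by (auto simp: self_def)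

lemma vcomp_self_arr [simp]:
  assumes "a \<in> Obj V" "b \<in> Obj V" "c \<in> Obj V" "g \<in> Arr V" "f \<in> Arr V" "Cod V g = IHom V b c"
    "Cod V f = IHom V a b" "Dom V g = Dom V f"
  shows "vcomp V (self V) a b c g f \<in> Arr V" "Dom V (vcomp V (self V) a b c g f) = Dom V f"
    "Cod V (vcomp V (self V) a b c g f) = IHom V a c"
  using assms by (auto simp: vcomp_def self_def Let_def ap_def[symmetric])

lemma vcomp_self_comp [simp]:
  assumes "a \<in> Obj V" "b \<in> Obj V" "c \<in> Obj V" "g \<in> Arr V" "f \<in> Arr V" "Cod V g = IHom V b c"
    "Cod V f = IHom V a b" "Dom V g = Dom V f" "s \<in> Arr V" "Cod V s = Dom V f"
  shows "vcomp V (self V) a b c g f \<cdot> s = vcomp V (self V) a b c (g \<cdot> s) (f \<cdot> s)"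
  using assms by (auto simp: vcomp_def self_def Let_def ap_def[symmetric])

lemma ap_vcomp_self [simp]:
  assumes "a \<in> Obj V" "b \<in> Obj V" "c \<in> Obj V" "g \<in> Arr V" "f \<in> Arr V" "Cod V g = IHom V b c"
    "Cod V f = IHom V a b" "Dom V g = Dom V f" "x \<in> Arr V" "Cod V x = a" "Dom V x = Dom V f"
  shows "ap a c (vcomp V (self V) a b c g f) x = ap b c g (ap a b f x)"
  using assms by (auto simp: vcomp_def self_def Let_def ap_def[symmetric])

lemma VIdt_self_arr [simp]:
  assumes "a \<in> Obj V"
  shows "VIdt (self V) a \<in> Arr V" "Dom V (VIdt (self V) a) = Trm V"
    "Cod V (VIdt (self V) a) = IHom V a a"
  using assms by (auto simp: self_def)

lemma ap_VIdt_self [simp]: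
  assumes "a \<in> Obj V" "s \<in> Arr V" "Cod V s = Trm V" "x \<in> Arr V" "Cod V x = a" "Dom V x = Dom V s"
  shows "ap a a (VIdt (self V) a \<cdot> s) x = x"
  using assms by (auto simp: self_def)

lemma name_of_arr [simp]:
  assumes "f \<in> Arr V" "Dom V f = a" "Cod V f = b"
  shows "name_of V a b f \<in> Arr V" "Dom V (name_of V a b f) = Trm V"
    "Cod V (name_of V a b f) = IHom V a b"
  using assms by (auto simp: name_of_def)

lemma ap_name_of [simp]:
  assumes "f \<in> Arr V" "Dom V f = a" "Cod V f = b" "s \<in> Arr V" "Cod V s = Trm V" "x \<in> Arr V" "Cod V x = a"
    "Dom V x = Dom V s"
  shows "ap a b (name_of V a b f \<cdot> s) x = f \<cdot> x"
  using assms by (auto simp: name_of_def)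

lemma vcategory_self: "vcategory V (self V)"
proof
  show "VCmp (self V) a b c \<in> hom V (Prd V (VHom (self V) b c) (VHom (self V) a b)) (VHom (self V) a c)"
    if "a \<in> VObj (self V)" "b \<in> VObj (self V)" "c \<in> VObj (self V)" for a b c
    using that by (auto simp: self_def Let_def ap_def[symmetric])
next
  fix a b c d f g h z
  assume "a \<in> VObj (self V)" "b \<in> VObj (self V)" "c \<in> VObj (self V)" "d \<in> VObj (self V)"
    "f \<in> hom V z (VHom (self V) a b)" "g \<in> hom V z (VHom (self V) b c)" "h \<in> hom V z (VHom (self V) c d)"
  then have t: "a \<in> Obj V" "b \<in> Obj V" "c \<in> Obj V" "d \<in> Obj V"
    "f \<in> hom V z (IHom V a b)" "g \<in> hom V z (IHom V b c)" "h \<in> hom V z (IHom V c d)" by simp_all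
  show "vcomp V (self V) a b d (vcomp V (self V) b c d h g) f =
      vcomp V (self V) a c d h (vcomp V (self V) a b c g f)"
    by (rule ap_ext[of _ z a d]; use t in simp)
next
  fix a b f z
  assume as: "a \<in> VObj (self V)" "b \<in> VObj (self V)" "f \<in> hom V z (VHom (self V) a b)"
  then have z: "z \<in> Obj V" by auto
  show "vcomp V (self V) a b b (VIdt (self V) b \<cdot> bang V z) f = f"
    by (rule ap_ext[of _ z a b]; use as z in simp)
  show "vcomp V (self V) a a b f (VIdt (self V) a \<cdot> bang V z) = f"
    by (rule ap_ext[of _ z a b]; use as z in simp)
qed auto

lemma full_theory_simps [simp]:
  "VObj (full_theory V X) = UNIV"
  "VHom (full_theory V X) n m = IHom V (pow V X n) (pow V X m)"
  "VIdt (full_theory V X) n = VIdt (self V) (pow V X n)"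
  "TProj (full_theory V X) n i = name_of V (pow V X n) X (pproj V X n i)"
  "vcomp V (full_theory V X) n m l = vcomp V (self V) (pow V X n) (pow V X m) (pow V X l)"
  by (auto simp: full_theory_def vcomp_def fun_eq_iff)

lemma is_theory_full:
  assumes X: "X \<in> Obj V"
  shows "is_theory V (full_theory V X)"
  unfolding is_theory_def
proof (intro conjI allI)
  interpret self: vcategory V "self V" by (rule vcategory_self)
  show "vcategory V (full_theory V X)"
  proof
    show "VCmp (full_theory V X) a b c
      \<in> hom V (Prd V (VHom (full_theory V X) b c) (VHom (full_theory V X) a b)) (VHom (full_theory V X) a c)" for a b c
      using self.VCmp_in[of "pow V X a" "pow V X b" "pow V X c"] X by (auto simp: full_theory_def)
    show "vcomp V (full_theory V X) a b b (VIdt (full_theory V X) b \<cdot> bang V z) f = f"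
      "vcomp V (full_theory V X) a a b f (VIdt (full_theory V X) a \<cdot> bang V z) = f"
      if "f \<in> hom V z (VHom (full_theory V X) a b)" for a b f z
      using self.VIdt_left[of "pow V X a" "pow V X b" f z] self.VIdt_right[of "pow V X a" "pow V X b" f z]
        X that by auto
  qed (use X self.vcomp_assoc in auto)
next
  fix n
  show "conical_power V (full_theory V X) n n 1 (TProj (full_theory V X) n)"
    unfolding conical_power_def
  proof (intro conjI ballI)
    fix c :: nat
    let ?p = "\<lambda>i. vpost V (full_theory V X) c n 1 (TProj (full_theory V X) n i)"
    let ?C = "pow V X c" and ?N = "pow V X n"
    have p: "?p i \<in> hom V (IHom V ?C ?N) (IHom V ?C X)" if "i < n" for i
      using that X by (auto simp: vpost_def)
    have app: "ap ?C X (?p i \<cdot> h) x = pproj V X n i \<cdot> ap ?C ?N h x"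
      if "i < n" "h \<in> hom V w (IHom V ?C ?N)" "x \<in> hom V w ?C" for i h x w
      using that X by (auto simp: vpost_def)
    show "is_power V n (VHom (full_theory V X) c n) (VHom (full_theory V X) c 1) ?p"
      unfolding is_power_def
    proof (intro conjI ballI allI impI)
      fix z f assume z: "z \<in> Obj V" "\<forall>i<n. f i \<in> hom V z (VHom (full_theory V X) c 1)"
      (* currying turns the power in the base into a power of internal homs *)
      define h where "h = vcurry V z ?C ?N (tuple V (Prd V z ?C) X n
        (\<lambda>i. ap ?C X (f i \<cdot> Pr1 V z ?C) (Pr2 V z ?C)))"
      have h: "h \<in> hom V z (IHom V ?C ?N)"
        unfolding h_def using z X by auto
      have ph: "?p i \<cdot> h = f i" if i: "i < n" for i
      proof (rule ap_ext[of _ z ?C X])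
        fix w s x assume "s \<in> hom V w z" "x \<in> hom V w ?C"
        then show "ap ?C X ((?p i \<cdot> h) \<cdot> s) x = ap ?C X (f i \<cdot> s) x"
          using p[OF i] h z X i app[OF i, of "h \<cdot> s" w x] by (simp, simp add: h_def)
      qed (use h p[OF i] X z i in auto)
      show "\<exists>!h. h \<in> hom V z (VHom (full_theory V X) c n) \<and> (\<forall>i<n. ?p i \<cdot> h = f i)"
      proof (rule ex1I[of _ h])
        fix h' assume h': "h' \<in> hom V z (VHom (full_theory V X) c n) \<and> (\<forall>i<n. ?p i \<cdot> h' = f i)"
        show "h' = h"
        proof (rule ap_ext[of _ z ?C ?N])
          fix w s x assume sx: "s \<in> hom V w z" "x \<in> hom V w ?C"
          show "ap ?C ?N (h' \<cdot> s) x = ap ?C ?N (h \<cdot> s) x"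
          proof (rule pow_ext[of _ w X n])
            fix i assume i: "i < n"
            have "?p i \<cdot> h' \<cdot> s = (?p i \<cdot> h') \<cdot> s" "?p i \<cdot> h \<cdot> s = (?p i \<cdot> h) \<cdot> s"
              using p[OF i] h h' sx by auto
            then have "?p i \<cdot> h' \<cdot> s = ?p i \<cdot> h \<cdot> s" using ph[OF i] h' i by simp
            then show "pproj V X n i \<cdot> ap ?C ?N (h' \<cdot> s) x = pproj V X n i \<cdot> ap ?C ?N (h \<cdot> s) x"
              using app[OF i, of "h \<cdot> s" w x] app[OF i, of "h' \<cdot> s" w x] h h' sx by simp
          qed (use h h' sx X in auto)
        qed (use h h' X in auto)
      qed (use h ph in auto)
    qed (use X p in auto)
  qed (use X in auto)
next
  show "TProj (full_theory V X) 1 0 = VIdt (full_theory V X) 1"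
    using X by (auto simp: name_of_def self_def)
qed auto

subsection \<open>Faithful functors and isomorphisms\<close>

lemma vcomp_arr [simp]:
  assumes "VCmp C a b c \<in> hom V (Prd V (VHom C b c) (VHom C a b)) (VHom C a c)"
    "g \<in> hom V z (VHom C b c)" "f \<in> hom V z (VHom C a b)"
  shows "vcomp V C a b c g f \<in> hom V z (VHom C a c)"
  using assms by (auto simp: vcomp_def)

text \<open>Every axiom of an enriched category is an equation between composites, which a
  composition-preserving, identity-preserving and monic family of maps reflects.\<close>

lemma vcategory_faithful:
  assumes D: "vcategory V D" and F: "is_vfunctor V C D F"
    and hom: "\<And>a b. a \<in> VObj C \<Longrightarrow> b \<in> VObj C \<Longrightarrow> VHom C a b \<in> Obj V"
    and cmp: "\<And>a b c. a \<in> VObj C \<Longrightarrow> b \<in> VObj C \<Longrightarrow> c \<in> VObj C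
      \<Longrightarrow> VCmp C a b c \<in> hom V (Prd V (VHom C b c) (VHom C a b)) (VHom C a c)"
    and idt: "\<And>a. a \<in> VObj C \<Longrightarrow> VIdt C a \<in> hom V (Trm V) (VHom C a a)"
    and mono: "\<And>a b z h h'. a \<in> VObj C \<Longrightarrow> b \<in> VObj C \<Longrightarrow> h \<in> hom V z (VHom C a b)
      \<Longrightarrow> h' \<in> hom V z (VHom C a b) \<Longrightarrow> FArr F a b \<cdot> h = FArr F a b \<cdot> h' \<Longrightarrow> h = h'"
  shows "vcategory V C"
proof
  interpret D: vcategory V D by fact
  have FO: "FObj F a \<in> VObj D" if "a \<in> VObj C" for a
    using F that by (auto simp: is_vfunctor_def)
  have FA: "FArr F a b \<in> Arr V" "Dom V (FArr F a b) = VHom C a b"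
    "Cod V (FArr F a b) = VHom D (FObj F a) (FObj F b)" if "a \<in> VObj C" "b \<in> VObj C" for a b
    using F that by (auto simp: is_vfunctor_def)
  have Fc: "FArr F a c \<cdot> vcomp V C a b c g f =
      vcomp V D (FObj F a) (FObj F b) (FObj F c) (FArr F b c \<cdot> g) (FArr F a b \<cdot> f)"
    if "a \<in> VObj C" "b \<in> VObj C" "c \<in> VObj C" "g \<in> hom V z (VHom C b c)" "f \<in> hom V z (VHom C a b)" for a b c g f z
    using F that unfolding is_vfunctor_def by blast
  have Fi: "FArr F a a \<cdot> VIdt C a \<cdot> bang V z = VIdt D (FObj F a) \<cdot> bang V z"
    if "a \<in> VObj C" "z \<in> Obj V" for a z
  proof -
    have "FArr F a a \<cdot> VIdt C a \<cdot> bang V z = (FArr F a a \<cdot> VIdt C a) \<cdot> bang V z"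
      using FA idt[of a] that by simp
    then show ?thesis using F that by (auto simp: is_vfunctor_def)
  qed
  note va = vcomp_arr[OF cmp]
  show "vcomp V C a b d (vcomp V C b c d h g) f = vcomp V C a c d h (vcomp V C a b c g f)"
    if "a \<in> VObj C" "b \<in> VObj C" "c \<in> VObj C" "d \<in> VObj C"
      "f \<in> hom V z (VHom C a b)" "g \<in> hom V z (VHom C b c)" "h \<in> hom V z (VHom C c d)" for a b c d f g h z
  proof (rule mono[of a d _ z])
    have "FArr F a d \<cdot> vcomp V C a b d (vcomp V C b c d h g) f =
      vcomp V D (FObj F a) (FObj F b) (FObj F d)
       (vcomp V D (FObj F b) (FObj F c) (FObj F d) (FArr F c d \<cdot> h) (FArr F b c \<cdot> g)) (FArr F a b \<cdot> f)"
      using that va[of b c d h z g] by (simp add: Fc[where z = z] del: in_hom_iff)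
    also have "\<dots> = vcomp V D (FObj F a) (FObj F c) (FObj F d) (FArr F c d \<cdot> h)
       (vcomp V D (FObj F a) (FObj F b) (FObj F c) (FArr F b c \<cdot> g) (FArr F a b \<cdot> f))"
      by (rule D.vcomp_assoc[where z = z]) (use that FO FA in auto)
    also have "\<dots> = FArr F a d \<cdot> vcomp V C a c d h (vcomp V C a b c g f)"
      using that va[of a b c g z f] by (simp add: Fc[where z = z] del: in_hom_iff)
    finally show "FArr F a d \<cdot> vcomp V C a b d (vcomp V C b c d h g) f =
      FArr F a d \<cdot> vcomp V C a c d h (vcomp V C a b c g f)" .
  qed (use that va[of a b d "vcomp V C b c d h g" z f] va[of a c d h z "vcomp V C a b c g f"]
      va[of b c d h z g] va[of a b c g z f] in auto)
  show "vcomp V C a b b (VIdt C b \<cdot> bang V z) f = f" "vcomp V C a a b f (VIdt C a \<cdot> bang V z) = f"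
    if "a \<in> VObj C" "b \<in> VObj C" "f \<in> hom V z (VHom C a b)" for a b f z
  proof -
    have z: "z \<in> Obj V" using that by auto
    have i: "VIdt C b \<cdot> bang V z \<in> hom V z (VHom C b b)" "VIdt C a \<cdot> bang V z \<in> hom V z (VHom C a a)"
      using idt[of a] idt[of b] z that by auto
    have "FArr F a b \<cdot> f \<in> hom V z (VHom D (FObj F a) (FObj F b))"
      using FA that by auto
    then have "FArr F a b \<cdot> vcomp V C a b b (VIdt C b \<cdot> bang V z) f = FArr F a b \<cdot> f"
      "FArr F a b \<cdot> vcomp V C a a b f (VIdt C a \<cdot> bang V z) = FArr F a b \<cdot> f"
      using that z FO i by (simp_all add: Fc[where z = z] Fi D.VIdt_left D.VIdt_right del: in_hom_iff)
    then show "vcomp V C a b b (VIdt C b \<cdot> bang V z) f = f" "vcomp V C a a b f (VIdt C a \<cdot> bang V z) = f"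
      using mono[of a b _ z f] that i va[of a b b _ z f] va[of a a b f z] by blast+
  qed
qed (use hom cmp idt in auto)

end

section \<open>Rigs and finite sums\<close>

text \<open>At a fixed stage the generalized elements of the carrier form an ordinary rig, and
  precomposition is a rig homomorphism between stages. The sum lemmas below are the usual
  ones for that rig.\<close>

locale rig_in_ccc = cartesian_closed V + rig_in V R for V :: "('o, 'm) ccc" (structure) and R :: "('o, 'm) rig"
begin

declare Car_in [simp]

abbreviation X where "X \<equiv> Car R"

lemma rig_arr [simp]:
  assumes "x \<in> Arr V" "y \<in> Arr V" "Cod V x = X" "Cod V y = X" "Dom V x = Dom V y"
  shows "radd V R x y \<in> Arr V" "Dom V (radd V R x y) = Dom V y" "Cod V (radd V R x y) = X"
    "rmul V R x y \<in> Arr V" "Dom V (rmul V R x y) = Dom V y" "Cod V (rmul V R x y) = X"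
  using assms Add_in Mul_in by (auto simp: radd_def rmul_def)

lemma rig_comp [simp]:
  assumes "x \<in> Arr V" "y \<in> Arr V" "Cod V x = X" "Cod V y = X" "Dom V x = Dom V y"
    "s \<in> Arr V" "Cod V s = Dom V y"
  shows "radd V R x y \<cdot> s = radd V R (x \<cdot> s) (y \<cdot> s)"
    "rmul V R x y \<cdot> s = rmul V R (x \<cdot> s) (y \<cdot> s)"
  using assms Add_in Mul_in by (auto simp: radd_def rmul_def)

lemma const_arr [simp]:
  "Zer R \<in> Arr V" "Dom V (Zer R) = Trm V" "Cod V (Zer R) = X"
  "Uni R \<in> Arr V" "Dom V (Uni R) = Trm V" "Cod V (Uni R) = X"
  using Zer_in Uni_in by auto

lemma rconst_arr [simp]:
  assumes "z \<in> Obj V"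
  shows "rzero V R z \<in> Arr V" "Dom V (rzero V R z) = z" "Cod V (rzero V R z) = X"
    "rone V R z \<in> Arr V" "Dom V (rone V R z) = z" "Cod V (rone V R z) = X"
  using assms by (auto simp: rzero_def rone_def)

lemma rconst_comp [simp]:
  assumes "s \<in> Arr V" "Cod V s = z"
  shows "rzero V R z \<cdot> s = rzero V R (Dom V s)" "rone V R z \<cdot> s = rone V R (Dom V s)"
  using assms by (auto simp: rzero_def rone_def)

lemma const_comp [simp]:
  assumes "s \<in> Arr V" "Cod V s = Trm V"
  shows "Zer R \<cdot> s = rzero V R (Dom V s)" "Uni R \<cdot> s = rone V R (Dom V s)"
  using bang_unique[of s] assms by (auto simp: rzero_def rone_def)

lemma rsum_cong [cong]:
  "z = z' \<Longrightarrow> n = n' \<Longrightarrow> (\<And>i. i < n' \<Longrightarrow> f i = f' i) \<Longrightarrow> rsum V R z n f = rsum V R z' n' f'"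
  by (induction n arbitrary: n') auto

lemma rsum_arr [simp]:
  assumes "\<And>i. i < n \<Longrightarrow> f i \<in> Arr V" "\<And>i. i < n \<Longrightarrow> Dom V (f i) = z" "\<And>i. i < n \<Longrightarrow> Cod V (f i) = X"
    "z \<in> Obj V"
  shows "rsum V R z n f \<in> Arr V" "Dom V (rsum V R z n f) = z" "Cod V (rsum V R z n f) = X"
proof -
  have "rsum V R z n f \<in> hom V z X"
    using assms by (induction n) auto
  then show "rsum V R z n f \<in> Arr V" "Dom V (rsum V R z n f) = z" "Cod V (rsum V R z n f) = X"
    by auto
qed

lemma rsum_comp [simp]:
  assumes "\<And>i. i < n \<Longrightarrow> f i \<in> Arr V" "\<And>i. i < n \<Longrightarrow> Dom V (f i) = z" "\<And>i. i < n \<Longrightarrow> Cod V (f i) = X"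
    "z \<in> Obj V" "s \<in> Arr V" "Cod V s = z"
  shows "rsum V R z n f \<cdot> s = rsum V R (Dom V s) n (\<lambda>i. f i \<cdot> s)"
  using assms by (induction n) auto

lemma rmul_rsum:
  assumes "\<And>i. i < n \<Longrightarrow> f i \<in> hom V z X" "x \<in> hom V z X"
  shows "rmul V R x (rsum V R z n f) = rsum V R z n (\<lambda>i. rmul V R x (f i))"
proof -
  have "z \<in> Obj V" using assms by auto
  with assms show ?thesis
    by (induction n) (auto simp: mul_zero mul_add[where z = z])
qed

lemma rsum_rmul:
  assumes "\<And>i. i < n \<Longrightarrow> f i \<in> hom V z X" "x \<in> hom V z X"
  shows "rmul V R (rsum V R z n f) x = rsum V R z n (\<lambda>i. rmul V R (f i) x)"
proof -
  have "z \<in> Obj V" using assms by auto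
  with assms show ?thesis
    by (induction n) (auto simp: zero_mul add_mul[where z = z])
qed

lemma rsum_zero: "z \<in> Obj V \<Longrightarrow> rsum V R z n (\<lambda>i. rzero V R z) = rzero V R z"
  by (induction n) (auto simp: add_zero)

lemma radd_radd_commute:
  assumes "a \<in> hom V z X" "b \<in> hom V z X" "c \<in> hom V z X" "d \<in> hom V z X"
  shows "radd V R (radd V R a b) (radd V R c d) = radd V R (radd V R a c) (radd V R b d)"
proof -
  have "radd V R b (radd V R c d) = radd V R c (radd V R b d)"
    using assms add_assoc[of b z c d] add_assoc[of c z b d] add_comm[of b z c] by simp
  then show ?thesis
    using assms by (simp add: add_assoc[where z = z])
qed

lemma rsum_radd:
  assumes "\<And>i. i < n \<Longrightarrow> f i \<in> hom V z X" "\<And>i. i < n \<Longrightarrow> g i \<in> hom V z X" "z \<in> Obj V"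
  shows "rsum V R z n (\<lambda>i. radd V R (f i) (g i)) = radd V R (rsum V R z n f) (rsum V R z n g)"
  using assms
proof (induction n)
  case (Suc n)
  then show ?case
    using radd_radd_commute[of "rsum V R z n f" z "rsum V R z n g" "f n" "g n"] by auto
qed (auto simp: add_zero)

lemma rsum_swap:
  assumes "\<And>i j. i < n \<Longrightarrow> j < m \<Longrightarrow> f i j \<in> hom V z X" "z \<in> Obj V"
  shows "rsum V R z n (\<lambda>i. rsum V R z m (f i)) = rsum V R z m (\<lambda>j. rsum V R z n (\<lambda>i. f i j))"
  using assms
proof (induction n)
  case (Suc n)
  then show ?case
    using rsum_radd[of m "\<lambda>j. rsum V R z n (\<lambda>i. f i j)" z "f n"] by auto
qed (auto simp: rsum_zero)

lemma rsum_delta: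
  assumes "\<And>i. i < n \<Longrightarrow> f i \<in> hom V z X" "z \<in> Obj V" "k < n"
  shows "rsum V R z n (\<lambda>i. if i = k then f i else rzero V R z) = f k"
  using assms
proof (induction n)
  case (Suc n)
  show ?case
  proof (cases "k = n")
    case True
    then have "rsum V R z n (\<lambda>i. if i = k then f i else rzero V R z) = rsum V R z n (\<lambda>i. rzero V R z)"
      by (intro rsum_cong) auto
    then show ?thesis using True Suc by (auto simp: rsum_zero add_zero)
  next
    case False
    then have "rsum V R z n (\<lambda>i. if i = k then f i else rzero V R z) = f k"
      using Suc by auto
    then show ?thesis using False Suc.prems add_comm[of "f k" z "rzero V R z"]
      by (auto simp: add_zero)
  qed
qed auto

end

section \<open>Matrices and their action on powers of the carrier\<close>

context rig_in_ccc
begin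

declare mat_obj_def [simp] entry_def [simp] mk_mat_def [simp]

text \<open>The entry in row \<open>j\<close> and column \<open>i\<close> of a generalized \<open>m\<close> by \<open>n\<close> matrix \<open>a\<close>. The same
  notation serves for a tuple of vectors, with \<open>j\<close> numbering the vectors.\<close>

abbreviation entry_of :: "nat \<Rightarrow> nat \<Rightarrow> nat \<Rightarrow> nat \<Rightarrow> 'm \<Rightarrow> 'm" where
  "entry_of m n j i a \<equiv> pproj V X n i \<cdot> pproj V (pow V X n) m j \<cdot> a"

definition basis :: "'o \<Rightarrow> nat \<Rightarrow> nat \<Rightarrow> 'm" where
  "basis w n i = tuple V w X n (\<lambda>l. if l = i then rone V R w else rzero V R w)"

definition lact :: "nat \<Rightarrow> nat \<Rightarrow> 'm" where
  "lact = FArr (fst (snd (Mat_left V R)))"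

lemma Mat_left_eq: "Mat_left V R = (Mat V R, \<lparr>FObj = id, FArr = lact\<rparr>, full_theory V X)"
  by (simp add: Mat_left_def lact_def)

lemma Mat_simps [simp]:
  "VObj (Mat V R) = UNIV" "VHom (Mat V R) n m = pow V (pow V X n) m"
  by (auto simp: Mat_def)

lemma mat_ext:
  assumes "h \<in> hom V z (pow V (pow V X n) m)" "h' \<in> hom V z (pow V (pow V X n) m)"
    and "\<And>j i. j < m \<Longrightarrow> i < n \<Longrightarrow> entry_of m n j i h = entry_of m n j i h'"
  shows "h = h'"
proof (rule pow_ext)
  show "pproj V (pow V X n) m j \<cdot> h = pproj V (pow V X n) m j \<cdot> h'" if "j < m" for j
    by (rule pow_ext[of _ z X n]) (use that assms in simp_all)
qed (use assms in simp_all)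

lemma basis_arr [simp]:
  assumes "w \<in> Obj V"
  shows "basis w n i \<in> Arr V" "Dom V (basis w n i) = w" "Cod V (basis w n i) = pow V X n"
  using assms by (simp_all add: basis_def)

lemma pproj_basis [simp]:
  assumes "w \<in> Obj V" "l < n"
  shows "pproj V X n l \<cdot> basis w n i = (if l = i then rone V R w else rzero V R w)"
  using assms by (simp add: basis_def)

lemma basis_comp [simp]:
  assumes "s \<in> Arr V" "Cod V s = w"
  shows "basis w n i \<cdot> s = basis (Dom V s) n i"
proof (rule pow_ext)
  have w: "w \<in> Obj V" using assms by auto
  show "pproj V X n l \<cdot> basis w n i \<cdot> s = pproj V X n l \<cdot> basis (Dom V s) n i" if "l < n" for l
    using assms w that by (simp add: Cmp_assoc'[symmetric] del: Cmp_assoc')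
  show "basis w n i \<cdot> s \<in> hom V (Dom V s) (pow V X n)"
    using assms w by simp
qed (use assms in simp_all)

lemma Mat_VCmp_in: "VCmp (Mat V R) n m l \<in> hom V (Prd V (VHom (Mat V R) m l) (VHom (Mat V R) n m)) (VHom (Mat V R) n l)"
  by (simp add: Mat_def Let_def)

lemma entry_vcomp:
  assumes "b \<in> hom V w (pow V (pow V X m) l)" "a \<in> hom V w (pow V (pow V X n) m)" "k < l" "i < n"
  shows "entry_of l n k i (vcomp V (Mat V R) n m l b a) = rsum V R w m (\<lambda>j. rmul V R (entry_of l m k j b) (entry_of m n j i a))"
  using assms by (simp add: Mat_def Let_def vcomp_def)

lemma VIdt_Mat_arr [simp]: "VIdt (Mat V R) n \<in> Arr V" "Dom V (VIdt (Mat V R) n) = Trm V"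
  "Cod V (VIdt (Mat V R) n) = pow V (pow V X n) n"
  by (simp_all add: Mat_def)

lemma entry_VIdt:
  assumes "s \<in> hom V w (Trm V)" "j < n" "i < n"
  shows "entry_of n n j i (VIdt (Mat V R) n \<cdot> s) = (if j = i then rone V R w else rzero V R w)"
  using assms by (simp add: Mat_def)

lemma TProj_Mat_arr [simp]:
  "TProj (Mat V R) n i \<in> Arr V" "Dom V (TProj (Mat V R) n i) = Trm V"
  "Cod V (TProj (Mat V R) n i) = pow V X n"
  by (simp_all add: Mat_def)

lemma entry_TProj:
  assumes "s \<in> hom V w (Trm V)" "i' < n"
  shows "pproj V X n i' \<cdot> TProj (Mat V R) n i \<cdot> s = (if i' = i then rone V R w else rzero V R w)"
  using assms by (simp add: Mat_def)

lemma lact_arr [simp]: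
  "lact n m \<in> Arr V" "Dom V (lact n m) = pow V (pow V X n) m"
  "Cod V (lact n m) = IHom V (pow V X n) (pow V X m)"
  by (simp_all add: lact_def Mat_left_def Let_def)

lemma pproj_lact:
  assumes "a \<in> hom V w (pow V (pow V X n) m)" "x \<in> hom V w (pow V X n)" "j < m"
  shows "pproj V X m j \<cdot> ap (pow V X n) (pow V X m) (lact n m \<cdot> a) x =
    rsum V R w n (\<lambda>i. rmul V R (entry_of m n j i a) (pproj V X n i \<cdot> x))"
  using assms by (simp add: lact_def Mat_left_def Let_def)

lemma rmul_delta:
  assumes "\<And>i. i < n \<Longrightarrow> x i \<in> hom V z X" "k < n" "z \<in> Obj V"
  shows "rsum V R z n (\<lambda>i. rmul V R (if i = k then rone V R z else rzero V R z) (x i)) = x k"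
    "rsum V R z n (\<lambda>i. rmul V R (x i) (if i = k then rone V R z else rzero V R z)) = x k"
proof -
  have "rsum V R z n (\<lambda>i. rmul V R (if i = k then rone V R z else rzero V R z) (x i)) =
      rsum V R z n (\<lambda>i. if i = k then x i else rzero V R z)"
    by (rule rsum_cong) (use assms in \<open>simp_all add: one_mul zero_mul\<close>)
  then show "rsum V R z n (\<lambda>i. rmul V R (if i = k then rone V R z else rzero V R z) (x i)) = x k"
    using rsum_delta[of n x z k] assms by simp
  have "rsum V R z n (\<lambda>i. rmul V R (x i) (if i = k then rone V R z else rzero V R z)) =
      rsum V R z n (\<lambda>i. if i = k then x i else rzero V R z)"
    by (rule rsum_cong) (use assms in \<open>simp_all add: mul_one mul_zero\<close>)
  then show "rsum V R z n (\<lambda>i. rmul V R (x i) (if i = k then rone V R z else rzero V R z)) = x k"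
    using rsum_delta[of n x z k] assms by simp
qed

text \<open>Applied to a basis vector, a matrix gives its column, so its entries can be recovered from
  its action.\<close>

lemma lact_basis:
  assumes "a \<in> hom V w (pow V (pow V X n) m)" "j < m" "i < n"
  shows "pproj V X m j \<cdot> ap (pow V X n) (pow V X m) (lact n m \<cdot> a) (basis w n i) = entry_of m n j i a"
proof -
  have w: "w \<in> Obj V" using assms by auto
  show ?thesis
    using assms w by (simp add: pproj_lact[where w = w] rmul_delta)
qed

lemma lact_mono:
  assumes "h \<in> hom V z (pow V (pow V X n) m)" "h' \<in> hom V z (pow V (pow V X n) m)"
    and "lact n m \<cdot> h = lact n m \<cdot> h'"
  shows "h = h'"
  by (rule mat_ext[OF assms(1,2)]) (use lact_basis assms in metis)

text \<open>Associativity of a product of a row, a matrix and a column. It is behind the functoriality of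
  the action, and also behind the fact that left and right multiplications commute.\<close>

lemma rsum_assoc:
  assumes "\<And>j. j < m \<Longrightarrow> b j \<in> hom V w X" "\<And>i. i < n \<Longrightarrow> x i \<in> hom V w X"
    "\<And>j i. j < m \<Longrightarrow> i < n \<Longrightarrow> a j i \<in> hom V w X" "w \<in> Obj V"
  shows "rsum V R w n (\<lambda>i. rmul V R (rsum V R w m (\<lambda>j. rmul V R (b j) (a j i))) (x i)) =
    rsum V R w m (\<lambda>j. rmul V R (b j) (rsum V R w n (\<lambda>i. rmul V R (a j i) (x i))))"
proof -
  have "rsum V R w n (\<lambda>i. rmul V R (rsum V R w m (\<lambda>j. rmul V R (b j) (a j i))) (x i)) =
      rsum V R w n (\<lambda>i. rsum V R w m (\<lambda>j. rmul V R (b j) (rmul V R (a j i) (x i))))"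
    by (intro rsum_cong refl) (use assms in \<open>simp add: rsum_rmul mul_assoc[where z = w]\<close>)
  also have "\<dots> = rsum V R w m (\<lambda>j. rsum V R w n (\<lambda>i. rmul V R (b j) (rmul V R (a j i) (x i))))"
    by (rule rsum_swap) (use assms in simp_all)
  also have "\<dots> = rsum V R w m (\<lambda>j. rmul V R (b j) (rsum V R w n (\<lambda>i. rmul V R (a j i) (x i))))"
    by (intro rsum_cong refl) (use assms in \<open>simp add: rmul_rsum\<close>)
  finally show ?thesis .
qed

lemma lact_vcomp:
  assumes "b \<in> hom V z (pow V (pow V X m) l)" "a \<in> hom V z (pow V (pow V X n) m)"
  shows "lact n l \<cdot> vcomp V (Mat V R) n m l b a =
    vcomp V (self V) (pow V X n) (pow V X m) (pow V X l) (lact m l \<cdot> b) (lact n m \<cdot> a)"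
proof (rule ap_ext)
  have t: "vcomp V (Mat V R) n m l b a \<in> hom V z (pow V (pow V X n) l)"
    using vcomp_arr[OF Mat_VCmp_in] assms by simp
  show "lact n l \<cdot> vcomp V (Mat V R) n m l b a \<in> hom V z (IHom V (pow V X n) (pow V X l))"
    using t by simp
  fix w s x assume s: "s \<in> hom V w z" "x \<in> hom V w (pow V X n)"
  have w: "w \<in> Obj V" and z: "z \<in> Obj V" using s by auto
  let ?L = "ap (pow V X n) (pow V X l) (lact n l \<cdot> vcomp V (Mat V R) n m l b a \<cdot> s) x"
  let ?M = "ap (pow V X n) (pow V X m) (lact n m \<cdot> a \<cdot> s) x"
  let ?N = "ap (pow V X m) (pow V X l) (lact m l \<cdot> b \<cdot> s) ?M"
  have "?L = ?N"
  proof (rule pow_ext)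
    fix k assume k: "k < l"
    have e: "entry_of l n k i (vcomp V (Mat V R) n m l b a \<cdot> s) =
      rsum V R w m (\<lambda>j. rmul V R (entry_of l m k j (b \<cdot> s)) (entry_of m n j i (a \<cdot> s)))" if i: "i < n" for i
    proof -
      have "entry_of l n k i (vcomp V (Mat V R) n m l b a \<cdot> s) = entry_of l n k i (vcomp V (Mat V R) n m l b a) \<cdot> s"
        using t s k i by simp
      also have "\<dots> = rsum V R z m (\<lambda>j. rmul V R (entry_of l m k j b) (entry_of m n j i a)) \<cdot> s"
        using assms k i by (simp only: entry_vcomp)
      finally show ?thesis using s k i assms z by simp
    qed
    have "pproj V X l k \<cdot> ?L = rsum V R w n (\<lambda>i. rmul V R
      (rsum V R w m (\<lambda>j. rmul V R (entry_of l m k j (b \<cdot> s)) (entry_of m n j i (a \<cdot> s)))) (pproj V X n i \<cdot> x))"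
      using t s k e by (simp add: pproj_lact[where w = w])
    also have "\<dots> = rsum V R w m (\<lambda>j. rmul V R (entry_of l m k j (b \<cdot> s))
      (rsum V R w n (\<lambda>i. rmul V R (entry_of m n j i (a \<cdot> s)) (pproj V X n i \<cdot> x))))"
      by (rule rsum_assoc) (use assms s k w in simp_all)
    also have "\<dots> = pproj V X l k \<cdot> ?N"
      using assms s k by (simp add: pproj_lact[where w = w])
    finally show "pproj V X l k \<cdot> ?L = pproj V X l k \<cdot> ?N" .
  qed (use t s assms in simp_all)
  then show "ap (pow V X n) (pow V X l) ((lact n l \<cdot> vcomp V (Mat V R) n m l b a) \<cdot> s) x =
    ap (pow V X n) (pow V X l) (vcomp V (self V) (pow V X n) (pow V X m) (pow V X l) (lact m l \<cdot> b) (lact n m \<cdot> a) \<cdot> s) x"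
    using t s assms by simp
qed (use assms in simp_all)

lemma lact_VIdt: "lact n n \<cdot> VIdt (Mat V R) n = VIdt (self V) (pow V X n)"
proof (rule ap_ext)
  fix w s x assume s: "s \<in> hom V w (Trm V)" "x \<in> hom V w (pow V X n)"
  have w: "w \<in> Obj V" using s by auto
  let ?L = "ap (pow V X n) (pow V X n) (lact n n \<cdot> VIdt (Mat V R) n \<cdot> s) x"
  have "?L = x"
  proof (rule pow_ext)
    show "pproj V X n j \<cdot> ?L = pproj V X n j \<cdot> x" if "j < n" for j
      using s w that rmul_delta(1)[of n "\<lambda>i. pproj V X n i \<cdot> x" w j]
      by (simp add: pproj_lact[where w = w] entry_VIdt[where w = w] eq_commute[of j])
  qed (use s in simp_all)
  then show "ap (pow V X n) (pow V X n) ((lact n n \<cdot> VIdt (Mat V R) n) \<cdot> s) x =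
      ap (pow V X n) (pow V X n) (VIdt (self V) (pow V X n) \<cdot> s) x"
    using s by simp
qed simp_all

lemma lact_TProj:
  assumes "i < n"
  shows "lact n 1 \<cdot> TProj (Mat V R) n i = name_of V (pow V X n) X (pproj V X n i)"
proof (rule ap_ext)
  fix w s x assume s: "s \<in> hom V w (Trm V)" "x \<in> hom V w (pow V X n)"
  have w: "w \<in> Obj V" using s by auto
  let ?L = "ap (pow V X n) X (lact n 1 \<cdot> TProj (Mat V R) n i \<cdot> s) x"
  have "?L = pproj V X n i \<cdot> x"
    using s w assms rmul_delta(1)[of n "\<lambda>i. pproj V X n i \<cdot> x" w i]
      pproj_lact[of "TProj (Mat V R) n i \<cdot> s" w n 1 x 0]
    by (simp add: entry_TProj[where w = w])
  then show "ap (pow V X n) X ((lact n 1 \<cdot> TProj (Mat V R) n i) \<cdot> s) x =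
      ap (pow V X n) X (name_of V (pow V X n) X (pproj V X n i) \<cdot> s) x"
    using s assms by simp
qed (use assms in simp_all)

lemma is_theory_morphism_lact:
  "is_theory_morphism V (Mat V R) (full_theory V X) \<lparr>FObj = id, FArr = lact\<rparr>"
  unfolding is_theory_morphism_def is_vfunctor_def
proof (intro conjI allI ballI impI)
  fix n m l z g f assume "g \<in> hom V z (VHom (Mat V R) m l)" "f \<in> hom V z (VHom (Mat V R) n m)"
  then show "FArr \<lparr>FObj = id, FArr = lact\<rparr> n l \<cdot> vcomp V (Mat V R) n m l g f =
    vcomp V (full_theory V X) (FObj \<lparr>FObj = id, FArr = lact\<rparr> n) (FObj \<lparr>FObj = id, FArr = lact\<rparr> m)
      (FObj \<lparr>FObj = id, FArr = lact\<rparr> l) (FArr \<lparr>FObj = id, FArr = lact\<rparr> m l \<cdot> g)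
      (FArr \<lparr>FObj = id, FArr = lact\<rparr> n m \<cdot> f)"
    using lact_vcomp[of g z m l f n] by simp
next
  fix n i :: nat assume "i < n"
  then show "FArr \<lparr>FObj = id, FArr = lact\<rparr> n 1 \<cdot> TProj (Mat V R) n i = TProj (full_theory V X) n i"
    using lact_TProj by simp
qed (simp_all add: lact_VIdt)

lemma is_power_cong:
  "(\<And>i. i < n \<Longrightarrow> p i = p' i) \<Longrightarrow> is_power V n P Y p = is_power V n P Y p'"
  by (simp add: is_power_def)

text \<open>Multiplying by a standard basis row selects a row, so the powers in \<open>Mat V R\<close> are the powers
  of row objects that define the objects of matrices.\<close>

lemma vpost_TProj:
  assumes i: "i < n"
  shows "vpost V (Mat V R) c n 1 (TProj (Mat V R) n i) = pproj V (pow V X c) n i"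
proof (rule pow_ext)
  let ?M = "pow V (pow V X c) n"
  have M: "?M \<in> Obj V" by simp
  have t: "TProj (Mat V R) n i \<cdot> bang V ?M \<in> hom V ?M (pow V (pow V X n) 1)" by simp
  show "vpost V (Mat V R) c n 1 (TProj (Mat V R) n i) \<in> hom V ?M (pow V X c)"
    unfolding vpost_def using vcomp_arr[OF Mat_VCmp_in, of "TProj (Mat V R) n i \<cdot> bang V ?M" ?M n 1 "Idt V ?M" c] by simp
  fix k assume k: "k < c"
  have "entry_of 1 c 0 k (vpost V (Mat V R) c n 1 (TProj (Mat V R) n i)) =
    rsum V R ?M n (\<lambda>j. rmul V R (entry_of 1 n 0 j (TProj (Mat V R) n i \<cdot> bang V ?M)) (entry_of n c j k (Idt V ?M)))"
    unfolding vpost_def using entry_vcomp[of _ ?M n 1 "Idt V ?M" c 0 k, OF t] k by simp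
  also have "\<dots> = entry_of n c i k (Idt V ?M)"
    using k i rmul_delta(1)[of n "\<lambda>j. pproj V X c k \<cdot> pproj V (pow V X c) n j" ?M i]
    by (simp add: entry_TProj[where w = ?M])
  finally show "pproj V X c k \<cdot> vpost V (Mat V R) c n 1 (TProj (Mat V R) n i) =
    pproj V X c k \<cdot> pproj V (pow V X c) n i"
    using i k \<open>vpost V _ c n 1 _ \<in> _\<close> by simp
qed (use i in simp_all)

lemma is_theory_Mat: "is_theory V (Mat V R)"
  unfolding is_theory_def
proof (intro conjI allI)
  show "vcategory V (Mat V R)"
  proof (rule vcategory_faithful)
    show "vcategory V (full_theory V X)" using is_theory_full[of X] by (simp add: is_theory_def)
    show "is_vfunctor V (Mat V R) (full_theory V X) \<lparr>FObj = id, FArr = lact\<rparr>"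
      using is_theory_morphism_lact by (simp add: is_theory_morphism_def)
    show "VCmp (Mat V R) a b c \<in> hom V (Prd V (VHom (Mat V R) b c) (VHom (Mat V R) a b)) (VHom (Mat V R) a c)" for a b c
      by (rule Mat_VCmp_in)
    show "h = h'" if "h \<in> hom V z (VHom (Mat V R) a b)" "h' \<in> hom V z (VHom (Mat V R) a b)"
      "FArr \<lparr>FObj = id, FArr = lact\<rparr> a b \<cdot> h = FArr \<lparr>FObj = id, FArr = lact\<rparr> a b \<cdot> h'" for a b z h h'
      using lact_mono that by simp
  qed simp_all
  show "conical_power V (Mat V R) n n 1 (TProj (Mat V R) n)" for n
    unfolding conical_power_def
  proof (intro conjI ballI)
    fix c :: nat
    show "is_power V n (VHom (Mat V R) c n) (VHom (Mat V R) c 1)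
      (\<lambda>i. vpost V (Mat V R) c n 1 (TProj (Mat V R) n i))"
      by (subst is_power_cong[OF vpost_TProj], assumption) (use is_power_pow[of "pow V X c" n] in simp)
  qed simp_all
  show "TProj (Mat V R) 1 0 = VIdt (Mat V R) 1"
    by (simp add: Mat_def)
qed simp

end

section \<open>Natural families into the base\<close>

context cartesian_closed
begin

text \<open>The typing part of a functor into the base: enough to speak of natural families at
  generalized elements and to compose them. Powers of an algebra are used through it.\<close>

definition graph_map :: "('c, 'o, 'm, 'x) vcat_scheme \<Rightarrow> ('c, 'o, 'm) vfun \<Rightarrow> bool" where
  "graph_map C F \<longleftrightarrow> (\<forall>k \<in> VObj C. FObj F k \<in> Obj V) \<and>
    (\<forall>k \<in> VObj C. \<forall>l \<in> VObj C. VHom C k l \<in> Obj V \<and>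
      FArr F k l \<in> hom V (VHom C k l) (IHom V (FObj F k) (FObj F l)))"

lemma graph_mapD:
  assumes "graph_map C F" "k \<in> VObj C"
  shows "FObj F k \<in> Obj V"
    "l \<in> VObj C \<Longrightarrow> VHom C k l \<in> Obj V"
    "l \<in> VObj C \<Longrightarrow> FArr F k l \<in> hom V (VHom C k l) (IHom V (FObj F k) (FObj F l))"
  using assms unfolding graph_map_def by blast+

text \<open>Naturality is defined at the generic pair over \<open>VHom C k l \<times> z\<close>; by precomposition it
  gives the usual naturality square for elements \<open>a\<close>, \<open>s\<close> and \<open>x\<close> at any stage, and conversely.\<close>

lemma natural_family_iff:
  assumes F: "graph_map C F" and G: "graph_map C G"
  shows "vnatural_family V C (self V) F G z \<phi> \<longleftrightarrow> z \<in> Obj V \<and>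
    (\<forall>k \<in> VObj C. \<phi> k \<in> hom V z (IHom V (FObj F k) (FObj G k))) \<and>
    (\<forall>k \<in> VObj C. \<forall>l \<in> VObj C. \<forall>w a s x.
      a \<in> hom V w (VHom C k l) \<longrightarrow> s \<in> hom V w z \<longrightarrow> x \<in> hom V w (FObj F k) \<longrightarrow>
      ap (FObj G k) (FObj G l) (FArr G k l \<cdot> a) (ap (FObj F k) (FObj G k) (\<phi> k \<cdot> s) x) =
      ap (FObj F l) (FObj G l) (\<phi> l \<cdot> s) (ap (FObj F k) (FObj F l) (FArr F k l \<cdot> a) x))"
  (is "?L \<longleftrightarrow> ?z \<and> ?t \<and> ?e")
proof -
  let ?eq = "\<lambda>k l. vcomp V (self V) (FObj F k) (FObj G k) (FObj G l)
        (FArr G k l \<cdot> Pr1 V (VHom C k l) z) (\<phi> k \<cdot> Pr2 V (VHom C k l) z) =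
      vcomp V (self V) (FObj F k) (FObj F l) (FObj G l)
        (\<phi> l \<cdot> Pr2 V (VHom C k l) z) (FArr F k l \<cdot> Pr1 V (VHom C k l) z)"
  let ?pw = "\<lambda>k l. \<forall>w a s x.
      a \<in> hom V w (VHom C k l) \<longrightarrow> s \<in> hom V w z \<longrightarrow> x \<in> hom V w (FObj F k) \<longrightarrow>
      ap (FObj G k) (FObj G l) (FArr G k l \<cdot> a) (ap (FObj F k) (FObj G k) (\<phi> k \<cdot> s) x) =
      ap (FObj F l) (FObj G l) (\<phi> l \<cdot> s) (ap (FObj F k) (FObj F l) (FArr F k l \<cdot> a) x)"
  have "?eq k l \<longleftrightarrow> ?pw k l" if z: ?z and t: ?t and k: "k \<in> VObj C" and l: "l \<in> VObj C" for k l
  proof -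
    have ty: "FObj F k \<in> Obj V" "FObj F l \<in> Obj V" "FObj G k \<in> Obj V" "FObj G l \<in> Obj V"
      "VHom C k l \<in> Obj V"
      "FArr F k l \<in> hom V (VHom C k l) (IHom V (FObj F k) (FObj F l))"
      "FArr G k l \<in> hom V (VHom C k l) (IHom V (FObj G k) (FObj G l))"
      "\<phi> k \<in> hom V z (IHom V (FObj F k) (FObj G k))" "\<phi> l \<in> hom V z (IHom V (FObj F l) (FObj G l))"
      using graph_mapD[OF F] graph_mapD[OF G] k l t by blast+
    show ?thesis
    proof
      assume eq: "?eq k l"
      show "?pw k l"
      proof (intro allI impI)
        fix w a s x assume as: "a \<in> hom V w (VHom C k l)" "s \<in> hom V w z" "x \<in> hom V w (FObj F k)"
        have "ap (FObj F k) (FObj G l) (vcomp V (self V) (FObj F k) (FObj G k) (FObj G l)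
            (FArr G k l \<cdot> Pr1 V (VHom C k l) z) (\<phi> k \<cdot> Pr2 V (VHom C k l) z) \<cdot> pair V a s) x =
          ap (FObj F k) (FObj G l) (vcomp V (self V) (FObj F k) (FObj F l) (FObj G l)
            (\<phi> l \<cdot> Pr2 V (VHom C k l) z) (FArr F k l \<cdot> Pr1 V (VHom C k l) z) \<cdot> pair V a s) x"
          by (simp only: eq)
        then show "ap (FObj G k) (FObj G l) (FArr G k l \<cdot> a) (ap (FObj F k) (FObj G k) (\<phi> k \<cdot> s) x) =
          ap (FObj F l) (FObj G l) (\<phi> l \<cdot> s) (ap (FObj F k) (FObj F l) (FArr F k l \<cdot> a) x)"
          using as ty z by simp
      qed
    next
      assume pw: "?pw k l"
      show "?eq k l"
      proof (rule ap_ext[of _ "Prd V (VHom C k l) z" "FObj F k" "FObj G l"])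
        fix w s x assume s: "s \<in> hom V w (Prd V (VHom C k l) z)" "x \<in> hom V w (FObj F k)"
        have "Pr1 V (VHom C k l) z \<cdot> s \<in> hom V w (VHom C k l)" "Pr2 V (VHom C k l) z \<cdot> s \<in> hom V w z"
          using s ty z by simp_all
        then show "ap (FObj F k) (FObj G l) (vcomp V (self V) (FObj F k) (FObj G k) (FObj G l)
            (FArr G k l \<cdot> Pr1 V (VHom C k l) z) (\<phi> k \<cdot> Pr2 V (VHom C k l) z) \<cdot> s) x =
          ap (FObj F k) (FObj G l) (vcomp V (self V) (FObj F k) (FObj F l) (FObj G l)
            (\<phi> l \<cdot> Pr2 V (VHom C k l) z) (FArr F k l \<cdot> Pr1 V (VHom C k l) z) \<cdot> s) x"
          using s ty z pw[rule_format, of "Pr1 V (VHom C k l) z \<cdot> s" w "Pr2 V (VHom C k l) z \<cdot> s" x] by simp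
      qed (use ty z in simp_all)
    qed
  qed
  then show ?thesis unfolding vnatural_family_def self_simps by blast
qed

lemma natural_family_vcomp:
  assumes F: "graph_map C F" and G: "graph_map C G" and H: "graph_map C H"
    and \<phi>: "vnatural_family V C (self V) F G z \<phi>" and \<psi>: "vnatural_family V C (self V) G H z \<psi>"
  shows "vnatural_family V C (self V) F H z
    (\<lambda>k. vcomp V (self V) (FObj F k) (FObj G k) (FObj H k) (\<psi> k) (\<phi> k))"
proof -
  note nf = \<phi>[unfolded natural_family_iff[OF F G]] \<psi>[unfolded natural_family_iff[OF G H]]
  have ob: "FObj F k \<in> Obj V" "FObj G k \<in> Obj V" "FObj H k \<in> Obj V"
    "\<phi> k \<in> hom V z (IHom V (FObj F k) (FObj G k))" "\<psi> k \<in> hom V z (IHom V (FObj G k) (FObj H k))"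
    if "k \<in> VObj C" for k
    using graph_mapD(1)[OF F that] graph_mapD(1)[OF G that] graph_mapD(1)[OF H that] nf that by blast+
  show ?thesis
    unfolding natural_family_iff[OF F H]
  proof (intro conjI ballI allI impI)
    fix k l w a s x assume kl: "k \<in> VObj C" "l \<in> VObj C"
      and as: "a \<in> hom V w (VHom C k l)" "s \<in> hom V w z" "x \<in> hom V w (FObj F k)"
    have ty: "FArr F k l \<in> hom V (VHom C k l) (IHom V (FObj F k) (FObj F l))"
      using graph_mapD[OF F] kl by blast
    let ?y = "ap (FObj F k) (FObj G k) (\<phi> k \<cdot> s) x"
    have y: "?y \<in> hom V w (FObj G k)" using ob kl as by simp
    have "ap (FObj H k) (FObj H l) (FArr H k l \<cdot> a) (ap (FObj G k) (FObj H k) (\<psi> k \<cdot> s) ?y) =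
      ap (FObj G l) (FObj H l) (\<psi> l \<cdot> s) (ap (FObj G k) (FObj G l) (FArr G k l \<cdot> a) ?y)"
      using nf(2) kl as y by blast
    also have "ap (FObj G k) (FObj G l) (FArr G k l \<cdot> a) ?y =
      ap (FObj F l) (FObj G l) (\<phi> l \<cdot> s) (ap (FObj F k) (FObj F l) (FArr F k l \<cdot> a) x)"
      using nf(1) kl as by blast
    finally show "ap (FObj H k) (FObj H l) (FArr H k l \<cdot> a)
        (ap (FObj F k) (FObj H k) (vcomp V (self V) (FObj F k) (FObj G k) (FObj H k) (\<psi> k) (\<phi> k) \<cdot> s) x) =
      ap (FObj F l) (FObj H l) (vcomp V (self V) (FObj F l) (FObj G l) (FObj H l) (\<psi> l) (\<phi> l) \<cdot> s)
        (ap (FObj F k) (FObj F l) (FArr F k l \<cdot> a) x)"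
      using ob[OF kl(1)] ob[OF kl(2)] as ty by simp
  qed (use nf ob in simp_all)
qed

lemma natural_family_reindex:
  assumes F: "graph_map C F" and G: "graph_map C G"
    and \<phi>: "vnatural_family V C (self V) F G z \<phi>" and s: "s \<in> hom V w z"
  shows "vnatural_family V C (self V) F G w (\<lambda>k. \<phi> k \<cdot> s)"
proof -
  note nf = \<phi>[unfolded natural_family_iff[OF F G]]
  show ?thesis
    unfolding natural_family_iff[OF F G]
  proof (intro conjI ballI allI impI)
    fix k l w' a s' x assume kl: "k \<in> VObj C" "l \<in> VObj C"
      and as: "a \<in> hom V w' (VHom C k l)" "s' \<in> hom V w' w" "x \<in> hom V w' (FObj F k)"
    have "s \<cdot> s' \<in> hom V w' z" using s as by simp
    moreover have "(\<phi> k \<cdot> s) \<cdot> s' = \<phi> k \<cdot> s \<cdot> s'" "(\<phi> l \<cdot> s) \<cdot> s' = \<phi> l \<cdot> s \<cdot> s'"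
      using nf kl s as by simp_all
    ultimately show "ap (FObj G k) (FObj G l) (FArr G k l \<cdot> a) (ap (FObj F k) (FObj G k) ((\<phi> k \<cdot> s) \<cdot> s') x) =
      ap (FObj F l) (FObj G l) ((\<phi> l \<cdot> s) \<cdot> s') (ap (FObj F k) (FObj F l) (FArr F k l \<cdot> a) x)"
      using nf kl as by metis
  qed (use nf s in auto)
qed

lemma natural_family_VIdt:
  assumes F: "graph_map C F"
  shows "vnatural_family V C (self V) F F (Trm V) (\<lambda>k. VIdt (self V) (FObj F k))"
  unfolding natural_family_iff[OF F F]
proof (intro conjI ballI allI impI)
  fix k l w a s x assume kl: "k \<in> VObj C" "l \<in> VObj C"
    and as: "a \<in> hom V w (VHom C k l)" "s \<in> hom V w (Trm V)" "x \<in> hom V w (FObj F k)"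
  have ty: "FObj F k \<in> Obj V" "FObj F l \<in> Obj V"
    "FArr F k l \<in> hom V (VHom C k l) (IHom V (FObj F k) (FObj F l))"
    using graph_mapD[OF F] kl by blast+
  show "ap (FObj F k) (FObj F l) (FArr F k l \<cdot> a) (ap (FObj F k) (FObj F k) (VIdt (self V) (FObj F k) \<cdot> s) x) =
    ap (FObj F l) (FObj F l) (VIdt (self V) (FObj F l) \<cdot> s) (ap (FObj F k) (FObj F l) (FArr F k l \<cdot> a) x)"
    using ty as by simp
qed (use F in \<open>auto simp: graph_map_def\<close>)

section \<open>Transport of theories along isomorphisms\<close>

lemma vfunctor_comp:
  assumes F: "is_vfunctor V C D F" and G: "is_vfunctor V D E G" and C: "vcategory V C"
  shows "is_vfunctor V C E (vfun_comp V G F)"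
proof -
  interpret C: vcategory V C by fact
  have FO: "FObj F a \<in> VObj D" and FA: "FArr F a a \<cdot> VIdt C a = VIdt D (FObj F a)" if "a \<in> VObj C" for a
    using F that by (simp_all add: is_vfunctor_def)
  have Ft: "FArr F a b \<in> hom V (VHom C a b) (VHom D (FObj F a) (FObj F b))" if "a \<in> VObj C" "b \<in> VObj C" for a b
    using F that unfolding is_vfunctor_def by blast
  have Gt: "FArr G a b \<in> hom V (VHom D a b) (VHom E (FObj G a) (FObj G b))" if "a \<in> VObj D" "b \<in> VObj D" for a b
    using G that unfolding is_vfunctor_def by blast
  show ?thesis
    unfolding is_vfunctor_def
  proof (intro conjI ballI allI)
    fix a b c z g f assume ob: "a \<in> VObj C" "b \<in> VObj C" "c \<in> VObj C"
      and gf: "g \<in> hom V z (VHom C b c)" "f \<in> hom V z (VHom C a b)"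
    have Fgf: "FArr F b c \<cdot> g \<in> hom V z (VHom D (FObj F b) (FObj F c))"
      "FArr F a b \<cdot> f \<in> hom V z (VHom D (FObj F a) (FObj F b))"
      using Ft[of b c] Ft[of a b] ob gf by simp_all
    have "FArr (vfun_comp V G F) a c \<cdot> vcomp V C a b c g f =
      FArr G (FObj F a) (FObj F c) \<cdot> FArr F a c \<cdot> vcomp V C a b c g f"
      using Gt[of "FObj F a" "FObj F c"] Ft[of a c] FO ob vcomp_arr[OF C.VCmp_in gf]
      by (simp add: vfun_comp_def)
    also have "FArr F a c \<cdot> vcomp V C a b c g f =
      vcomp V D (FObj F a) (FObj F b) (FObj F c) (FArr F b c \<cdot> g) (FArr F a b \<cdot> f)"
      using F ob gf unfolding is_vfunctor_def by blast
    also have "FArr G (FObj F a) (FObj F c) \<cdot> \<dots> = vcomp V E (FObj G (FObj F a)) (FObj G (FObj F b))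
      (FObj G (FObj F c)) (FArr G (FObj F b) (FObj F c) \<cdot> FArr F b c \<cdot> g) (FArr G (FObj F a) (FObj F b) \<cdot> FArr F a b \<cdot> f)"
      using G FO ob Fgf unfolding is_vfunctor_def by blast
    finally show "FArr (vfun_comp V G F) a c \<cdot> vcomp V C a b c g f =
      vcomp V E (FObj (vfun_comp V G F) a) (FObj (vfun_comp V G F) b) (FObj (vfun_comp V G F) c)
        (FArr (vfun_comp V G F) b c \<cdot> g) (FArr (vfun_comp V G F) a b \<cdot> f)"
      using Gt[of "FObj F b" "FObj F c"] Gt[of "FObj F a" "FObj F b"] Ft[of b c] Ft[of a b] ob gf FO
      by (simp add: vfun_comp_def)
  next
    fix a assume a: "a \<in> VObj C"
    have "(FArr G (FObj F a) (FObj F a) \<cdot> FArr F a a) \<cdot> VIdt C a = VIdt E (FObj G (FObj F a))"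
      using Gt[of "FObj F a" "FObj F a"] Ft[of a a] C.VIdt_in[OF a] FO[OF a] FA[OF a] a G
      by (simp add: is_vfunctor_def)
    then show "FArr (vfun_comp V G F) a a \<cdot> VIdt C a = VIdt E (FObj (vfun_comp V G F) a)"
      by (simp add: vfun_comp_def)
  next
    fix a b assume "a \<in> VObj C" "b \<in> VObj C"
    then show "FArr (vfun_comp V G F) a b \<in> hom V (VHom C a b) (VHom E (FObj (vfun_comp V G F) a) (FObj (vfun_comp V G F) b))"
      using Gt[of "FObj F a" "FObj F b"] Ft[of a b] FO by (simp add: vfun_comp_def)
  qed (use FO G in \<open>auto simp: vfun_comp_def is_vfunctor_def\<close>)
qed

lemma theory_morphism_comp:
  assumes F: "is_theory_morphism V T U F" and G: "is_theory_morphism V U W G" and T: "is_theory V T"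
  shows "is_theory_morphism V T W (vfun_comp V G F)"
  unfolding is_theory_morphism_def
proof (intro conjI allI impI)
  show "is_vfunctor V T W (vfun_comp V G F)"
    using vfunctor_comp F G T by (auto simp: is_theory_morphism_def is_theory_def)
  show "FObj (vfun_comp V G F) = id"
    using F G by (simp add: is_theory_morphism_def vfun_comp_def)
  fix n i :: nat assume i: "i < n"
  have "VObj T = UNIV" "TProj T n i \<in> hom V (Trm V) (VHom T n 1)"
    using T i unfolding is_theory_def conical_power_def by blast+
  moreover have "FArr F n 1 \<in> hom V (VHom T n 1) (VHom U n 1)"
    "FArr G n 1 \<in> hom V (VHom U n 1) (VHom W n 1)"
  proof -
    have F': "is_vfunctor V T U F" "FObj F = id" and G': "is_vfunctor V U W G" "FObj G = id"
      using F G by (simp_all add: is_theory_morphism_def)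
    have "n \<in> VObj U" for n using F' \<open>VObj T = UNIV\<close> by (auto simp: is_vfunctor_def)
    then show "FArr F n 1 \<in> hom V (VHom T n 1) (VHom U n 1)"
      "FArr G n 1 \<in> hom V (VHom U n 1) (VHom W n 1)"
      using F' G' \<open>VObj T = UNIV\<close> unfolding is_vfunctor_def by (metis UNIV_I id_apply)+
  qed
  ultimately show "FArr (vfun_comp V G F) n 1 \<cdot> TProj T n i = TProj W n i"
    using F G i by (simp add: is_theory_morphism_def vfun_comp_def)
qed

text \<open>The category axioms of \<open>U\<close> are reflected along \<open>H\<close>; its powers are those of \<open>T\<close>,
  because \<open>G\<close> carries postcomposition with a projection of \<open>T\<close> to postcomposition with the
  corresponding projection of \<open>U\<close>.\<close>

lemma theory_transport:
  fixes T U :: "('o, 'm) vtheory"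
  assumes T: "is_theory V T" and U: "VObj U = UNIV"
    and G: "\<And>n m. G n m \<in> hom V (VHom T n m) (VHom U n m)"
    and H: "\<And>n m. H n m \<in> hom V (VHom U n m) (VHom T n m)"
    and GH: "\<And>n m. G n m \<cdot> H n m = Idt V (VHom U n m)"
    and HG: "\<And>n m. H n m \<cdot> G n m = Idt V (VHom T n m)"
    and cmp_in: "\<And>n m l. VCmp U n m l \<in> hom V (Prd V (VHom U m l) (VHom U n m)) (VHom U n l)"
    and cmp: "\<And>n m l z b a. b \<in> hom V z (VHom T m l) \<Longrightarrow> a \<in> hom V z (VHom T n m) \<Longrightarrow>
      G n l \<cdot> vcomp V T n m l b a = vcomp V U n m l (G m l \<cdot> b) (G n m \<cdot> a)"
    and idt: "\<And>n. VIdt U n = G n n \<cdot> VIdt T n"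
    and proj: "\<And>n i. i < n \<Longrightarrow> TProj U n i = G n 1 \<cdot> TProj T n i"
  shows "is_theory V U" "is_theory_morphism V T U \<lparr>FObj = id, FArr = G\<rparr>"
    "is_theory_morphism V U T \<lparr>FObj = id, FArr = H\<rparr>"
proof -
  interpret T: vcategory V T using T by (simp add: is_theory_def)
  have TU: "VObj T = UNIV" and Tp: "\<And>n. conical_power V T n n 1 (TProj T n)" and T1: "TProj T 1 0 = VIdt T 1"
    using T by (simp_all add: is_theory_def)
  have TI: "VIdt T n \<in> hom V (Trm V) (VHom T n n)" for n using T.VIdt_in TU by blast
  have TP: "TProj T n i \<in> hom V (Trm V) (VHom T n 1)" if "i < n" for n i
    using Tp that unfolding conical_power_def by blast
  have TH: "VHom T n m \<in> Obj V" for n m using T.VHom_in TU by blast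
  have UH: "VHom U n m \<in> Obj V" for n m using G[of n m] arr_obj(2)[of "G n m"] by (simp del: arr_obj)
  have tc: "vcomp V T n m l b a \<in> hom V z (VHom T n l)"
    if "b \<in> hom V z (VHom T m l)" "a \<in> hom V z (VHom T n m)" for n m l b a z
    by (rule vcomp_arr[OF T.VCmp_in]) (use that TU in simp_all)
  have GHc: "G n m \<cdot> H n m \<cdot> f = f" if "f \<in> hom V z (VHom U n m)" for n m f z
    using Cmp_assoc'[of f "H n m" "G n m"] GH[of n m] G[of n m] H[of n m] that by simp
  have HGc: "H n m \<cdot> G n m \<cdot> f = f" if "f \<in> hom V z (VHom T n m)" for n m f z
    using Cmp_assoc'[of f "G n m" "H n m"] HG[of n m] G[of n m] H[of n m] that by simp
  have cmpH: "H n l \<cdot> vcomp V U n m l b a = vcomp V T n m l (H m l \<cdot> b) (H n m \<cdot> a)"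
    if "b \<in> hom V z (VHom U m l)" "a \<in> hom V z (VHom U n m)" for n m l b a z
  proof -
    have Hb: "H m l \<cdot> b \<in> hom V z (VHom T m l)" "H n m \<cdot> a \<in> hom V z (VHom T n m)"
      using H[of m l] H[of n m] that by simp_all
    have "vcomp V U n m l b a = G n l \<cdot> vcomp V T n m l (H m l \<cdot> b) (H n m \<cdot> a)"
      using cmp[OF Hb] GHc[OF that(1)] GHc[OF that(2)] by simp
    then show ?thesis using HGc[OF tc[OF Hb]] by simp
  qed
  have Hfun: "is_vfunctor V U T \<lparr>FObj = id, FArr = H\<rparr>"
    unfolding is_vfunctor_def
  proof (intro conjI ballI allI)
    fix a b c z g f assume "g \<in> hom V z (VHom U b c)" "f \<in> hom V z (VHom U a b)"
    then show "FArr \<lparr>FObj = id, FArr = H\<rparr> a c \<cdot> vcomp V U a b c g f =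
       vcomp V T (FObj \<lparr>FObj = id, FArr = H\<rparr> a) (FObj \<lparr>FObj = id, FArr = H\<rparr> b)
        (FObj \<lparr>FObj = id, FArr = H\<rparr> c) (FArr \<lparr>FObj = id, FArr = H\<rparr> b c \<cdot> g)
        (FArr \<lparr>FObj = id, FArr = H\<rparr> a b \<cdot> f)"
      using cmpH[of g z b c f a] by simp
  next
    show "FArr \<lparr>FObj = id, FArr = H\<rparr> a a \<cdot> VIdt U a = VIdt T (FObj \<lparr>FObj = id, FArr = H\<rparr> a)" for a
      using HGc[OF TI[of a]] idt[of a] by simp
  qed (use H TU in simp_all)
  have Gfun: "is_vfunctor V T U \<lparr>FObj = id, FArr = G\<rparr>"
    unfolding is_vfunctor_def
  proof (intro conjI ballI allI)
    fix a b c z g f assume "g \<in> hom V z (VHom T b c)" "f \<in> hom V z (VHom T a b)"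
    then show "FArr \<lparr>FObj = id, FArr = G\<rparr> a c \<cdot> vcomp V T a b c g f =
       vcomp V U (FObj \<lparr>FObj = id, FArr = G\<rparr> a) (FObj \<lparr>FObj = id, FArr = G\<rparr> b)
        (FObj \<lparr>FObj = id, FArr = G\<rparr> c) (FArr \<lparr>FObj = id, FArr = G\<rparr> b c \<cdot> g)
        (FArr \<lparr>FObj = id, FArr = G\<rparr> a b \<cdot> f)"
      using cmp[of g z b c f a] by simp
  qed (use G U idt in simp_all)
  have UI: "VIdt U n \<in> hom V (Trm V) (VHom U n n)" for n
    using idt TI[of n] G[of n n] by simp
  have UP: "TProj U n i \<in> hom V (Trm V) (VHom U n 1)" if "i < n" for n i
    using proj TP[OF that] G[of n 1] that by simp
  have "vcategory V U"
  proof (rule vcategory_faithful[OF T.vcategory_axioms Hfun])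
    show "h = h'" if "h \<in> hom V z (VHom U a b)" "h' \<in> hom V z (VHom U a b)"
      "FArr \<lparr>FObj = id, FArr = H\<rparr> a b \<cdot> h = FArr \<lparr>FObj = id, FArr = H\<rparr> a b \<cdot> h'" for a b z h h'
      using GHc[OF that(1)] GHc[OF that(2)] that(3) by (metis vfun.select_convs(2))
  qed (use UH cmp_in UI in simp_all)
  moreover have "conical_power V U n n 1 (TProj U n)" for n
    unfolding conical_power_def
  proof (intro conjI ballI allI impI)
    fix c :: nat
    let ?p = "\<lambda>i. vpost V T c n 1 (TProj T n i)" and ?q = "\<lambda>i. vpost V U c n 1 (TProj U n i)"
    have p: "?p i \<in> hom V (VHom T c n) (VHom T c 1)" if "i < n" for i
      unfolding vpost_def by (rule tc) (use TP[OF that] TH in simp_all)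
    have q: "?q i \<cdot> G c n = G c 1 \<cdot> ?p i" "?q i \<in> hom V (VHom U c n) (VHom U c 1)" if i: "i < n" for i
    proof -
      let ?b = "TProj T n i \<cdot> bang V (VHom U c n)"
      have b: "?b \<in> hom V (VHom U c n) (VHom T n 1)" "TProj T n i \<cdot> bang V (VHom T c n) \<in> hom V (VHom T c n) (VHom T n 1)"
        using TP[OF i] UH TH by simp_all
      (* the identity of VHom U c n is expanded as G H, so that preservation of composition applies *)
      have "?q i = vcomp V U c n 1 (G n 1 \<cdot> ?b) (G c n \<cdot> H c n)"
        unfolding vpost_def using proj[OF i] TP[OF i] G[of n 1] UH GH[of c n] by simp
      also have "\<dots> = G c 1 \<cdot> vcomp V T c n 1 ?b (H c n)"
        by (rule cmp[OF b(1) H, symmetric])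
      finally have "?q i = G c 1 \<cdot> vcomp V T c n 1 ?b (H c n)" .
      moreover have "vcomp V T c n 1 ?b (H c n) = ?p i \<cdot> H c n"
        unfolding vpost_def vcomp_def
        using TP[OF i] H[of c n] TH UH T.VCmp_in[of c n 1] TU by simp
      ultimately have q: "?q i = G c 1 \<cdot> ?p i \<cdot> H c n" by simp
      then show "?q i \<in> hom V (VHom U c n) (VHom U c 1)"
        using p[OF i] G[of c 1] H[of c n] by simp
      show "?q i \<cdot> G c n = G c 1 \<cdot> ?p i"
        unfolding q using p[OF i] G[of c 1] H[of c n] G[of c n] HG[of c n] by simp
    qed
    have pw: "is_power V n (VHom T c n) (VHom T c 1) ?p"
      using Tp TU by (simp add: conical_power_def)
    show "is_power V n (VHom U c n) (VHom U c 1) ?q"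
      unfolding is_power_def
    proof (intro conjI ballI allI impI)
      fix z f assume z: "z \<in> Obj V" "\<forall>i<n. f i \<in> hom V z (VHom U c 1)"
      have "\<forall>i<n. H c 1 \<cdot> f i \<in> hom V z (VHom T c 1)" using z H[of c 1] by simp
      then have ex: "\<exists>!k. k \<in> hom V z (VHom T c n) \<and> (\<forall>i<n. ?p i \<cdot> k = H c 1 \<cdot> f i)"
        using pw z(1) unfolding is_power_def by simp
      then obtain k where k: "k \<in> hom V z (VHom T c n)" "\<forall>i<n. ?p i \<cdot> k = H c 1 \<cdot> f i" by blast
      show "\<exists>!h. h \<in> hom V z (VHom U c n) \<and> (\<forall>i<n. ?q i \<cdot> h = f i)"
      proof (rule ex1I[of _ "G c n \<cdot> k"], intro conjI allI impI)
        show "G c n \<cdot> k \<in> hom V z (VHom U c n)" using k G[of c n] by simp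
        fix i assume i: "i < n"
        have "?q i \<cdot> G c n \<cdot> k = (?q i \<cdot> G c n) \<cdot> k" using q(2)[OF i] k G[of c n] by simp
        also have "\<dots> = G c 1 \<cdot> ?p i \<cdot> k" using q[OF i] p[OF i] k G[of c 1] by simp
        also have "\<dots> = f i" using k i GHc[of "f i" z c 1] z by simp
        finally show "?q i \<cdot> G c n \<cdot> k = f i" .
      next
        fix h assume h: "h \<in> hom V z (VHom U c n) \<and> (\<forall>i<n. ?q i \<cdot> h = f i)"
        have Hh: "H c n \<cdot> h \<in> hom V z (VHom T c n)" using h H[of c n] by simp
        have "?p i \<cdot> H c n \<cdot> h = H c 1 \<cdot> f i" if i: "i < n" for i
        proof -
          have "f i = ?q i \<cdot> G c n \<cdot> H c n \<cdot> h" using h i GHc[of h z c n] by simp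
          also have "\<dots> = (?q i \<cdot> G c n) \<cdot> H c n \<cdot> h" using q(2)[OF i] Hh G[of c n] by simp
          also have "\<dots> = G c 1 \<cdot> ?p i \<cdot> H c n \<cdot> h" using q[OF i] p[OF i] Hh G[of c 1] by simp
          finally show ?thesis using HGc[of "?p i \<cdot> H c n \<cdot> h" z c 1] p[OF i] Hh by simp
        qed
        then have "H c n \<cdot> h = k" using ex k Hh by blast
        then show "h = G c n \<cdot> k" using GHc[of h z c n] h by simp
      qed
    qed (use UH q in blast)+
  qed (use U UP in simp_all)
  moreover have "TProj U 1 0 = VIdt U 1" using proj[of 0 1] idt[of 1] T1 by simp
  ultimately show "is_theory V U" using U by (simp add: is_theory_def)
  show "is_theory_morphism V T U \<lparr>FObj = id, FArr = G\<rparr>"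
    using Gfun proj by (simp add: is_theory_morphism_def)
  show "is_theory_morphism V U T \<lparr>FObj = id, FArr = H\<rparr>"
    using Hfun proj HGc[OF TP] by (simp add: is_theory_morphism_def)
qed

end

section \<open>The opposite rig\<close>

context rig_in_ccc
begin

lemma rig_op_simps [simp]:
  "Car (rig_op V R) = X" "Add (rig_op V R) = Add R" "Zer (rig_op V R) = Zer R" "Uni (rig_op V R) = Uni R"
  "radd V (rig_op V R) = radd V R" "rzero V (rig_op V R) = rzero V R" "rone V (rig_op V R) = rone V R"
  by (simp_all add: rig_op_def radd_def rzero_def rone_def fun_eq_iff)

lemma rmul_op [simp]:
  assumes "x \<in> Arr V" "y \<in> Arr V" "Cod V x = X" "Cod V y = X" "Dom V x = Dom V y"
  shows "rmul V (rig_op V R) x y = rmul V R y x"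
proof -
  have "rmul V (rig_op V R) x y = rmul V R (Pr2 V X X) (Pr1 V X X) \<cdot> pair V x y"
    by (simp add: rig_op_def rmul_def[of V "_\<lparr>Mul := _\<rparr>"])
  then show ?thesis using assms by simp
qed

lemma rsum_op [simp]: "rsum V (rig_op V R) z n f = rsum V R z n f"
  by (induction n) simp_all

lemma rig_op_in: "rig_in_ccc V (rig_op V R)"
proof
  show "Mul (rig_op V R) \<in> hom V (Prd V (Car (rig_op V R)) (Car (rig_op V R))) (Car (rig_op V R))"
    by (simp add: rig_op_def)
  show "radd V (rig_op V R) (radd V (rig_op V R) x y) w = radd V (rig_op V R) x (radd V (rig_op V R) y w)"
    "rmul V (rig_op V R) (rmul V (rig_op V R) x y) w = rmul V (rig_op V R) x (rmul V (rig_op V R) y w)"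
    "rmul V (rig_op V R) x (radd V (rig_op V R) y w) = radd V (rig_op V R) (rmul V (rig_op V R) x y) (rmul V (rig_op V R) x w)"
    "rmul V (rig_op V R) (radd V (rig_op V R) x y) w = radd V (rig_op V R) (rmul V (rig_op V R) x w) (rmul V (rig_op V R) y w)"
    if "x \<in> hom V z (Car (rig_op V R))" "y \<in> hom V z (Car (rig_op V R))" "w \<in> hom V z (Car (rig_op V R))" for x y w z
    using that by (simp_all add: add_assoc[where z = z] mul_assoc[where z = z] mul_add[where z = z] add_mul[where z = z])
  show "radd V (rig_op V R) x y = radd V (rig_op V R) y x"
    if "x \<in> hom V z (Car (rig_op V R))" "y \<in> hom V z (Car (rig_op V R))" for x y z
    using that add_comm[of x z y] by simp
  show "radd V (rig_op V R) (rzero V (rig_op V R) z) x = x"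
    "rmul V (rig_op V R) (rone V (rig_op V R) z) x = x"
    "rmul V (rig_op V R) x (rone V (rig_op V R) z) = x"
    "rmul V (rig_op V R) x (rzero V (rig_op V R) z) = rzero V (rig_op V R) z"
    "rmul V (rig_op V R) (rzero V (rig_op V R) z) x = rzero V (rig_op V R) z"
    if x: "x \<in> hom V z (Car (rig_op V R))" for x z
  proof -
    have "z \<in> Obj V" using x by auto
    then show "radd V (rig_op V R) (rzero V (rig_op V R) z) x = x"
      "rmul V (rig_op V R) (rone V (rig_op V R) z) x = x"
      "rmul V (rig_op V R) x (rone V (rig_op V R) z) = x"
      "rmul V (rig_op V R) x (rzero V (rig_op V R) z) = rzero V (rig_op V R) z"
      "rmul V (rig_op V R) (rzero V (rig_op V R) z) x = rzero V (rig_op V R) z"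
      using x by (simp_all add: add_zero mul_one one_mul zero_mul mul_zero)
  qed
qed (use Add_in in simp_all)

lemma rig_op_op: "rig_op V (rig_op V R) = R"
proof -
  have "rmul V (rig_op V R) (Pr2 V X X) (Pr1 V X X) = Mul R"
    using Mul_in by (simp add: rmul_def[of V R])
  then show ?thesis by (simp add: rig_op_def)
qed

lemma Mat_right_eq: "Mat_right V R = Mat_left V (rig_op V R)"
  unfolding Mat_right_def Mat_left_def by (simp add: Let_def)

text \<open>The action of matrices over the opposite rig: right multiplication of vectors in powers of
  \<open>X\<close>, with products taken in \<open>R\<close>. Its properties are those of the left action, read in the
  opposite rig.\<close>

abbreviation ract :: "nat \<Rightarrow> nat \<Rightarrow> 'm" where
  "ract \<equiv> rig_in_ccc.lact V (rig_op V R)"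

lemmas ract_arr [simp] = rig_in_ccc.lact_arr[OF rig_op_in, simplified]
lemmas ract_mono = rig_in_ccc.lact_mono[OF rig_op_in, unfolded rig_op_simps]
lemmas ract_vcomp = rig_in_ccc.lact_vcomp[OF rig_op_in, unfolded rig_op_simps]
lemmas ract_VIdt = rig_in_ccc.lact_VIdt[OF rig_op_in, unfolded rig_op_simps]
lemmas ract_TProj = rig_in_ccc.lact_TProj[OF rig_op_in, unfolded rig_op_simps]

lemma pproj_ract:
  assumes "a \<in> hom V w (pow V (pow V X n) m)" "x \<in> hom V w (pow V X n)" "j < m"
  shows "pproj V X m j \<cdot> ap (pow V X n) (pow V X m) (ract n m \<cdot> a) x =
    rsum V R w n (\<lambda>i. rmul V R (pproj V X n i \<cdot> x) (entry_of m n j i a))"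
  using rig_in_ccc.pproj_lact[OF rig_op_in, of a w n m x j] assms by simp

section \<open>Natural transformations between powers of the module of scalars\<close>

abbreviation scalars :: "(nat, 'o, 'm) vfun" where
  "scalars \<equiv> algebra_of V X \<lparr>FObj = id, FArr = lact\<rparr>"

abbreviation scalars_pow :: "nat \<Rightarrow> (nat, 'o, 'm) vfun" where
  "scalars_pow \<equiv> alg_pow V (Mat V R) scalars"

lemma scalars_pow_FObj [simp]: "FObj (scalars_pow n) k = pow V (pow V X k) n"
  by (simp add: alg_pow_def algebra_of_def)

lemma scalars_pow_FArr_arr [simp]:
  "FArr (scalars_pow n) k l \<in> Arr V" "Dom V (FArr (scalars_pow n) k l) = pow V (pow V X k) l"
  "Cod V (FArr (scalars_pow n) k l) = IHom V (pow V (pow V X k) n) (pow V (pow V X l) n)"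
  by (simp_all add: alg_pow_def algebra_of_def Let_def ap_def[symmetric])

lemma graph_map_scalars_pow: "graph_map (Mat V R) (scalars_pow n)"
  by (simp add: graph_map_def)

lemma pproj_scalars_pow:
  assumes "a \<in> hom V w (pow V (pow V X k) l)" "x \<in> hom V w (pow V (pow V X k) n)" "i < n"
  shows "pproj V (pow V X l) n i \<cdot>
    ap (pow V (pow V X k) n) (pow V (pow V X l) n) (FArr (scalars_pow n) k l \<cdot> a) x =
    ap (pow V X k) (pow V X l) (lact k l \<cdot> a) (pproj V (pow V X k) n i \<cdot> x)"
  using assms by (simp add: alg_pow_def algebra_of_def Let_def ap_def[symmetric])

text \<open>A generalized element of \<open>(X\<^sup>k)\<^sup>n\<close> is a family of \<open>n\<close> vectors of length \<open>k\<close>; \<open>col\<close> collects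
  their components at position \<open>l\<close> into one vector of length \<open>n\<close>.\<close>

definition col :: "nat \<Rightarrow> nat \<Rightarrow> nat \<Rightarrow> 'm \<Rightarrow> 'm" where
  "col k n l x = tuple V (Dom V x) X n (\<lambda>i. entry_of n k i l x)"

lemma col_arr [simp]:
  assumes "x \<in> Arr V" "Cod V x = pow V (pow V X k) n" "l < k"
  shows "col k n l x \<in> Arr V" "Dom V (col k n l x) = Dom V x" "Cod V (col k n l x) = pow V X n"
  using assms by (simp_all add: col_def)

lemma pproj_col [simp]:
  assumes "x \<in> Arr V" "Cod V x = pow V (pow V X k) n" "l < k" "i < n"
  shows "pproj V X n i \<cdot> col k n l x = entry_of n k i l x"
  using assms by (simp add: col_def)

lemma pproj_col_comp:
  assumes "x \<in> Arr V" "Cod V x = pow V (pow V X k) n" "l < k" "i < n" "s \<in> Arr V" "Cod V s = Dom V x"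
  shows "pproj V X n i \<cdot> col k n l x \<cdot> s = entry_of n k i l (x \<cdot> s)"
  using assms by (simp add: col_def)

lemma col_comp [simp]:
  assumes "x \<in> Arr V" "Cod V x = pow V (pow V X k) n" "l < k" "s \<in> Arr V" "Cod V s = Dom V x"
  shows "col k n l x \<cdot> s = col k n l (x \<cdot> s)"
  by (rule pow_ext[of _ "Dom V s" X n]) (use assms in \<open>simp_all add: pproj_col_comp\<close>)

lemma col_ext:
  assumes "x \<in> hom V w (pow V (pow V X k) n)" "y \<in> hom V w (pow V (pow V X k) n)"
    and "\<And>l. l < k \<Longrightarrow> col k n l x = col k n l y"
  shows "x = y"
proof (rule mat_ext[OF assms(1,2)])
  fix i l assume "i < n" "l < k"
  then show "entry_of n k i l x = entry_of n k i l y"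
    using assms(3)[of l] pproj_col[of x k n l i] pproj_col[of y k n l i] assms(1,2) by simp
qed

text \<open>The first power of \<open>X\<close> is \<open>X\<close> itself, so for \<open>k = 1\<close> the only column is the given vector.\<close>

lemma col_1:
  assumes "x \<in> Arr V" "Cod V x = pow V X n"
  shows "col 1 n 0 x = x"
  by (rule pow_ext[of _ "Dom V x" X n]) (use assms pproj_col[of x 1 n 0] in simp_all)

text \<open>The component at \<open>k\<close> of right multiplication by a matrix, as a map from \<open>(X\<^sup>k)\<^sup>n\<close> to
  \<open>(X\<^sup>k)\<^sup>m\<close>: the right action applied to each of the \<open>k\<close> columns. Since it is defined columnwise, it
  inherits functoriality from the right action.\<close>

definition ract_pow :: "nat \<Rightarrow> nat \<Rightarrow> nat \<Rightarrow> 'm" where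
  "ract_pow k n m = (let N = pow V (pow V X n) m; P = pow V (pow V X k) n; z = Prd V N P in
    vcurry V N P (pow V (pow V X k) m) (mk_mat V R z m k (\<lambda>j l. pproj V X m j \<cdot>
      ap (pow V X n) (pow V X m) (ract n m \<cdot> Pr1 V N P) (col k n l (Pr2 V N P)))))"

lemma ract_pow_arr [simp]:
  "ract_pow k n m \<in> Arr V" "Dom V (ract_pow k n m) = pow V (pow V X n) m"
  "Cod V (ract_pow k n m) = IHom V (pow V (pow V X k) n) (pow V (pow V X k) m)"
  by (simp_all add: ract_pow_def Let_def)

lemma col_ract_pow:
  assumes "b \<in> hom V w (pow V (pow V X n) m)" "x \<in> hom V w (pow V (pow V X k) n)" "l < k"
  shows "col k m l (ap (pow V (pow V X k) n) (pow V (pow V X k) m) (ract_pow k n m \<cdot> b) x) =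
    ap (pow V X n) (pow V X m) (ract n m \<cdot> b) (col k n l x)"
proof (rule pow_ext[of _ w X m])
  fix j assume "j < m"
  then show "pproj V X m j \<cdot> col k m l (ap (pow V (pow V X k) n) (pow V (pow V X k) m) (ract_pow k n m \<cdot> b) x) =
    pproj V X m j \<cdot> ap (pow V X n) (pow V X m) (ract n m \<cdot> b) (col k n l x)"
    using assms by (simp, simp add: ract_pow_def Let_def)
qed (use assms in simp_all)

lemma ract_pow_1: "ract_pow 1 n m = ract n m"
proof (rule ap_ext[of _ "pow V (pow V X n) m" "pow V X n" "pow V X m"])
  fix w s x assume s: "s \<in> hom V w (pow V (pow V X n) m)" "x \<in> hom V w (pow V X n)"
  then show "ap (pow V X n) (pow V X m) (ract_pow 1 n m \<cdot> s) x = ap (pow V X n) (pow V X m) (ract n m \<cdot> s) x"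
    using col_ract_pow[of s w n m x 1 0] col_1[of x n]
      col_1[of "ap (pow V X n) (pow V X m) (ract_pow 1 n m \<cdot> s) x" m] by simp
qed simp_all

lemma ract_pow_ext:
  assumes "h \<in> hom V z (IHom V (pow V (pow V X k) n) (pow V (pow V X k) m))"
    "h' \<in> hom V z (IHom V (pow V (pow V X k) n) (pow V (pow V X k) m))"
    and "\<And>w s x l. s \<in> hom V w z \<Longrightarrow> x \<in> hom V w (pow V (pow V X k) n) \<Longrightarrow> l < k \<Longrightarrow>
      col k m l (ap (pow V (pow V X k) n) (pow V (pow V X k) m) (h \<cdot> s) x) =
      col k m l (ap (pow V (pow V X k) n) (pow V (pow V X k) m) (h' \<cdot> s) x)"
  shows "h = h'"
proof (rule ap_ext[OF assms(1,2)])
  fix w s x assume s: "s \<in> hom V w z" and x: "x \<in> hom V w (pow V (pow V X k) n)"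
  show "ap (pow V (pow V X k) n) (pow V (pow V X k) m) (h \<cdot> s) x =
    ap (pow V (pow V X k) n) (pow V (pow V X k) m) (h' \<cdot> s) x"
    by (rule col_ext[of _ w k m], use assms(1,2) s x in \<open>simp, simp\<close>) (rule assms(3)[OF s x])
qed simp_all

abbreviation Matop where "Matop \<equiv> Mat V (rig_op V R)"

lemma Matop_simps [simp]: "VObj Matop = UNIV" "VHom Matop n m = pow V (pow V X n) m"
  by (simp_all add: Mat_def)

lemmas Matop_VCmp_in = rig_in_ccc.Mat_VCmp_in[OF rig_op_in]
lemmas Matop_arr [simp] = rig_in_ccc.VIdt_Mat_arr[OF rig_op_in, unfolded rig_op_simps]
   rig_in_ccc.TProj_Mat_arr[OF rig_op_in, unfolded rig_op_simps]

lemma ract_pow_vcomp: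
  assumes b: "b \<in> hom V z (pow V (pow V X m) l)" and a: "a \<in> hom V z (pow V (pow V X n) m)"
  shows "ract_pow k n l \<cdot> vcomp V Matop n m l b a =
    vcomp V (self V) (pow V (pow V X k) n) (pow V (pow V X k) m) (pow V (pow V X k) l)
      (ract_pow k m l \<cdot> b) (ract_pow k n m \<cdot> a)"
proof (rule ract_pow_ext)
  have t: "vcomp V Matop n m l b a \<in> hom V z (pow V (pow V X n) l)"
    using vcomp_arr[OF Matop_VCmp_in] assms by simp
  then show "ract_pow k n l \<cdot> vcomp V Matop n m l b a
    \<in> hom V z (IHom V (pow V (pow V X k) n) (pow V (pow V X k) l))" by simp
  fix w s x q assume s: "s \<in> hom V w z" and x: "x \<in> hom V w (pow V (pow V X k) n)" and q: "q < k"
  let ?K = "\<lambda>n. pow V (pow V X k) n"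
  have "col k l q (ap (?K n) (?K l) (ract_pow k n l \<cdot> vcomp V Matop n m l b a \<cdot> s) x) =
     ap (pow V X n) (pow V X l) ((ract n l \<cdot> vcomp V Matop n m l b a) \<cdot> s) (col k n q x)"
    using t s x q by (simp add: col_ract_pow[where w = w])
  also have "\<dots> = ap (pow V X m) (pow V X l) (ract m l \<cdot> b \<cdot> s) (ap (pow V X n) (pow V X m) (ract n m \<cdot> a \<cdot> s) (col k n q x))"
    using ract_vcomp[OF b a] a b s x q by simp
  also have "\<dots> = col k l q (ap (?K m) (?K l) (ract_pow k m l \<cdot> b \<cdot> s) (ap (?K n) (?K m) (ract_pow k n m \<cdot> a \<cdot> s) x))"
    using a b s x q by (simp add: col_ract_pow[where w = w])
  finally show "col k l q (ap (?K n) (?K l) ((ract_pow k n l \<cdot> vcomp V Matop n m l b a) \<cdot> s) x) =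
    col k l q (ap (?K n) (?K l) (vcomp V (self V) (?K n) (?K m) (?K l) (ract_pow k m l \<cdot> b) (ract_pow k n m \<cdot> a) \<cdot> s) x)"
    using t a b s x by simp
qed (use a b in simp_all)

lemma ract_pow_VIdt: "ract_pow k n n \<cdot> VIdt Matop n = VIdt (self V) (pow V (pow V X k) n)"
proof (rule ract_pow_ext)
  fix w s x q assume s: "s \<in> hom V w (Trm V)" and x: "x \<in> hom V w (pow V (pow V X k) n)" and q: "q < k"
  let ?K = "pow V (pow V X k) n"
  have "col k n q (ap ?K ?K (ract_pow k n n \<cdot> VIdt Matop n \<cdot> s) x) =
    ap (pow V X n) (pow V X n) ((ract n n \<cdot> VIdt Matop n) \<cdot> s) (col k n q x)"
    using s x q by (simp add: col_ract_pow[where w = w])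
  also have "\<dots> = col k n q x" unfolding ract_VIdt using s x q by simp
  finally show "col k n q (ap ?K ?K ((ract_pow k n n \<cdot> VIdt Matop n) \<cdot> s) x) =
    col k n q (ap ?K ?K (VIdt (self V) ?K \<cdot> s) x)"
    using s x by simp
qed simp_all

lemma ract_pow_TProj:
  assumes i: "i < n"
  shows "ract_pow k n 1 \<cdot> TProj Matop n i = name_of V (pow V (pow V X k) n) (pow V X k) (pproj V (pow V X k) n i)"
proof (rule ract_pow_ext[of _ "Trm V" k n 1])
  fix w s x q assume s: "s \<in> hom V w (Trm V)" and x: "x \<in> hom V w (pow V (pow V X k) n)" and q: "q < k"
  let ?K = "pow V (pow V X k) n"
  have "col k 1 q (ap ?K (pow V X k) (ract_pow k n 1 \<cdot> TProj Matop n i \<cdot> s) x) =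
    ap (pow V X n) X ((ract n 1 \<cdot> TProj Matop n i) \<cdot> s) (col k n q x)"
    using s x q col_ract_pow[of "TProj Matop n i \<cdot> s" w n 1 x k q] by simp
  also have "\<dots> = entry_of n k i q x" unfolding ract_TProj[OF i] using s x q i by simp
  also have "\<dots> = col k 1 q (pproj V (pow V X k) n i \<cdot> x)"
    using s x q i pproj_col[of "pproj V (pow V X k) n i \<cdot> x" k 1 q 0] by simp
  finally show "col k 1 q (ap ?K (pow V (pow V X k) 1) ((ract_pow k n 1 \<cdot> TProj Matop n i) \<cdot> s) x) =
    col k 1 q (ap ?K (pow V (pow V X k) 1) (name_of V ?K (pow V X k) (pproj V (pow V X k) n i) \<cdot> s) x)"
    using s x i by simp
qed (use i in simp_all)

lemma entry_ract_pow:
  assumes "b \<in> hom V w (pow V (pow V X n) m)" "x \<in> hom V w (pow V (pow V X k) n)" "l < k" "j < m"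
  shows "entry_of m k j l (ap (pow V (pow V X k) n) (pow V (pow V X k) m) (ract_pow k n m \<cdot> b) x) =
    rsum V R w n (\<lambda>i. rmul V R (entry_of n k i l x) (entry_of m n j i b))"
proof -
  let ?y = "ap (pow V (pow V X k) n) (pow V (pow V X k) m) (ract_pow k n m \<cdot> b) x"
  have "entry_of m k j l ?y = pproj V X m j \<cdot> col k m l ?y"
    by (rule pproj_col[symmetric]) (use assms in simp_all)
  also have "\<dots> = rsum V R w n (\<lambda>i. rmul V R (entry_of n k i l x) (entry_of m n j i b))"
    using assms by (simp add: col_ract_pow[where w = w] pproj_ract[where w = w])
  finally show ?thesis .
qed

text \<open>Entrywise, naturality is the identity \<open>a (x b) = (a x) b\<close> for a matrix \<open>a\<close> acting from the left
  and a matrix \<open>b\<close> acting from the right.\<close>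

lemma ract_pow_natural:
  "vnatural_family V (Mat V R) (self V) (scalars_pow n) (scalars_pow m) (pow V (pow V X n) m) (\<lambda>k. ract_pow k n m)"
  unfolding natural_family_iff[OF graph_map_scalars_pow graph_map_scalars_pow]
proof (intro conjI ballI allI impI)
  fix k l w a b x
  assume "a \<in> hom V w (VHom (Mat V R) k l)" and b: "b \<in> hom V w (pow V (pow V X n) m)"
    and "x \<in> hom V w (FObj (scalars_pow n) k)"
  then have a: "a \<in> hom V w (pow V (pow V X k) l)" and x: "x \<in> hom V w (pow V (pow V X k) n)" by simp_all
  have w: "w \<in> Obj V" using a by auto
  let ?kn = "pow V (pow V X k) n" and ?km = "pow V (pow V X k) m"
    and ?ln = "pow V (pow V X l) n" and ?lm = "pow V (pow V X l) m"
  let ?y = "ap ?kn ?km (ract_pow k n m \<cdot> b) x" and ?x = "ap ?kn ?ln (FArr (scalars_pow n) k l \<cdot> a) x"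
  have y: "?y \<in> hom V w ?km" and x': "?x \<in> hom V w ?ln"
    using a b x by simp_all
  have "ap ?km ?lm (FArr (scalars_pow m) k l \<cdot> a) ?y = ap ?ln ?lm (ract_pow l n m \<cdot> b) ?x"
  proof (rule mat_ext[of _ w l m])
    fix j p assume j: "j < m" and p: "p < l"
    have "entry_of m l j p (ap ?km ?lm (FArr (scalars_pow m) k l \<cdot> a) ?y) =
      rsum V R w k (\<lambda>q. rmul V R (entry_of l k p q a) (entry_of m k j q ?y))"
      using a y j p by (simp add: pproj_scalars_pow[where w = w] pproj_lact[where w = w])
    also have "\<dots> = rsum V R w k (\<lambda>q. rmul V R (entry_of l k p q a)
        (rsum V R w n (\<lambda>i. rmul V R (entry_of n k i q x) (entry_of m n j i b))))"
      using b x j by (intro rsum_cong refl) (simp add: entry_ract_pow[where w = w])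
    also have "\<dots> = rsum V R w n (\<lambda>i. rmul V R
        (rsum V R w k (\<lambda>q. rmul V R (entry_of l k p q a) (entry_of n k i q x))) (entry_of m n j i b))"
      by (rule rsum_assoc[symmetric]) (use a b x j p w in simp_all)
    also have "\<dots> = rsum V R w n (\<lambda>i. rmul V R (entry_of n l i p ?x) (entry_of m n j i b))"
      using a x p by (intro rsum_cong refl) (simp add: pproj_scalars_pow[where w = w] pproj_lact[where w = w])
    also have "\<dots> = entry_of m l j p (ap ?ln ?lm (ract_pow l n m \<cdot> b) ?x)"
      using b x' j p by (simp add: entry_ract_pow[where w = w])
    finally show "entry_of m l j p (ap ?km ?lm (FArr (scalars_pow m) k l \<cdot> a) ?y) =
      entry_of m l j p (ap ?ln ?lm (ract_pow l n m \<cdot> b) ?x)" .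
  qed (use a b y x' in simp_all)
  then show "ap (FObj (scalars_pow m) k) (FObj (scalars_pow m) l) (FArr (scalars_pow m) k l \<cdot> a)
      (ap (FObj (scalars_pow n) k) (FObj (scalars_pow m) k) (ract_pow k n m \<cdot> b) x) =
    ap (FObj (scalars_pow n) l) (FObj (scalars_pow m) l) (ract_pow l n m \<cdot> b)
      (ap (FObj (scalars_pow n) k) (FObj (scalars_pow n) l) (FArr (scalars_pow n) k l \<cdot> a) x)"
    by simp
qed simp_all

text \<open>The morphism from \<open>k\<close> to \<open>1\<close> that is a standard basis row acts by extracting a component, so
  on the \<open>n\<close>-th power it extracts a column.\<close>

lemma scalars_pow_basis:
  assumes x: "x \<in> hom V w (pow V (pow V X k) n)" and q: "q < k"
  shows "ap (pow V (pow V X k) n) (pow V X n) (FArr (scalars_pow n) k 1 \<cdot> basis w k q) x = col k n q x"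
proof (rule pow_ext[of _ w X n])
  have w: "w \<in> Obj V" using x by auto
  show "pproj V X n i \<cdot> ap (pow V (pow V X k) n) (pow V X n) (FArr (scalars_pow n) k 1 \<cdot> basis w k q) x =
    pproj V X n i \<cdot> col k n q x" if i: "i < n" for i
    using pproj_scalars_pow[of "basis w k q" w k 1 x n i]
      pproj_lact[of "basis w k q" w k 1 "pproj V (pow V X k) n i \<cdot> x" 0]
      rmul_delta(1)[of k "\<lambda>p. entry_of n k i p x" w q] x w i q by simp
qed (use x q in auto)

text \<open>Naturality at the basis row \<open>q\<close>, which acts by extracting column \<open>q\<close>: the whole family is
  determined by its component at \<open>1\<close>.\<close>

lemma natural_col:
  assumes nat: "vnatural_family V (Mat V R) (self V) (scalars_pow n) (scalars_pow m) z \<phi>"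
    and s: "s \<in> hom V w z" and x: "x \<in> hom V w (pow V (pow V X k) n)" and q: "q < k"
  shows "col k m q (ap (pow V (pow V X k) n) (pow V (pow V X k) m) (\<phi> k \<cdot> s) x) =
    ap (pow V X n) (pow V X m) (\<phi> 1 \<cdot> s) (col k n q x)"
proof -
  note nf = nat[unfolded natural_family_iff[OF graph_map_scalars_pow graph_map_scalars_pow]]
  have w: "w \<in> Obj V" using x by auto
  have \<phi>: "\<phi> k \<in> hom V z (IHom V (pow V (pow V X k) n) (pow V (pow V X k) m))" for k
    using nf by simp
  let ?y = "ap (pow V (pow V X k) n) (pow V (pow V X k) m) (\<phi> k \<cdot> s) x"
  have "basis w k q \<in> hom V w (VHom (Mat V R) k 1)" "x \<in> hom V w (FObj (scalars_pow n) k)"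
    using w x by simp_all
  then have "ap (FObj (scalars_pow m) k) (FObj (scalars_pow m) 1) (FArr (scalars_pow m) k 1 \<cdot> basis w k q)
      (ap (FObj (scalars_pow n) k) (FObj (scalars_pow m) k) (\<phi> k \<cdot> s) x) =
    ap (FObj (scalars_pow n) 1) (FObj (scalars_pow m) 1) (\<phi> 1 \<cdot> s)
      (ap (FObj (scalars_pow n) k) (FObj (scalars_pow n) 1) (FArr (scalars_pow n) k 1 \<cdot> basis w k q) x)"
    using nf s unfolding Mat_simps by blast
  then show ?thesis
    using scalars_pow_basis[OF x q] scalars_pow_basis[of ?y w k m q] \<phi>[of k] s x q by simp
qed

text \<open>Left linearity, in the form of compatibility with the expansion of \<open>v\<close> in the standard basis.
  It is naturality at \<open>v\<close>, regarded as a morphism from \<open>n\<close> to \<open>1\<close>, evaluated at the identity matrix: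
  the action of \<open>v\<close> takes the identity matrix to \<open>v\<close>, and the columns of the identity matrix are
  the basis vectors.\<close>

lemma natural_linear:
  assumes nat: "vnatural_family V (Mat V R) (self V) (scalars_pow n) (scalars_pow m) z \<phi>"
    and s: "s \<in> hom V w z" and v: "v \<in> hom V w (pow V X n)" and j: "j < m"
  shows "pproj V X m j \<cdot> ap (pow V X n) (pow V X m) (\<phi> 1 \<cdot> s) v =
    rsum V R w n (\<lambda>q. rmul V R (pproj V X n q \<cdot> v)
      (pproj V X m j \<cdot> ap (pow V X n) (pow V X m) (\<phi> 1 \<cdot> s) (basis w n q)))"
proof -
  note nf = nat[unfolded natural_family_iff[OF graph_map_scalars_pow graph_map_scalars_pow]]
  have w: "w \<in> Obj V" using v by auto
  have \<phi>: "\<phi> k \<in> hom V z (IHom V (pow V (pow V X k) n) (pow V (pow V X k) m))" for k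
    using nf by simp
  define I where "I = VIdt (Mat V R) n \<cdot> bang V w"
  have I: "I \<in> hom V w (pow V (pow V X n) n)" using w by (simp add: I_def)
  have elI: "entry_of n n i l I = (if i = l then rone V R w else rzero V R w)" if "i < n" "l < n" for i l
    unfolding I_def by (rule entry_VIdt) (use w that in simp_all)
  have colI: "col n n q I = basis w n q" if q: "q < n" for q
    by (rule pow_ext[of _ w X n]) (use I q w elI in simp_all)
  let ?y = "ap (pow V (pow V X n) n) (pow V (pow V X n) m) (\<phi> n \<cdot> s) I"
  have y: "?y \<in> hom V w (pow V (pow V X n) m)" using \<phi>[of n] s I by simp
  have vI: "ap (pow V (pow V X n) n) (pow V X n) (FArr (scalars_pow n) n 1 \<cdot> v) I = v"
  proof (rule pow_ext[of _ w X n])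
    show "pproj V X n i \<cdot> ap (pow V (pow V X n) n) (pow V X n) (FArr (scalars_pow n) n 1 \<cdot> v) I = pproj V X n i \<cdot> v"
      if i: "i < n" for i
      using pproj_scalars_pow[of v w n 1 I n i] pproj_lact[of v w n 1 "pproj V (pow V X n) n i \<cdot> I" 0]
        rmul_delta(2)[of n "\<lambda>p. pproj V X n p \<cdot> v" w i] I v w i elI by (simp add: eq_commute[of i])
  qed (use I v in simp_all)
  have "v \<in> hom V w (VHom (Mat V R) n 1)" "I \<in> hom V w (FObj (scalars_pow n) n)"
    using v I by simp_all
  then have "ap (FObj (scalars_pow m) n) (FObj (scalars_pow m) 1) (FArr (scalars_pow m) n 1 \<cdot> v)
      (ap (FObj (scalars_pow n) n) (FObj (scalars_pow m) n) (\<phi> n \<cdot> s) I) =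
    ap (FObj (scalars_pow n) 1) (FObj (scalars_pow m) 1) (\<phi> 1 \<cdot> s)
      (ap (FObj (scalars_pow n) n) (FObj (scalars_pow n) 1) (FArr (scalars_pow n) n 1 \<cdot> v) I)"
    using nf s unfolding Mat_simps by blast
  then have "pproj V X m j \<cdot> ap (pow V X n) (pow V X m) (\<phi> 1 \<cdot> s) v =
    pproj V X m j \<cdot> ap (pow V (pow V X n) m) (pow V X m) (FArr (scalars_pow m) n 1 \<cdot> v) ?y"
    using vI by simp
  also have "\<dots> = rsum V R w n (\<lambda>q. rmul V R (pproj V X n q \<cdot> v) (entry_of m n j q ?y))"
    using pproj_scalars_pow[of v w n 1 ?y m j] pproj_lact[of v w n 1 "pproj V (pow V X n) m j \<cdot> ?y" 0] v y j
    by simp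
  also have "\<dots> = rsum V R w n (\<lambda>q. rmul V R (pproj V X n q \<cdot> v) (pproj V X m j \<cdot> col n m q ?y))"
    using y j by (intro rsum_cong refl) simp
  also have "\<dots> = rsum V R w n (\<lambda>q. rmul V R (pproj V X n q \<cdot> v)
      (pproj V X m j \<cdot> ap (pow V X n) (pow V X m) (\<phi> 1 \<cdot> s) (basis w n q)))"
    using natural_col[OF nat s I] colI by (intro rsum_cong refl) simp
  finally show ?thesis .
qed

text \<open>A natural family is right multiplication by the matrix whose columns are the values of its
  component at \<open>1\<close> on the standard basis. By linearity the two agree at \<open>1\<close>, hence everywhere, as
  both are determined by their components at \<open>1\<close>. The matrix is unique because the right action is
  faithful.\<close>

lemma is_nat_object_ract_pow:
  "is_nat_object V (Mat V R) (self V) (scalars_pow n) (scalars_pow m) (pow V (pow V X n) m) (\<lambda>k. ract_pow k n m)"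
  unfolding is_nat_object_def
proof (intro conjI allI impI ract_pow_natural)
  fix z \<phi> assume nat: "vnatural_family V (Mat V R) (self V) (scalars_pow n) (scalars_pow m) z \<phi>"
  note nf = nat[unfolded natural_family_iff[OF graph_map_scalars_pow graph_map_scalars_pow]]
  have z: "z \<in> Obj V" using nf by simp
  have \<phi>: "\<phi> k \<in> hom V z (IHom V (pow V (pow V X k) n) (pow V (pow V X k) m))" for k
    using nf by simp
  have \<phi>1: "\<phi> 1 \<in> hom V z (IHom V (pow V X n) (pow V X m))" using \<phi>[of 1] by simp
  (* the matrix of the component at 1 in the standard basis *)
  define b where "b = mk_mat V R z m n (\<lambda>j i. pproj V X m j \<cdot> ap (pow V X n) (pow V X m) (\<phi> 1) (basis z n i))"
  have b: "b \<in> hom V z (pow V (pow V X n) m)"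
    using \<phi>1 z by (simp add: b_def)
  have elb: "entry_of m n j i (b \<cdot> s) = pproj V X m j \<cdot> ap (pow V X n) (pow V X m) (\<phi> 1 \<cdot> s) (basis w n i)"
    if "s \<in> hom V w z" "j < m" "i < n" for j i s w
    using \<phi>1 z that by (simp add: b_def)
  have act: "ap (pow V X n) (pow V X m) (ract n m \<cdot> b \<cdot> s) v = ap (pow V X n) (pow V X m) (\<phi> 1 \<cdot> s) v"
    if s: "s \<in> hom V w z" and v: "v \<in> hom V w (pow V X n)" for w s v
  proof (rule pow_ext[of _ w X m])
    fix j assume j: "j < m"
    show "pproj V X m j \<cdot> ap (pow V X n) (pow V X m) (ract n m \<cdot> b \<cdot> s) v =
      pproj V X m j \<cdot> ap (pow V X n) (pow V X m) (\<phi> 1 \<cdot> s) v"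
      unfolding natural_linear[OF nat s v j]
      using pproj_ract[of "b \<cdot> s" w n m v j] elb[OF s] b s v j by simp
  qed (use b s v \<phi>1 in simp_all)
  have "ract_pow k n m \<cdot> b = \<phi> k" for k
  proof (rule ract_pow_ext)
    fix w s x q assume s: "s \<in> hom V w z" and x: "x \<in> hom V w (pow V (pow V X k) n)" and q: "q < k"
    show "col k m q (ap (pow V (pow V X k) n) (pow V (pow V X k) m) ((ract_pow k n m \<cdot> b) \<cdot> s) x) =
      col k m q (ap (pow V (pow V X k) n) (pow V (pow V X k) m) (\<phi> k \<cdot> s) x)"
      using natural_col[OF nat s x q] col_ract_pow[of "b \<cdot> s" w n m x k q] act[OF s, of "col k n q x"] b s x q
      by simp
  qed (use b \<phi> in simp_all)
  moreover have "h = b" if "h \<in> hom V z (pow V (pow V X n) m)" "\<forall>k \<in> VObj (Mat V R). ract_pow k n m \<cdot> h = \<phi> k" for h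
  proof (rule ract_mono[OF that(1) b])
    show "ract n m \<cdot> h = ract n m \<cdot> b"
      using that(2) \<open>ract_pow _ n m \<cdot> b = _\<close>[of 1] ract_pow_1[of n m] by (metis Mat_simps(1) UNIV_I)
  qed
  ultimately show "\<exists>!h. h \<in> hom V z (pow V (pow V X n) m) \<and> (\<forall>k \<in> VObj (Mat V R). ract_pow k n m \<cdot> h = \<phi> k)"
    using b by blast
qed

end

section \<open>The commutant of the theory of left modules\<close>

context rig_in_ccc
begin

abbreviation nat_hom :: "nat \<Rightarrow> nat \<Rightarrow> 'o" where
  "nat_hom n m \<equiv> alg_hom V (Mat V R) (scalars_pow n) (scalars_pow m)"

abbreviation nat_ev :: "nat \<Rightarrow> nat \<Rightarrow> nat \<Rightarrow> 'm" where
  "nat_ev n m \<equiv> alg_ev V (Mat V R) (scalars_pow n) (scalars_pow m)"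

abbreviation natural :: "nat \<Rightarrow> nat \<Rightarrow> 'o \<Rightarrow> (nat \<Rightarrow> 'm) \<Rightarrow> bool" where
  "natural n m \<equiv> vnatural_family V (Mat V R) (self V) (scalars_pow n) (scalars_pow m)"

abbreviation nat_lift :: "nat \<Rightarrow> nat \<Rightarrow> 'o \<Rightarrow> (nat \<Rightarrow> 'm) \<Rightarrow> 'm" where
  "nat_lift n m \<equiv> alg_lift V (Mat V R) (scalars_pow n) (scalars_pow m)"

text \<open>The object of natural transformations in \<open>Alg\<close> is an unspecified choice; the matrix objects
  witness that there is something to choose.\<close>

lemma is_nat_object_nat_hom:
  "is_nat_object V (Mat V R) (self V) (scalars_pow n) (scalars_pow m) (nat_hom n m) (nat_ev n m)"
proof -
  have "\<exists>p. is_nat_object V (Mat V R) (self V) (scalars_pow n) (scalars_pow m) (fst p) (snd p)"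
    by (rule exI[of _ "(pow V (pow V X n) m, \<lambda>k. ract_pow k n m)"]) (simp add: is_nat_object_ract_pow)
  then show ?thesis
    unfolding alg_hom_def alg_ev_def alg_hom_data_def by (rule someI_ex)
qed

lemma nat_ev_natural: "natural n m (nat_hom n m) (nat_ev n m)"
  using is_nat_object_nat_hom by (simp add: is_nat_object_def)

lemma nat_ev_arr [simp]:
  "nat_hom n m \<in> Obj V" "nat_ev n m k \<in> Arr V" "Dom V (nat_ev n m k) = nat_hom n m"
  "Cod V (nat_ev n m k) = IHom V (pow V (pow V X k) n) (pow V (pow V X k) m)"
  using nat_ev_natural[of n m] unfolding vnatural_family_def by simp_all

lemma nat_lift_ex1:
  assumes "natural n m z \<phi>"
  shows "\<exists>!h. h \<in> hom V z (nat_hom n m) \<and> (\<forall>k. nat_ev n m k \<cdot> h = \<phi> k)"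
  using is_nat_object_nat_hom[of n m] assms unfolding is_nat_object_def by simp

lemma nat_lift_props:
  assumes "natural n m z \<phi>"
  shows "nat_lift n m z \<phi> \<in> hom V z (nat_hom n m)" "nat_ev n m k \<cdot> nat_lift n m z \<phi> = \<phi> k"
  using theI'[OF nat_lift_ex1[OF assms]] unfolding alg_lift_def by simp_all

lemma nat_hom_ext:
  assumes "h \<in> hom V z (nat_hom n m)" "h' \<in> hom V z (nat_hom n m)"
    and "\<And>k. nat_ev n m k \<cdot> h = nat_ev n m k \<cdot> h'"
  shows "h = h'"
proof -
  have "natural n m z (\<lambda>k. nat_ev n m k \<cdot> h)"
    by (rule natural_family_reindex[OF graph_map_scalars_pow graph_map_scalars_pow nat_ev_natural assms(1)])
  from nat_lift_ex1[OF this] show ?thesis using assms by metis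
qed

abbreviation comm :: "('o, 'm) vtheory" where
  "comm \<equiv> commutant_theory V (Mat V R) scalars"

lemma comm_simps [simp]:
  "VObj comm = UNIV" "VHom comm n m = nat_hom n m"
  by (simp_all add: commutant_theory_def Alg_def)

lemma comm_VCmp:
  "VCmp comm n m l \<in> hom V (Prd V (nat_hom m l) (nat_hom n m)) (nat_hom n l)"
  "nat_ev n l k \<cdot> VCmp comm n m l =
    vcomp V (self V) (pow V (pow V X k) n) (pow V (pow V X k) m) (pow V (pow V X k) l)
      (nat_ev m l k \<cdot> Pr1 V (nat_hom m l) (nat_hom n m)) (nat_ev n m k \<cdot> Pr2 V (nat_hom m l) (nat_hom n m))"
proof -
  let ?P = "Prd V (nat_hom m l) (nat_hom n m)"
  let ?\<phi> = "\<lambda>k. vcomp V (self V) (FObj (scalars_pow n) k) (FObj (scalars_pow m) k) (FObj (scalars_pow l) k)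
      (nat_ev m l k \<cdot> Pr1 V (nat_hom m l) (nat_hom n m)) (nat_ev n m k \<cdot> Pr2 V (nat_hom m l) (nat_hom n m))"
  have eq: "VCmp comm n m l = nat_lift n l ?P ?\<phi>"
    by (simp add: commutant_theory_def Alg_def Let_def)
  have nat: "natural n l ?P ?\<phi>"
    by (rule natural_family_vcomp[OF graph_map_scalars_pow graph_map_scalars_pow graph_map_scalars_pow])
      (rule natural_family_reindex[OF graph_map_scalars_pow graph_map_scalars_pow nat_ev_natural], simp)+
  show "VCmp comm n m l \<in> hom V ?P (nat_hom n l)"
    "nat_ev n l k \<cdot> VCmp comm n m l =
    vcomp V (self V) (pow V (pow V X k) n) (pow V (pow V X k) m) (pow V (pow V X k) l)
      (nat_ev m l k \<cdot> Pr1 V (nat_hom m l) (nat_hom n m)) (nat_ev n m k \<cdot> Pr2 V (nat_hom m l) (nat_hom n m))"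
    unfolding eq using nat_lift_props[OF nat] by (simp_all only: scalars_pow_FObj)
qed

lemma nat_ev_vcomp:
  assumes "b \<in> hom V z (nat_hom m l)" "a \<in> hom V z (nat_hom n m)"
  shows "nat_ev n l k \<cdot> vcomp V comm n m l b a =
    vcomp V (self V) (pow V (pow V X k) n) (pow V (pow V X k) m) (pow V (pow V X k) l)
      (nat_ev m l k \<cdot> b) (nat_ev n m k \<cdot> a)"
proof -
  have "nat_ev n l k \<cdot> vcomp V comm n m l b a = (nat_ev n l k \<cdot> VCmp comm n m l) \<cdot> pair V b a"
    unfolding vcomp_def using assms comm_VCmp(1)[of n m l] by simp
  then show ?thesis
    unfolding comm_VCmp(2) using assms by simp
qed

lemma comm_VIdt:
  "VIdt comm n \<in> hom V (Trm V) (nat_hom n n)"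
  "nat_ev n n k \<cdot> VIdt comm n = VIdt (self V) (pow V (pow V X k) n)"
  using nat_lift_props[OF natural_family_VIdt[OF graph_map_scalars_pow, of n]]
  by (simp_all add: commutant_theory_def Alg_def)

definition to_comm :: "nat \<Rightarrow> nat \<Rightarrow> 'm" where
  "to_comm n m = nat_lift n m (pow V (pow V X n) m) (\<lambda>k. ract_pow k n m)"

lemma to_comm_arr [simp]:
  "to_comm n m \<in> Arr V" "Dom V (to_comm n m) = pow V (pow V X n) m" "Cod V (to_comm n m) = nat_hom n m"
  using nat_lift_props(1)[OF ract_pow_natural, of n m] unfolding to_comm_def by simp_all

lemma nat_ev_to_comm: "nat_ev n m k \<cdot> to_comm n m = ract_pow k n m"
  unfolding to_comm_def by (rule nat_lift_props(2)[OF ract_pow_natural])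

lemma nat_ev_to_comm_comp:
  "s \<in> hom V w (pow V (pow V X n) m) \<Longrightarrow> nat_ev n m k \<cdot> to_comm n m \<cdot> s = ract_pow k n m \<cdot> s"
  using nat_ev_to_comm[of n m k, symmetric] by simp

lemma comm_TProj:
  assumes i: "i < n"
  shows "TProj comm n i = to_comm n 1 \<cdot> TProj Matop n i"
proof -
  let ?\<phi> = "\<lambda>k. name_of V (pow V (pow V X k) n) (pow V X k) (pproj V (pow V X k) n i)"
  have eq: "?\<phi> = (\<lambda>k. ract_pow k n 1 \<cdot> TProj Matop n i)"
    using ract_pow_TProj[OF i] by simp
  have nat: "natural n 1 (Trm V) ?\<phi>"
    unfolding eq
    by (rule natural_family_reindex[OF graph_map_scalars_pow graph_map_scalars_pow ract_pow_natural]) simp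
  have "TProj comm n i = nat_lift n 1 (Trm V) ?\<phi>"
    by (simp add: commutant_theory_def alg_pproj_def algebra_of_def)
  then have "TProj comm n i \<in> hom V (Trm V) (nat_hom n 1)" "nat_ev n 1 k \<cdot> TProj comm n i = ?\<phi> k" for k
    using nat_lift_props[OF nat] by simp_all
  then show ?thesis
    by - (rule nat_hom_ext[of _ "Trm V" n 1], simp_all add: nat_ev_to_comm_comp[where w = "Trm V"] ract_pow_TProj[OF i, simplified])
qed

lemma ex_nat_hom_to_matrices:
  "\<exists>H. (\<forall>n m. H n m \<in> hom V (nat_hom n m) (pow V (pow V X n) m)) \<and> (\<forall>n m k. ract_pow k n m \<cdot> H n m = nat_ev n m k)"
proof -
  have "\<exists>h. h \<in> hom V (nat_hom n m) (pow V (pow V X n) m) \<and> (\<forall>k. ract_pow k n m \<cdot> h = nat_ev n m k)" for n m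
    using is_nat_object_ract_pow[of n m] nat_ev_natural[of n m] unfolding is_nat_object_def by simp blast
  then show ?thesis by metis
qed

lemma Mat_left_in_Th_over: "Mat_left V R \<in> Obj (Th_over V X)"
  using is_theory_Mat is_theory_full[of X] is_theory_morphism_lact
  by (simp add: slice_def Th_def Mat_left_eq)

text \<open>The comparison maps are invertible, since both sides represent natural families, and they
  respect composition, identities and projections, since the right action on every power does.
  Being compatible with the components at \<open>1\<close>, they form a morphism over the full theory; the
  forgetful morphism of the commutant is the right action composed with their inverse, and so
  is a morphism of theories.\<close>

lemma isomorphic_commutant:
  "isomorphic (Th_over V X) (Mat_right V R) (commutant V X (Mat_left V R))"
proof -
  obtain H where H: "\<And>n m. H n m \<in> hom V (nat_hom n m) (pow V (pow V X n) m)"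
    and evH: "\<And>n m k. ract_pow k n m \<cdot> H n m = nat_ev n m k"
    using ex_nat_hom_to_matrices by blast
  let ?G = "\<lparr>FObj = id, FArr = to_comm\<rparr>" and ?H = "\<lparr>FObj = id, FArr = H\<rparr>"
  let ?F = "\<lparr>FObj = id, FArr = ract\<rparr>" and ?E = "\<lparr>FObj = id, FArr = \<lambda>n m. nat_ev n m 1\<rparr>"
  have GH: "to_comm n m \<cdot> H n m = Idt V (nat_hom n m)" for n m
    by (rule nat_hom_ext[of _ "nat_hom n m" n m])
      (use H[of n m] evH in \<open>simp_all add: nat_ev_to_comm_comp[where w = "nat_hom n m"]\<close>)
  have HG: "H n m \<cdot> to_comm n m = Idt V (pow V (pow V X n) m)" for n m
  proof (rule ract_mono)
    have "ract n m \<cdot> H n m \<cdot> to_comm n m = (ract_pow 1 n m \<cdot> H n m) \<cdot> to_comm n m"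
      using H[of n m] by (simp add: ract_pow_1[simplified])
    also have "\<dots> = ract n m"
      using evH[of 1 n m] nat_ev_to_comm[of n m 1] ract_pow_1[of n m] by simp
    finally show "ract n m \<cdot> H n m \<cdot> to_comm n m = ract n m \<cdot> Idt V (pow V (pow V X n) m)"
      by simp
  qed (use H[of n m] in simp_all)
  have op: "is_theory V Matop" "is_theory_morphism V Matop (full_theory V X) ?F"
    using rig_in_ccc.is_theory_Mat[OF rig_op_in] rig_in_ccc.is_theory_morphism_lact[OF rig_op_in] by simp_all
  have comm: "is_theory V comm" "is_theory_morphism V Matop comm ?G" "is_theory_morphism V comm Matop ?H"
  proof -
    have cmp: "to_comm n l \<cdot> vcomp V Matop n m l b a = vcomp V comm n m l (to_comm m l \<cdot> b) (to_comm n m \<cdot> a)"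
      if b: "b \<in> hom V z (pow V (pow V X m) l)" and a: "a \<in> hom V z (pow V (pow V X n) m)" for n m l b a z
    proof (rule nat_hom_ext[of _ z n l])
      have t: "vcomp V Matop n m l b a \<in> hom V z (pow V (pow V X n) l)"
        using vcomp_arr[OF Matop_VCmp_in] a b by simp
      have Gb: "to_comm m l \<cdot> b \<in> hom V z (nat_hom m l)" "to_comm n m \<cdot> a \<in> hom V z (nat_hom n m)"
        using a b by simp_all
      show "to_comm n l \<cdot> vcomp V Matop n m l b a \<in> hom V z (nat_hom n l)" using t by simp
      show "vcomp V comm n m l (to_comm m l \<cdot> b) (to_comm n m \<cdot> a) \<in> hom V z (nat_hom n l)"
        using vcomp_arr[of comm n m l _ z] comm_VCmp(1)[of n m l] Gb by simp
      show "nat_ev n l k \<cdot> to_comm n l \<cdot> vcomp V Matop n m l b a =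
        nat_ev n l k \<cdot> vcomp V comm n m l (to_comm m l \<cdot> b) (to_comm n m \<cdot> a)" for k
        unfolding nat_ev_vcomp[OF Gb] nat_ev_to_comm_comp[OF t] nat_ev_to_comm_comp[OF a]
          nat_ev_to_comm_comp[OF b] by (rule ract_pow_vcomp[OF b a])
    qed
    have idt: "VIdt comm n = to_comm n n \<cdot> VIdt Matop n" for n
      by (rule nat_hom_ext[of _ "Trm V" n n])
        (use comm_VIdt[of n] in \<open>simp_all add: nat_ev_to_comm_comp[where w = "Trm V"] ract_pow_VIdt\<close>)
    note transport = theory_transport[of Matop comm to_comm H, OF op(1)]
    show "is_theory V comm"
      by (rule transport(1)) (use H GH HG comm_VCmp(1) cmp idt comm_TProj in simp_all)
    show "is_theory_morphism V Matop comm ?G"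
      by (rule transport(2)) (use H GH HG comm_VCmp(1) cmp idt comm_TProj in simp_all)
    show "is_theory_morphism V comm Matop ?H"
      by (rule transport(3)) (use H GH HG comm_VCmp(1) cmp idt comm_TProj in simp_all)
  qed
  have E: "?E = vfun_comp V ?F ?H"
    using evH[of 1] ract_pow_1 by (simp add: vfun_comp_def fun_eq_iff)
  have F: "?F = vfun_comp V ?E ?G"
    using nat_ev_to_comm[of _ _ 1] ract_pow_1 by (simp add: vfun_comp_def fun_eq_iff)
  have forget: "is_theory_morphism V comm (full_theory V X) ?E"
    unfolding E by (rule theory_morphism_comp[OF comm(3) op(2) comm(1)])
  have L: "Mat_right V R = (Matop, ?F, full_theory V X)"
    using rig_in_ccc.Mat_left_eq[OF rig_op_in] by (simp add: Mat_right_eq)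
  have C: "commutant V X (Mat_left V R) = (comm, ?E, full_theory V X)"
    by (simp add: Mat_left_eq commutant_def Let_def)
  have full: "is_theory V (full_theory V X)" by (rule is_theory_full) simp
  let ?g = "(Mat_right V R, (Matop, ?G, comm), commutant V X (Mat_left V R))"
  let ?h = "(commutant V X (Mat_left V R), (comm, ?H, Matop), Mat_right V R)"
  have HGid: "vfun_comp V ?H ?G = vfun_id V Matop" "vfun_comp V ?G ?H = vfun_id V comm"
    using HG GH by (simp_all add: vfun_comp_def vfun_id_def fun_eq_iff)
  show ?thesis
    unfolding isomorphic_def
  proof (intro conjI bexI)
    show "Mat_right V R \<in> Obj (Th_over V X)" "commutant V X (Mat_left V R) \<in> Obj (Th_over V X)"
      unfolding L C using op comm full forget by (simp_all add: slice_def Th_def)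
    show "?g \<in> hom (Th_over V X) (Mat_right V R) (commutant V X (Mat_left V R))"
      "?h \<in> hom (Th_over V X) (commutant V X (Mat_left V R)) (Mat_right V R)"
      unfolding L C using op comm full forget E F by (simp_all add: slice_def Th_def)
    show "?h \<cdot>\<^bsub>Th_over V X\<^esub> ?g = Idt (Th_over V X) (Mat_right V R)"
      "?g \<cdot>\<^bsub>Th_over V X\<^esub> ?h = Idt (Th_over V X) (commutant V X (Mat_left V R))"
      unfolding L C using HGid by (simp_all add: slice_def Th_def)
  qed
qed

end

theorem theorem7p2:
  fixes V :: "('o, 'm) ccc" and R :: "('o, 'm) rig"
  assumes "base_category V" and "rig_in V R"
  shows "mutual_commutants V (Car R) (Mat_left V R) (Mat_right V R)"
proof -
  interpret base_category V by fact
  interpret R: rig_in_ccc V R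
    using assms(2) cartesian_closed_axioms by (simp add: rig_in_ccc_def)
  interpret op: rig_in_ccc V "rig_op V R" by (rule R.rig_op_in)
  have "Mat_right V (rig_op V R) = Mat_left V R"
    using op.Mat_right_eq R.rig_op_op by simp
  then show ?thesis
    unfolding mutual_commutants_def
    using R.Mat_left_in_Th_over op.Mat_left_in_Th_over R.isomorphic_commutant op.isomorphic_commutant
    by (simp add: R.Mat_right_eq)
qed

end
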